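(* Let $\mathcal A$ be a weakly cancellative commutative Banach algebra with dense principal ideals, let $T=(T(t))_{t>0}$ be a strongly continuous semigroup of multipliers on $\mathcal A$ such that $T(t)\mathcal A$ is dense in $\mathcal A$ for $t>0$, and let $\mathcal B$ be a normalization of $\mathcal A$ with respect to $T$. Set $Res_{ar}(\Delta_T)=\mathbb C\setminus\sigma_{ar}(\Delta_{T,\mathcal I_T})$. Then the quasimultiplier $\lambda I-\Delta_T\in\mathcal{QM}(\mathcal A)$ admits an inverse $(\lambda I-\Delta_T)^{-1}\in\mathcal I_{T,\mathcal B}\subset\mathcal M(\mathcal B)\subset\mathcal{QM}_r(\mathcal A)$ for $\lambda\in Res_{ar}(\Delta_T)$, and the map $\lambda\mapsto(\lambda I-\Delta_T)^{-1}$ is a holomorphic map from $Res_{ar}(\Delta_T)$ into $\mathcal I_{T,\mathcal B}$. Moreover, for $\mathrm{Re}(\lambda)>\log\rho_T$, $$(\lambda I-\Delta_T)^{-1}=\int_0^{+\infty}e^{-\lambda s}T(s)\,ds\in\mathcal I_{T,\mathcal B},$$ where the Bochner integral is computed with respect to the strong operator topology on $\mathcal M(\mathcal B)$, and $$\|(\lambda I-\Delta_T)^{-1}\|_{\mathcal M(\mathcal B)}\le\int_0^{+\infty}e^{-\mathrm{Re}(\lambda)t}\|T(t)\|_{\mathcal M(\mathcal B)}\,dt.$$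
   Context: Banach algebras are complex with submultiplicative norm. A commutative Banach algebra $\mathcal A\neq\{0\}$ is weakly cancellative if $u\mathcal A\ne\{0\}$ for all $u\in\mathcal A\setminus\{0\}$; $\Omega(\mathcal A)=\{u\in\mathcal A: u\mathcal A\text{ is dense in }\mathcal A\}$; $\mathcal A$ has dense principal ideals if $\Omega(\mathcal A)\ne\emptyset$. For such $\mathcal A$, $u\in\mathcal A$, $v\in\Omega(\mathcal A)$, $S_{u/v}$ is the closed operator with domain $\{x\in\mathcal A:ux\in v\mathcal A\}$, $S_{u/v}x$ being the unique $y$ with $vy=ux$. $\mathcal{QM}(\mathcal A)$ is the algebra of all such operators (quasimultipliers), with $S_{u/v}+S_{u'/v'}=S_{(uv'+u'v)/vv'}$ and $S_{u/v}S_{u'/v'}=S_{uu'/vv'}$. A set $V\subset\mathcal{QM}(\mathcal A)$ is pseudobounded if $\sup_{S\in V}\|Su\|<\infty$ for some $u\in\Omega(\mathcal A)$ in the domain of all $S\in V$; $S$ is regular if $\{r^nS^n\}_{n\ge1}$ is pseudobounded for some $r>0$; $\mathcal{QM}_r(\mathcal A)$ is the algebra of regular quasimultipliers. $\mathcal M(\mathcal A)$ is the Banach algebra of multipliers (bounded linear $R$ with $R(uv)=(Ru)v$), identified with the quasimultipliers of domain $\mathcal A$. A continuous homomorphism $\Phi:\mathcal A\to\mathcal B$ is a $\mathcal{QM}$-homomorphism if it is injective with dense range and $\Phi(u)\mathcal B\subset\Phi(\mathcal A)$ for some $u\in\Omega(\mathcal A)$; then $\tilde\Phi:S_{u/v}\mapsto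 S_{\Phi(u)/\Phi(v)}$ is an isomorphism $\mathcal{QM}(\mathcal A)\to\mathcal{QM}(\mathcal B)$ preserving pseudoboundedness in both directions. $T$ strongly continuous: $t\mapsto T(t)u$ is continuous on $(0,\infty)$ for $u\in\mathcal A$. $\rho_T=\lim_{t\to+\infty}\|T(t)\|^{1/t}$. $\omega_T(t)=\|T(t)\|$; $L^1_{\omega_T}$ is the convolution Banach algebra of measurable $f$ on $[0,\infty)$ with $\int_0^\infty|f|\omega_T<\infty$; $\Phi_T(f)u=\int_0^\infty f(t)T(t)u\,dt$; the Arveson ideal $\mathcal I_T$ is the closure of $\Phi_T(L^1_{\omega_T})$ in $\mathcal M(\mathcal A)$ (a weakly cancellative commutative Banach algebra with dense principal ideals). With $f_0\in C^1([0,\infty))\cap\Omega(L^1_{\omega_T})$, $f_0(0)=0$, $f_0'\in L^1_{\omega_T}$ and $u_0\in\Omega(\mathcal A)$: the generator is $\Delta_T=S_{-\Phi_T(f_0')u_0/\Phi_T(f_0)u_0}\in\mathcal{QM}(\mathcal A)$, and $\Delta_{T,\mathcal I_T}=S_{-\Phi_T(f_0')/\Phi_T(f_0)}\in\mathcal{QM}(\mathcal I_T)$ (independent of choices). A character $\chi$ of $\mathcal I_T$ extends to $\mathcal{QM}(\mathcal I_T)$ by $\tilde\chi(S_{u/v})=\chi(u)/\chi(v)$; $\sigma_{ar}(\Delta_{T,\mathcal I_T})=\{\tilde\chi(\Delta_{T,\mathcal I_T}):\chi\text{ character of }\mathcal I_T\}$, empty if $\mathcal I_T$ is radical. A normalization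 of $\mathcal A$ with respect to $T$ is a subalgebra $\mathcal B$ of $\mathcal{QM}(\mathcal A)$ which is a Banach algebra for a norm $\|\cdot\|_{\mathcal B}$ such that: the inclusion $j:\mathcal A\to\mathcal B$ is a $\mathcal{QM}$-homomorphism and $\|j(u)\|_{\mathcal B}\le\|u\|_{\mathcal A}$; $\tilde j(\mathcal M(\mathcal A))\subset\mathcal M(\mathcal B)$ with $\|\tilde j(R)\|_{\mathcal M(\mathcal B)}\le\|R\|_{\mathcal M(\mathcal A)}$; $\limsup_{t\to0^+}\|\tilde j(T(t))\|_{\mathcal M(\mathcal B)}<\infty$. $\mathcal{QM}(\mathcal A)$ and $\mathcal{QM}(\mathcal B)$ are identified via $\tilde j$. $\mathcal I_{T,\mathcal B}$ is the closure in $\mathcal M(\mathcal B)$ of $\{\int_0^\infty f(t)T(t)\,dt:\ f\text{ measurable},\ \int_0^\infty|f(t)|\|T(t)\|_{\mathcal M(\mathcal B)}dt<\infty\}$. *)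

theory Defs
  imports "HOL-Analysis.Analysis"
begin

section \<open>Complex Banach spaces and commutative complex Banach algebras\<close>

class scaleC =
  fixes scaleC :: "complex \<Rightarrow> 'a \<Rightarrow> 'a" (infixr "*\<^sub>C" 75)

class cbanach = banach + scaleC +
  assumes scaleC_add_right: "c *\<^sub>C (x + y) = c *\<^sub>C x + c *\<^sub>C y"
    and scaleC_add_left: "(c + d) *\<^sub>C x = c *\<^sub>C x + d *\<^sub>C x"
    and scaleC_scaleC: "c *\<^sub>C (d *\<^sub>C x) = (c * d) *\<^sub>C x"
    and scaleC_of_real: "complex_of_real r *\<^sub>C x = r *\<^sub>R x"
    and norm_scaleC: "norm (c *\<^sub>C x) = cmod c * norm x"

text \<open>No unit is required. Submultiplicativity of the norm is part of \<^class>\<open>real_normed_algebra\<close>.\<close>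

class comm_cbanach_algebra = cbanach + real_normed_algebra + comm_ring +
  assumes mult_scaleC_left: "(c *\<^sub>C x) * y = c *\<^sub>C (x * y)"

lemma scaleC_one: "1 *\<^sub>C x = (x::'a::cbanach)"
  using scaleC_of_real[of 1 x] by simp

lemma bounded_linear_scaleC: "bounded_linear (\<lambda>x::'a::cbanach. c *\<^sub>C x)"
proof (rule bounded_linear_intro[where K = "cmod c"])
  fix r :: real and x :: 'a
  show "c *\<^sub>C (r *\<^sub>R x) = r *\<^sub>R (c *\<^sub>C x)"
    by (simp add: scaleC_of_real[symmetric] scaleC_scaleC mult.commute)
qed (simp_all add: scaleC_add_right norm_scaleC mult.commute)

instantiation blinfun :: (real_normed_vector, cbanach) cbanach
begin

lift_definition scaleC_blinfun :: "complex \<Rightarrow> 'a \<Rightarrow>\<^sub>L 'b \<Rightarrow> 'a \<Rightarrow>\<^sub>L 'b"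
  is "\<lambda>c f x. c *\<^sub>C f x"
  by (rule bounded_linear_compose[OF bounded_linear_scaleC])

instance
proof
  fix c d :: complex and r :: real and f g :: "'a \<Rightarrow>\<^sub>L 'b"
  show "c *\<^sub>C (f + g) = c *\<^sub>C f + c *\<^sub>C g"
    by transfer (simp add: scaleC_add_right)
  show "(c + d) *\<^sub>C f = c *\<^sub>C f + d *\<^sub>C f"
    by transfer (simp add: scaleC_add_left)
  show sc: "c *\<^sub>C (d *\<^sub>C f) = (c * d) *\<^sub>C f" for c d and f :: "'a \<Rightarrow>\<^sub>L 'b"
    by transfer (simp add: scaleC_scaleC)
  show "complex_of_real r *\<^sub>C f = r *\<^sub>R f"
    by transfer (simp add: scaleC_of_real)
  have le: "norm (c *\<^sub>C f) \<le> cmod c * norm f" for c and f :: "'a \<Rightarrow>\<^sub>L 'b"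
  proof (rule norm_blinfun_bound)
    fix x
    have "norm (blinfun_apply (c *\<^sub>C f) x) = cmod c * norm (blinfun_apply f x)"
      by (simp add: scaleC_blinfun.rep_eq norm_scaleC)
    also have "\<dots> \<le> cmod c * (norm f * norm x)"
      by (intro mult_left_mono norm_blinfun) simp
    finally show "norm (blinfun_apply (c *\<^sub>C f) x) \<le> cmod c * norm f * norm x"
      by (simp add: mult.assoc)
  qed simp
  show "norm (c *\<^sub>C f) = cmod c * norm f"
  proof (cases "c = 0")
    case True
    then show ?thesis using le[of c f] by simp
  next
    case False
    have one: "1 *\<^sub>C f = f"
      by transfer (simp add: scaleC_one)
    have "norm f = norm (inverse c *\<^sub>C (c *\<^sub>C f))"
      using False one by (simp add: sc)
    also have "\<dots> \<le> norm (c *\<^sub>C f) / cmod c"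
      using le[of "inverse c" "c *\<^sub>C f"] by (simp add: norm_inverse divide_inverse mult.commute)
    finally show ?thesis
      using le[of c f] False by (simp add: field_simps)
  qed
qed

end

section \<open>Quasimultipliers\<close>

text \<open>
  The notions below are used both for algebras given as types (carrier \<^term>\<open>UNIV\<close>) and for a closed
  algebra of operators, hence an algebra is given by a carrier \<open>C\<close> and a product \<open>m\<close>; linear
  structure and norm are those of the ambient type. Unbounded operators are represented by
  their graphs.
\<close>

definition weakly_cancellative :: "'v::cbanach set \<Rightarrow> ('v \<Rightarrow> 'v \<Rightarrow> 'v) \<Rightarrow> bool" where
  "weakly_cancellative C m \<longleftrightarrow> C \<noteq> {0} \<and> (\<forall>u\<in>C - {0}. m u ` C \<noteq> {0})"

definition Omega :: "'v::cbanach set \<Rightarrow> ('v \<Rightarrow> 'v \<Rightarrow> 'v) \<Rightarrow> 'v set" where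
  "Omega C m = {u\<in>C. C \<subseteq> closure (m u ` C)}"

definition dense_principal_ideals :: "'v::cbanach set \<Rightarrow> ('v \<Rightarrow> 'v \<Rightarrow> 'v) \<Rightarrow> bool" where
  "dense_principal_ideals C m \<longleftrightarrow> Omega C m \<noteq> {}"

text \<open>The graph of \<open>S\<^bsub>u/v\<^esub>\<close>: the pairs \<open>(x, y)\<close> with \<open>v y = u x\<close>.\<close>

definition qm :: "'v::cbanach set \<Rightarrow> ('v \<Rightarrow> 'v \<Rightarrow> 'v) \<Rightarrow> 'v \<Rightarrow> 'v \<Rightarrow> ('v \<times> 'v) set" where
  "qm C m u v = {(x, y). x \<in> C \<and> y \<in> C \<and> m v y = m u x}"

definition QM :: "'v::cbanach set \<Rightarrow> ('v \<Rightarrow> 'v \<Rightarrow> 'v) \<Rightarrow> ('v \<times> 'v) set set" where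
  "QM C m = {qm C m u v | u v. u \<in> C \<and> v \<in> Omega C m}"

definition qm_add ::
  "'v::cbanach set \<Rightarrow> ('v \<Rightarrow> 'v \<Rightarrow> 'v) \<Rightarrow> ('v \<times> 'v) set \<Rightarrow> ('v \<times> 'v) set \<Rightarrow> ('v \<times> 'v) set" where
  "qm_add C m S S' = (THE R. \<exists>u\<in>C. \<exists>v\<in>Omega C m. \<exists>u'\<in>C. \<exists>v'\<in>Omega C m.
     S = qm C m u v \<and> S' = qm C m u' v' \<and> R = qm C m (m u v' + m u' v) (m v v'))"

definition qm_mult ::
  "'v::cbanach set \<Rightarrow> ('v \<Rightarrow> 'v \<Rightarrow> 'v) \<Rightarrow> ('v \<times> 'v) set \<Rightarrow> ('v \<times> 'v) set \<Rightarrow> ('v \<times> 'v) set" where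
  "qm_mult C m S S' = (THE R. \<exists>u\<in>C. \<exists>v\<in>Omega C m. \<exists>u'\<in>C. \<exists>v'\<in>Omega C m.
     S = qm C m u v \<and> S' = qm C m u' v' \<and> R = qm C m (m u u') (m v v'))"

definition qm_scale ::
  "'v::cbanach set \<Rightarrow> ('v \<Rightarrow> 'v \<Rightarrow> 'v) \<Rightarrow> complex \<Rightarrow> ('v \<times> 'v) set \<Rightarrow> ('v \<times> 'v) set" where
  "qm_scale C m c S = (THE R. \<exists>u\<in>C. \<exists>v\<in>Omega C m. S = qm C m u v \<and> R = qm C m (c *\<^sub>C u) v)"

text \<open>The unit \<open>I = S\<^bsub>v/v\<^esub>\<close>.\<close>

definition qm_one :: "'v::cbanach set \<Rightarrow> ('v \<times> 'v) set" where
  "qm_one C = Id_on C"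

definition qm_power ::
  "'v::cbanach set \<Rightarrow> ('v \<Rightarrow> 'v \<Rightarrow> 'v) \<Rightarrow> ('v \<times> 'v) set \<Rightarrow> nat \<Rightarrow> ('v \<times> 'v) set" where
  "qm_power C m S n = (qm_mult C m S ^^ n) (qm_one C)"

definition qm_resolvend ::
  "'v::cbanach set \<Rightarrow> ('v \<Rightarrow> 'v \<Rightarrow> 'v) \<Rightarrow> complex \<Rightarrow> ('v \<times> 'v) set \<Rightarrow> ('v \<times> 'v) set" where
  "qm_resolvend C m \<mu> S = qm_add C m (qm_scale C m \<mu> (qm_one C)) (qm_scale C m (- 1) S)"

definition qm_invertible :: "'v::cbanach set \<Rightarrow> ('v \<Rightarrow> 'v \<Rightarrow> 'v) \<Rightarrow> ('v \<times> 'v) set \<Rightarrow> bool" where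
  "qm_invertible C m S \<longleftrightarrow> S \<in> QM C m \<and> (\<exists>W\<in>QM C m. qm_mult C m S W = qm_one C)"

definition qm_inverse :: "'v::cbanach set \<Rightarrow> ('v \<Rightarrow> 'v \<Rightarrow> 'v) \<Rightarrow> ('v \<times> 'v) set \<Rightarrow> ('v \<times> 'v) set" where
  "qm_inverse C m S = (THE W. W \<in> QM C m \<and> qm_mult C m S W = qm_one C)"

definition pseudobounded :: "'v::cbanach set \<Rightarrow> ('v \<Rightarrow> 'v \<Rightarrow> 'v) \<Rightarrow> ('v \<times> 'v) set set \<Rightarrow> bool" where
  "pseudobounded C m V \<longleftrightarrow> V \<subseteq> QM C m \<and>
     (\<exists>u\<in>Omega C m. (\<forall>S\<in>V. u \<in> Domain S) \<and> bounded {y. \<exists>S\<in>V. (u, y) \<in> S})"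

definition QM_reg :: "'v::cbanach set \<Rightarrow> ('v \<Rightarrow> 'v \<Rightarrow> 'v) \<Rightarrow> ('v \<times> 'v) set set" where
  "QM_reg C m = {S\<in>QM C m. \<exists>r>0. pseudobounded C m
     {qm_scale C m (complex_of_real (r ^ n)) (qm_power C m S n) | n. n \<ge> 1}}"

section \<open>Multipliers, homomorphisms, characters\<close>

text \<open>The norm of \<open>'a \<Rightarrow>\<^sub>L 'a\<close> is the operator norm, i.e. the norm of the Banach algebra of multipliers.\<close>

definition multipliers :: "('a::comm_cbanach_algebra \<Rightarrow>\<^sub>L 'a) set" where
  "multipliers = {R. (\<forall>c u. blinfun_apply R (c *\<^sub>C u) = c *\<^sub>C blinfun_apply R u) \<and>
     (\<forall>u v. blinfun_apply R (u * v) = blinfun_apply R u * v)}"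

definition graph_of :: "('a \<Rightarrow> 'a) \<Rightarrow> ('a \<times> 'a) set" where
  "graph_of g = {(x, y). y = g x}"

definition algebra_hom :: "('a::comm_cbanach_algebra \<Rightarrow> 'b::comm_cbanach_algebra) \<Rightarrow> bool" where
  "algebra_hom \<Phi> \<longleftrightarrow> (\<forall>x y. \<Phi> (x + y) = \<Phi> x + \<Phi> y) \<and> (\<forall>c x. \<Phi> (c *\<^sub>C x) = c *\<^sub>C \<Phi> x) \<and>
     (\<forall>x y. \<Phi> (x * y) = \<Phi> x * \<Phi> y)"

definition QM_hom :: "('a::comm_cbanach_algebra \<Rightarrow> 'b::comm_cbanach_algebra) \<Rightarrow> bool" where
  "QM_hom \<Phi> \<longleftrightarrow> algebra_hom \<Phi> \<and> continuous_on UNIV \<Phi> \<and> inj \<Phi> \<and> closure (range \<Phi>) = UNIV \<and>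
     (\<exists>u\<in>Omega UNIV (*). range (\<lambda>b. \<Phi> u * b) \<subseteq> range \<Phi>)"

definition qm_ext ::
  "('a::comm_cbanach_algebra \<Rightarrow> 'b::comm_cbanach_algebra) \<Rightarrow> ('a \<times> 'a) set \<Rightarrow> ('b \<times> 'b) set" where
  "qm_ext \<Phi> S = (THE R. \<exists>u. \<exists>v\<in>Omega UNIV (*).
     S = qm UNIV (*) u v \<and> R = qm UNIV (*) (\<Phi> u) (\<Phi> v))"

definition is_character :: "'v::cbanach set \<Rightarrow> ('v \<Rightarrow> 'v \<Rightarrow> 'v) \<Rightarrow> ('v \<Rightarrow> complex) \<Rightarrow> bool" where
  "is_character C m \<phi> \<longleftrightarrow>
     (\<forall>x\<in>C. \<forall>y\<in>C. \<phi> (x + y) = \<phi> x + \<phi> y) \<and> (\<forall>c. \<forall>x\<in>C. \<phi> (c *\<^sub>C x) = c * \<phi> x) \<and>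
     (\<forall>x\<in>C. \<forall>y\<in>C. \<phi> (m x y) = \<phi> x * \<phi> y) \<and> (\<exists>x\<in>C. \<phi> x \<noteq> 0)"

definition character_ext ::
  "'v::cbanach set \<Rightarrow> ('v \<Rightarrow> 'v \<Rightarrow> 'v) \<Rightarrow> ('v \<Rightarrow> complex) \<Rightarrow> ('v \<times> 'v) set \<Rightarrow> complex" where
  "character_ext C m \<phi> S = (THE z. \<exists>u\<in>C. \<exists>v\<in>Omega C m. S = qm C m u v \<and> z = \<phi> u / \<phi> v)"

section \<open>Bochner integrals\<close>

text \<open>
  This is \<^const>\<open>Bochner_Integration.has_bochner_integral\<close> without the restriction to second
  countable target spaces. The approximating functions are finitely valued, so the integrands
  \<^term>\<open>norm (F x - s i x)\<close> are measurable in non-separable spaces too.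
\<close>

definition has_Bochner_integral :: "'s measure \<Rightarrow> ('s \<Rightarrow> 'v::banach) \<Rightarrow> 'v \<Rightarrow> bool" where
  "has_Bochner_integral M F I \<longleftrightarrow> F \<in> borel_measurable M \<and>
     (\<exists>s. (\<forall>i::nat. Bochner_Integration.simple_bochner_integrable M (s i)) \<and>
          (\<lambda>i. \<integral>\<^sup>+ x. ennreal (norm (F x - s i x)) \<partial>M) \<longlonglongrightarrow> 0 \<and>
          (\<lambda>i. Bochner_Integration.simple_bochner_integral M (s i)) \<longlonglongrightarrow> I)"

definition Bochner_integral :: "'s measure \<Rightarrow> ('s \<Rightarrow> 'v::banach) \<Rightarrow> 'v" where
  "Bochner_integral M F = (THE I. has_Bochner_integral M F I)"

section \<open>Semigroups of multipliers\<close>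

text \<open>Semigroups are indexed by \<open>t > 0\<close>; the value at other \<open>t\<close> is irrelevant throughout.\<close>

definition half_line :: "real measure" where
  "half_line = lebesgue_on {0<..}"

definition multiplier_semigroup :: "(real \<Rightarrow> 'a::comm_cbanach_algebra \<Rightarrow>\<^sub>L 'a) \<Rightarrow> bool" where
  "multiplier_semigroup T \<longleftrightarrow> (\<forall>t>0. T t \<in> multipliers) \<and>
     (\<forall>s>0. \<forall>t>0. T (s + t) = T s o\<^sub>L T t)"

definition strongly_continuous :: "(real \<Rightarrow> 'a::comm_cbanach_algebra \<Rightarrow>\<^sub>L 'a) \<Rightarrow> bool" where
  "strongly_continuous T \<longleftrightarrow> (\<forall>u. continuous_on {0<..} (\<lambda>t. blinfun_apply (T t) u))"

definition growth_rate :: "(real \<Rightarrow> 'a::comm_cbanach_algebra \<Rightarrow>\<^sub>L 'a) \<Rightarrow> real" where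
  "growth_rate T = Lim at_top (\<lambda>t. norm (T t) powr (1 / t))"

definition ereal_log :: "real \<Rightarrow> ereal" where
  "ereal_log r = (if r = 0 then - \<infinity> else ereal (ln r))"

text \<open>Functions in the weighted space are not quotiented by null functions.\<close>

definition L1w :: "(real \<Rightarrow> real) \<Rightarrow> (real \<Rightarrow> complex) set" where
  "L1w \<omega> = {f. f \<in> borel_measurable half_line \<and>
     (\<integral>\<^sup>+ t. ennreal (cmod (f t) * \<omega> t) \<partial>half_line) < \<infinity>}"

definition convol :: "(real \<Rightarrow> complex) \<Rightarrow> (real \<Rightarrow> complex) \<Rightarrow> real \<Rightarrow> complex" where
  "convol f g t = (LINT s|lebesgue_on {0..t}. f (t - s) * g s)"

definition Omega_L1w :: "(real \<Rightarrow> real) \<Rightarrow> (real \<Rightarrow> complex) set" where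
  "Omega_L1w \<omega> = {f\<in>L1w \<omega>. \<forall>g\<in>L1w \<omega>. \<forall>\<epsilon>>0. \<exists>h\<in>L1w \<omega>.
     (\<integral>\<^sup>+ t. ennreal (cmod (convol f h t - g t) * \<omega> t) \<partial>half_line) < ennreal \<epsilon>}"

definition deriv_ray :: "(real \<Rightarrow> complex) \<Rightarrow> real \<Rightarrow> complex" where
  "deriv_ray f t = vector_derivative f (at t within {0..})"

definition C1_ray :: "(real \<Rightarrow> complex) \<Rightarrow> bool" where
  "C1_ray f \<longleftrightarrow> (\<forall>t\<ge>0. f differentiable (at t within {0..})) \<and> continuous_on {0..} (deriv_ray f)"

definition weight :: "(real \<Rightarrow> 'a::comm_cbanach_algebra \<Rightarrow>\<^sub>L 'a) \<Rightarrow> real \<Rightarrow> real" where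
  "weight T t = norm (T t)"

definition Phi ::
  "(real \<Rightarrow> 'a::comm_cbanach_algebra \<Rightarrow>\<^sub>L 'a) \<Rightarrow> (real \<Rightarrow> complex) \<Rightarrow> 'a \<Rightarrow>\<^sub>L 'a" where
  "Phi T f = Blinfun (\<lambda>u. Bochner_integral half_line (\<lambda>t. f t *\<^sub>C blinfun_apply (T t) u))"

definition arveson_ideal ::
  "(real \<Rightarrow> 'a::comm_cbanach_algebra \<Rightarrow>\<^sub>L 'a) \<Rightarrow> ('a \<Rightarrow>\<^sub>L 'a) set" where
  "arveson_ideal T = closure (Phi T ` L1w (weight T))"

text \<open>The functions \<open>f\<^sub>0\<close> allowed in the definition of the generator, which does not depend on them.\<close>

definition generating_function ::
  "(real \<Rightarrow> 'a::comm_cbanach_algebra \<Rightarrow>\<^sub>L 'a) \<Rightarrow> (real \<Rightarrow> complex) \<Rightarrow> bool" where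
  "generating_function T f\<^sub>0 \<longleftrightarrow> C1_ray f\<^sub>0 \<and> f\<^sub>0 \<in> Omega_L1w (weight T) \<and> f\<^sub>0 0 = 0 \<and>
     deriv_ray f\<^sub>0 \<in> L1w (weight T)"

definition generator ::
  "(real \<Rightarrow> 'a::comm_cbanach_algebra \<Rightarrow>\<^sub>L 'a) \<Rightarrow> (real \<Rightarrow> complex) \<Rightarrow> 'a \<Rightarrow> ('a \<times> 'a) set" where
  "generator T f\<^sub>0 u\<^sub>0 =
     qm UNIV (*) (- blinfun_apply (Phi T (deriv_ray f\<^sub>0)) u\<^sub>0) (blinfun_apply (Phi T f\<^sub>0) u\<^sub>0)"

definition arveson_generator ::
  "(real \<Rightarrow> 'a::comm_cbanach_algebra \<Rightarrow>\<^sub>L 'a) \<Rightarrow> (real \<Rightarrow> complex) \<Rightarrow>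
     (('a \<Rightarrow>\<^sub>L 'a) \<times> ('a \<Rightarrow>\<^sub>L 'a)) set" where
  "arveson_generator T f\<^sub>0 =
     qm (arveson_ideal T) blinfun_compose (- Phi T (deriv_ray f\<^sub>0)) (Phi T f\<^sub>0)"

definition sigma_ar ::
  "(real \<Rightarrow> 'a::comm_cbanach_algebra \<Rightarrow>\<^sub>L 'a) \<Rightarrow> (real \<Rightarrow> complex) \<Rightarrow> complex set" where
  "sigma_ar T f\<^sub>0 =
     {character_ext (arveson_ideal T) blinfun_compose \<phi> (arveson_generator T f\<^sub>0) | \<phi>.
        is_character (arveson_ideal T) blinfun_compose \<phi>}"

definition Res_ar ::
  "(real \<Rightarrow> 'a::comm_cbanach_algebra \<Rightarrow>\<^sub>L 'a) \<Rightarrow> (real \<Rightarrow> complex) \<Rightarrow> complex set" where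
  "Res_ar T f\<^sub>0 = - sigma_ar T f\<^sub>0"

section \<open>Normalizations\<close>

text \<open>
  A subalgebra \<open>\<B>\<close> of the quasimultiplier algebra of \<open>'a\<close>, with its own Banach algebra norm, is given
  as a Banach algebra \<open>'b\<close> together with the inclusion \<open>\<iota>\<close>, which sends an element of \<open>\<B>\<close> to itself
  as a quasimultiplier on \<open>'a\<close>.
\<close>

definition subalgebra_of_QM ::
  "('b::comm_cbanach_algebra \<Rightarrow> ('a::comm_cbanach_algebra \<times> 'a) set) \<Rightarrow> bool" where
  "subalgebra_of_QM \<iota> \<longleftrightarrow> inj \<iota> \<and> range \<iota> \<subseteq> QM UNIV (*) \<and>
     (\<forall>x y. \<iota> (x + y) = qm_add UNIV (*) (\<iota> x) (\<iota> y)) \<and>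
     (\<forall>c x. \<iota> (c *\<^sub>C x) = qm_scale UNIV (*) c (\<iota> x)) \<and>
     (\<forall>x y. \<iota> (x * y) = qm_mult UNIV (*) (\<iota> x) (\<iota> y))"

text \<open>An element \<open>u\<close> of \<open>'a\<close> is the quasimultiplier \<open>x \<mapsto> u x\<close>; \<open>incl_map \<iota>\<close> is the map \<open>j\<close>.\<close>

definition incl_map ::
  "('b::comm_cbanach_algebra \<Rightarrow> ('a::comm_cbanach_algebra \<times> 'a) set) \<Rightarrow> 'a \<Rightarrow> 'b" where
  "incl_map \<iota> u = (THE b. \<iota> b = graph_of ((*) u))"

text \<open>
  \<open>represents \<iota> S R\<close>: under the identification of \<open>\<Q>\<M>(\<A>)\<close> with \<open>\<Q>\<M>(\<B>)\<close>, the quasimultiplier \<open>S\<close> is the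
  multiplier \<open>R\<close> of \<open>\<B>\<close>.
\<close>

definition represents ::
  "('b::comm_cbanach_algebra \<Rightarrow> ('a::comm_cbanach_algebra \<times> 'a) set) \<Rightarrow> ('a \<times> 'a) set \<Rightarrow>
     ('b \<Rightarrow>\<^sub>L 'b) \<Rightarrow> bool" where
  "represents \<iota> S R \<longleftrightarrow> S \<in> QM UNIV (*) \<and> R \<in> multipliers \<and>
     qm_ext (incl_map \<iota>) S = graph_of (blinfun_apply R)"

definition to_multiplier ::
  "('b::comm_cbanach_algebra \<Rightarrow> ('a::comm_cbanach_algebra \<times> 'a) set) \<Rightarrow> ('a \<times> 'a) set \<Rightarrow>
     'b \<Rightarrow>\<^sub>L 'b" where
  "to_multiplier \<iota> S = (THE R. represents \<iota> S R)"

definition semigroup_on ::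
  "('b::comm_cbanach_algebra \<Rightarrow> ('a::comm_cbanach_algebra \<times> 'a) set) \<Rightarrow> (real \<Rightarrow> 'a \<Rightarrow>\<^sub>L 'a) \<Rightarrow>
     real \<Rightarrow> 'b \<Rightarrow>\<^sub>L 'b" where
  "semigroup_on \<iota> T t = to_multiplier \<iota> (graph_of (blinfun_apply (T t)))"

definition normalization ::
  "(real \<Rightarrow> 'a::comm_cbanach_algebra \<Rightarrow>\<^sub>L 'a) \<Rightarrow>
     ('b::comm_cbanach_algebra \<Rightarrow> ('a \<times> 'a) set) \<Rightarrow> bool" where
  "normalization T \<iota> \<longleftrightarrow> subalgebra_of_QM \<iota> \<and>
     (\<forall>u. graph_of ((*) u) \<in> range \<iota>) \<and>
     QM_hom (incl_map \<iota>) \<and> (\<forall>u. norm (incl_map \<iota> u) \<le> norm u) \<and>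
     (\<forall>R\<in>multipliers. \<exists>R'. represents \<iota> (graph_of (blinfun_apply R)) R' \<and> norm R' \<le> norm R) \<and>
     Limsup (at_right 0) (\<lambda>t. ereal (norm (semigroup_on \<iota> T t))) < \<infinity>"

section \<open>Vector-valued holomorphic maps\<close>

definition holomorphic_into ::
  "(complex \<Rightarrow> 'v::cbanach) \<Rightarrow> complex set \<Rightarrow> 'v set \<Rightarrow> bool" where
  "holomorphic_into F U X \<longleftrightarrow> open U \<and> F ` U \<subseteq> X \<and>
     (\<forall>\<mu>\<in>U. \<exists>D. (F has_derivative (\<lambda>h. h *\<^sub>C D)) (at \<mu>))"

end

theory Submission
  imports Defs
begin

text \<open>
  Write \<open>\<omega>(t) = \<parallel>T(t)\<parallel>\<close>, \<open>\<Phi>(f) = \<integral> f(t) T(t) dt\<close> and \<open>p\<^sup>\<and>(\<mu>) = \<integral> p(t) e\<^bsup>\<mu>t\<^esup> dt\<close> for integrable \<open>p\<close> supported in a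
  compact subset of the open half-line. No Gelfand theory is needed: \<open>\<mu>\<close> lies in the Arveson spectrum iff
  \<open>|p\<^sup>\<and>(\<mu>)| \<le> \<parallel>\<Phi>(p)\<parallel>\<close> for all such \<open>p\<close>, because then \<open>\<Phi>(p) \<mapsto> p\<^sup>\<and>(\<mu>)\<close> extends to a character of the Arveson ideal.
  Hence the resolvent set is open, and for \<open>\<mu>\<close> in it some \<open>p\<close> satisfies \<open>\<parallel>\<Phi>(p)\<parallel> < |p\<^sup>\<and>(\<mu>)|\<close>. With
  \<open>h(s) = \<integral>\<^sub>s\<^sup>\<infinity> p(t) e\<^bsup>\<mu>(t - s)\<^esup> dt\<close> one has \<open>(\<mu> - \<Delta>) \<Phi>(h) = p\<^sup>\<and>(\<mu>) - \<Phi>(p)\<close>. The function \<open>h\<close> does not vanish at \<open>0\<close>, so \<open>\<Phi>(h)\<close>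
  makes sense only on the normalization, where the semigroup is bounded near \<open>0\<close>; there the right-hand side
  is invertible by a Neumann series, and this gives the resolvent. For large real part of \<open>\<mu>\<close> one takes
  \<open>\<Phi>(e\<^bsup>-\<mu>t\<^esup>)\<close> instead. Holomorphy follows from the resolvent identity. All identities between vector-valued
  integrals are reduced to scalar ones by the Hahn-Banach theorem.
\<close>

section \<open>Hahn-Banach, uniform boundedness and closed graph theorems\<close>

text \<open>The generator enters through one function. For g = \<mu> f0 + f0' the quasimultiplier
  \<mu> - \<Delta> is the quotient \<Phi>(g)/\<Phi>(f0), and since f0(0) = 0 the product rule gives
  g * e = f0 for e(t) = exp(-\<mu> t). Associativity then yields g * (e * F) = f0 * F for every test
  function F. If the transform of F vanishes at \<mu>, e * F is again a test function. A character
  with value \<mu> at \<Delta> annihilates \<Phi>(g), hence \<Phi>(F); so it is proportional to the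
  transform at \<mu>, and multiplicativity makes the factor 1. If the transform c of p at \<mu> is
  not zero, e * p has the tail c e. Subtracting gives h = c e - e * p, of bounded support but with
  value c at 0. The obstacle is the behaviour at 0, where the norm of T(t) need not be integrable:
  supports stay away from 0 until the passage to the normalization. The norm of \<Phi>(p) does not
  grow in this passage, so a strict inequality found on the original algebra persists. The ideal
  need not have a unit, so the Neumann series appears as a fixed point equation inside the
  ideal.\<close>

definition sublinear :: "('a::real_normed_vector \<Rightarrow> real) \<Rightarrow> bool" where
  "sublinear q \<longleftrightarrow> (\<forall>x y. q (x + y) \<le> q x + q y) \<and> (\<forall>c\<ge>0. \<forall>x. q (c *\<^sub>R x) = c * q x) \<and>
     (\<forall>x. q x \<le> norm x)"

text \<open>The bound does not depend on \<open>q\<close>, so a chain of sublinear functionals has a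
  finite pointwise infimum.\<close>

lemma sublinear_lower: "sublinear q \<Longrightarrow> - norm x \<le> q x"
proof -
  assume q: "sublinear q"
  have "q (0 *\<^sub>R x) = 0 * q x" using q unfolding sublinear_def by blast
  moreover have "q (x + (-x)) \<le> q x + q (-x)" using q unfolding sublinear_def by blast
  moreover have "q (-x) \<le> norm (-x)" using q unfolding sublinear_def by blast
  ultimately show ?thesis by simp
qed

text \<open>Replacing \<open>q\<close> by \<open>tilt q y\<close> yields a smaller sublinear functional; a minimal one is therefore unchanged
  by tilting, which forces it to be additive.\<close>

definition tilt :: "('a::real_normed_vector \<Rightarrow> real) \<Rightarrow> 'a \<Rightarrow> 'a \<Rightarrow> real" where
  "tilt q y x = (INF t\<in>{0..}. q (x + t *\<^sub>R y) - t * q y)"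

lemma tilt_bdd:
  assumes "sublinear q"
  shows "bdd_below ((\<lambda>t. q (x + t *\<^sub>R y) - t * q y) ` {0..})"
proof (rule bdd_belowI2)
  fix t :: real assume "t \<in> {0..}"
  then have t: "t \<ge> 0" by simp
  have "q ((x + t *\<^sub>R y) + (-x)) \<le> q (x + t *\<^sub>R y) + q (-x)"
    using assms unfolding sublinear_def by blast
  moreover have "q (t *\<^sub>R y) = t * q y" using assms t unfolding sublinear_def by blast
  ultimately show "- q (-x) \<le> q (x + t *\<^sub>R y) - t * q y" by simp
qed

lemma tilt_le:
  assumes "sublinear q" "t \<ge> 0"
  shows "tilt q y x \<le> q (x + t *\<^sub>R y) - t * q y"
  unfolding tilt_def using assms by (intro cINF_lower tilt_bdd) auto

lemma tilt_greatest:
  assumes "\<And>t. t \<ge> 0 \<Longrightarrow> c \<le> q (x + t *\<^sub>R y) - t * q y"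
  shows "c \<le> tilt q y x"
  unfolding tilt_def using assms by (intro cINF_greatest) auto

lemma tilt_le_self: "sublinear q \<Longrightarrow> tilt q y x \<le> q x"
  using tilt_le[of q 0 y x] by simp

text \<open>Parameters \<open>s\<close> for \<open>a\<close> and \<open>t\<close> for
  \<open>b\<close> add up to an admissible parameter for \<open>a + b\<close>, and scaling the
  vector by \<open>c > 0\<close> rescales the parameter to \<open>c * t\<close>. Hence subadditivity
  and homogeneity survive the infimum.\<close>

lemma sublinear_tilt:
  assumes q: "sublinear q"
  shows "sublinear (tilt q y)"
proof -
  have q1: "q (a + b) \<le> q a + q b" and q2: "c \<ge> 0 \<Longrightarrow> q (c *\<^sub>R a) = c * q a" and q3: "q a \<le> norm a" for a b c
    using q unfolding sublinear_def by blast+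
  have add: "tilt q y (a + b) \<le> tilt q y a + tilt q y b" for a b
  proof -
    have "tilt q y (a + b) - tilt q y a \<le> tilt q y b"
    proof (rule tilt_greatest)
      fix t :: real assume t: "t \<ge> 0"
      have "tilt q y (a + b) - (q (b + t *\<^sub>R y) - t * q y) \<le> tilt q y a"
      proof (rule tilt_greatest)
        fix s :: real assume s: "s \<ge> 0"
        have "tilt q y (a + b) \<le> q ((a + b) + (s + t) *\<^sub>R y) - (s + t) * q y"
          using s t by (intro tilt_le q) auto
        also have "(a + b) + (s + t) *\<^sub>R y = (a + s *\<^sub>R y) + (b + t *\<^sub>R y)"
          by (simp add: algebra_simps)
        also have "q \<dots> \<le> q (a + s *\<^sub>R y) + q (b + t *\<^sub>R y)" by (rule q1)
        finally show "tilt q y (a + b) - (q (b + t *\<^sub>R y) - t * q y) \<le> q (a + s *\<^sub>R y) - s * q y"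
          by (simp add: algebra_simps)
      qed
      then show "tilt q y (a + b) - tilt q y a \<le> q (b + t *\<^sub>R y) - t * q y" by simp
    qed
    then show ?thesis by simp
  qed
  have sc_le: "tilt q y (c *\<^sub>R a) \<le> c * tilt q y a" if c: "c > 0" for c a
  proof -
    have "tilt q y (c *\<^sub>R a) / c \<le> tilt q y a"
    proof (rule tilt_greatest)
      fix t :: real assume t: "t \<ge> 0"
      have "tilt q y (c *\<^sub>R a) \<le> q (c *\<^sub>R a + (c * t) *\<^sub>R y) - (c * t) * q y"
        using c t by (intro tilt_le q) auto
      also have "c *\<^sub>R a + (c * t) *\<^sub>R y = c *\<^sub>R (a + t *\<^sub>R y)" by (simp add: algebra_simps)
      also have "q \<dots> = c * q (a + t *\<^sub>R y)" using c by (intro q2) auto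
      finally show "tilt q y (c *\<^sub>R a) / c \<le> q (a + t *\<^sub>R y) - t * q y"
        using c by (simp add: field_simps)
    qed
    then show ?thesis using c by (simp add: field_simps)
  qed
  have sc: "tilt q y (c *\<^sub>R a) = c * tilt q y a" if c: "c > 0" for c a
  proof -
    have "tilt q y (inverse c *\<^sub>R (c *\<^sub>R a)) \<le> inverse c * tilt q y (c *\<^sub>R a)"
      using c by (intro sc_le) auto
    then have "c * tilt q y a \<le> tilt q y (c *\<^sub>R a)"
      using c by (simp add: field_simps)
    with sc_le[OF c, of a] show ?thesis by simp
  qed
  have "q (0 *\<^sub>R 0) = 0 * q 0" by (rule q2) simp
  then have q0: "q 0 = 0" by simp
  have "0 \<le> tilt q y 0"
    using q2 by (intro tilt_greatest) simp
  moreover have "tilt q y 0 \<le> 0" using tilt_le_self[OF q, of y 0] q0 by simp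
  ultimately have z: "tilt q y 0 = 0" by simp
  have "tilt q y (c *\<^sub>R a) = c * tilt q y a" if "c \<ge> 0" for c a
    using sc[of c a] z that by (cases "c = 0") auto
  with add show ?thesis
    unfolding sublinear_def using order_trans[OF tilt_le_self[OF q] q3] by blast
qed

lemma sublinear_minimal_linear:
  assumes q: "sublinear q" and min: "\<And>p. sublinear p \<Longrightarrow> (\<And>x. p x \<le> q x) \<Longrightarrow> p = q"
  shows "linear q"
proof -
  have "tilt q y = q" for y
    by (rule min[OF sublinear_tilt[OF q] tilt_le_self[OF q]])
  \<comment> \<open>The parameter 1 alone gives superadditivity.\<close>
  then have "q x \<le> q (x + y) - q y" for x y
    using tilt_le[OF q, of 1 y x] by simp
  then have add: "q (x + y) = q x + q y" for x y
    using q unfolding sublinear_def by (meson antisym le_diff_eq)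
  have pos: "c \<ge> 0 \<Longrightarrow> q (c *\<^sub>R x) = c * q x" for c x
    using q unfolding sublinear_def by blast
  have neg: "q (- x) = - q x" for x
    using add[of x "- x"] pos[of 0 0] by simp
  show ?thesis
  proof (rule linearI)
    fix c x show "q (c *\<^sub>R x) = c *\<^sub>R q x"
    proof (cases "c \<ge> 0")
      case False
      then have "q ((- c) *\<^sub>R x) = (- c) * q x" by (intro pos) simp
      then show ?thesis using neg[of "c *\<^sub>R x"] by simp
    qed (use pos in auto)
  qed (rule add)
qed

text \<open>Zorn's lemma for the reversed pointwise order. The pointwise infimum of a chain stays
  subadditive because of any two members the smaller one serves both arguments.\<close>

lemma sublinear_has_minimal:
  fixes p :: "'a::real_normed_vector \<Rightarrow> real"
  assumes p: "sublinear p"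
  obtains q where "sublinear q" "\<And>x. q x \<le> p x" "linear q"
proof -
  define A where "A = {q. sublinear q \<and> (\<forall>x. q x \<le> p x)}"
  define P where "P = (\<lambda>q r :: 'a \<Rightarrow> real. \<forall>x. r x \<le> q x)"
  have "\<exists>m\<in>A. \<forall>a\<in>A. P m a \<longrightarrow> a = m"
  proof (rule predicate_Zorn)
    show "partial_order_on A (relation_of P A)"
      unfolding partial_order_on_def preorder_on_def refl_on_def trans_on_def antisym_on_def relation_of_def P_def
      by (auto intro: order_trans) (meson antisym ext)
  next
    fix C assume C: "C \<in> Chains (relation_of P A)"
    show "\<exists>u\<in>A. \<forall>a\<in>C. P a u"
    proof (cases "C = {}")
      case True
      then show ?thesis using p unfolding A_def by auto
    next
      case False
      have CA: "q \<in> A" if "q \<in> C" for q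
        using C that unfolding Chains_def relation_of_def by auto
      have tot: "(\<forall>x. r x \<le> q x) \<or> (\<forall>x. q x \<le> r x)" if "q \<in> C" "r \<in> C" for q r
        using C that unfolding Chains_def relation_of_def P_def by auto
      define u where "u x = (INF q\<in>C. q x)" for x
      have bdd: "bdd_below ((\<lambda>q. q x) ` C)" for x
        using CA sublinear_lower unfolding A_def by (intro bdd_belowI2[where m = "- norm x"]) auto
      have ule: "u x \<le> q x" if "q \<in> C" for q x
        unfolding u_def using that bdd by (intro cINF_lower)
      have ugr: "c \<le> u x" if "\<And>q. q \<in> C \<Longrightarrow> c \<le> q x" for c x
        unfolding u_def using that False by (intro cINF_greatest)
      have "u (x + y) \<le> u x + u y" for x y
      proof -
        have "u (x + y) - u x \<le> u y"
        proof (rule ugr)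
          fix q assume q: "q \<in> C"
          have "u (x + y) - q y \<le> u x"
          proof (rule ugr)
            fix r assume r: "r \<in> C"
            obtain s where s: "s \<in> C" "s x \<le> r x" "s y \<le> q y" using tot q r by blast
            have "u (x + y) \<le> s (x + y)" using ule s by blast
            also have "\<dots> \<le> s x + s y" using CA[OF s(1)] unfolding A_def sublinear_def by blast
            finally show "u (x + y) - q y \<le> r x" using s by simp
          qed
          then show "u (x + y) - u x \<le> q y" by simp
        qed
        then show ?thesis by simp
      qed
      moreover have "u (c *\<^sub>R x) = c * u x" if c: "c \<ge> 0" for c x
      proof -
        have hom: "q (c *\<^sub>R x) = c * q x" if "q \<in> C" "c \<ge> 0" for q c x
          using CA[OF that(1)] that(2) unfolding A_def sublinear_def by blast
        have *: "c * u x \<le> u (c *\<^sub>R x)" if "c \<ge> 0" for c x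
          using that ule hom by (intro ugr) (metis mult_left_mono)
        show ?thesis
        proof (cases "c = 0")
          case True
          obtain q where "q \<in> C" using False by blast
          then have "u 0 \<le> 0" using ule[of q 0] hom[of q 0 0] by simp
          then show ?thesis using *[of 0 x] True by simp
        next
          case False
          have "inverse c * u (c *\<^sub>R x) \<le> u (inverse c *\<^sub>R (c *\<^sub>R x))" using c by (intro *) auto
          then have "u (c *\<^sub>R x) \<le> c * u x" using c False by (simp add: field_simps)
          with *[OF c, of x] show ?thesis by simp
        qed
      qed
      moreover have "u x \<le> p x" for x
      proof -
        obtain q where q: "q \<in> C" using False by blast
        then have "q x \<le> p x" using CA unfolding A_def by blast
        with ule[OF q, of x] show ?thesis by simp
      qed
      moreover from this have "u x \<le> norm x" for x
        using p unfolding sublinear_def by (meson order_trans)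
      ultimately have "u \<in> A" unfolding A_def sublinear_def by auto
      then show ?thesis using ule unfolding P_def by blast
    qed
  qed
  then obtain m where m: "m \<in> A" and min: "\<And>a. a \<in> A \<Longrightarrow> P m a \<Longrightarrow> a = m" by blast
  have "linear m"
  proof (rule sublinear_minimal_linear)
    show "sublinear m" using m unfolding A_def by blast
    fix a assume "sublinear a" "\<And>x. a x \<le> m x"
    then show "a = m" using m unfolding A_def by (intro min) (auto intro: order_trans simp: A_def P_def)
  qed
  with m that show thesis unfolding A_def by blast
qed

text \<open>Tilting the norm in direction \<open>x\<close> before minimizing fixes the value at
  \<open>x\<close>: the parameter 1 gives \<open>tilt norm x (- x) \<le> - norm x\<close>, so a
  linear functional below it is at least \<open>norm x\<close> at \<open>x\<close>.\<close>

lemma norming_functional: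
  fixes x :: "'a::real_normed_vector"
  obtains l :: "'a \<Rightarrow> real" where "bounded_linear l" "\<And>y. \<bar>l y\<bar> \<le> norm y" "l x = norm x"
proof -
  have sn: "sublinear (norm :: 'a \<Rightarrow> real)" unfolding sublinear_def by (auto simp: norm_triangle_ineq)
  have "sublinear (tilt norm (x))" by (rule sublinear_tilt[OF sn])
  then obtain l where l: "sublinear l" "\<And>y. l y \<le> tilt norm x y" "linear l"
    by (rule sublinear_has_minimal) blast
  have le: "l y \<le> norm y" for y using l(1) unfolding sublinear_def by blast
  have neg: "l (- y) = - l y" for y using l(3) by (simp add: linear_neg)
  have abs: "\<bar>l y\<bar> \<le> norm y" for y using le[of y] le[of "- y"] neg[of y] by simp
  have "l (- x) \<le> norm (- x + 1 *\<^sub>R x) - 1 * norm x"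
    using l(2)[of "- x"] tilt_le[OF sn, of 1 x "- x"] by linarith
  then have "norm x \<le> l x" using neg by simp
  with le[of x] have "l x = norm x" by simp
  moreover have "bounded_linear l"
    using l(3) abs by (intro bounded_linear_intro[where K = 1]) (auto simp: linear_add linear_scale)
  ultimately show thesis using abs that by blast
qed

text \<open>A real norming functional \<open>k\<close> is the real part of the complex linear
  functional k(z) - i k(i z). Complex linearity is wanted because integrands have the form scalar
  times vector and the scalar has to come out of the functional.\<close>

lemma cfunctional_separates:
  fixes x y :: "'a::cbanach"
  assumes "\<And>l :: 'a \<Rightarrow> complex. bounded_linear l \<Longrightarrow> (\<And>c z. l (c *\<^sub>C z) = c * l z) \<Longrightarrow> l x = l y"
  shows "x = y"
proof -
  obtain k :: "'a \<Rightarrow> real" where k: "bounded_linear k" "k (x - y) = norm (x - y)"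
    by (rule norming_functional[of "x - y"])
  interpret k: bounded_linear k by (rule k(1))
  define l where "l z = complex_of_real (k z) - \<i> * complex_of_real (k (\<i> *\<^sub>C z))" for z
  have kr: "k (complex_of_real r *\<^sub>C z) = r * k z" for r z
    by (simp add: scaleC_of_real k.scale)
  have bl: "bounded_linear l"
    unfolding l_def
    by (intro bounded_linear_sub bounded_linear_const_mult
        bounded_linear_compose[OF bounded_linear_of_real k(1)]
        bounded_linear_compose[OF bounded_linear_of_real bounded_linear_compose[OF k(1) bounded_linear_scaleC]])
  have "l (c *\<^sub>C z) = c * l z" for c z
  proof -
    have 1: "c *\<^sub>C z = complex_of_real (Re c) *\<^sub>C z + complex_of_real (Im c) *\<^sub>C (\<i> *\<^sub>C z)"
      by (simp add: scaleC_scaleC scaleC_add_left[symmetric] complex_eq[symmetric] mult.commute)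
    have "\<i> * c = complex_of_real (- Im c) + complex_of_real (Re c) * \<i>"
      by (simp add: complex_eq_iff)
    then have 2: "\<i> *\<^sub>C (c *\<^sub>C z) = complex_of_real (- Im c) *\<^sub>C z + complex_of_real (Re c) *\<^sub>C (\<i> *\<^sub>C z)"
      by (simp add: scaleC_scaleC scaleC_add_left[symmetric])
    have "k (c *\<^sub>C z) = Re c * k z + Im c * k (\<i> *\<^sub>C z)"
      by (subst 1) (simp only: k.add kr)
    moreover have "k (\<i> *\<^sub>C (c *\<^sub>C z)) = - Im c * k z + Re c * k (\<i> *\<^sub>C z)"
      by (subst 2) (simp only: k.add kr)
    ultimately show ?thesis unfolding l_def by (simp add: complex_eq_iff)
  qed
  from assms[OF bl this] have "Re (l x) = Re (l y)" by simp
  then have "k (x - y) = 0" unfolding l_def by (simp add: k.diff)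
  with k(2) show ?thesis by simp
qed

section \<open>Consequences of the Baire category theorem\<close>

lemma closed_cover_interior:
  fixes S :: "nat \<Rightarrow> 'a::banach set"
  assumes "\<And>n. closed (S n)" "(\<Union>n. S n) = UNIV"
  obtains n x e where "e > 0" "cball x e \<subseteq> S n"
proof -
  have "\<exists>n. interior (S n) \<noteq> {}"
  proof (rule ccontr)
    assume "\<not> ?thesis"
    then have "(Met_TC.mtopology :: 'a topology) interior_of \<Union>(range S) = {}"
      using assms(1) by (intro Met_TC.metric_Baire_category_alt)
        (auto simp: mcomplete_iff_complete complete_UNIV)
    then show False using assms(2) by simp
  qed
  then show thesis using that by (meson ex_in_conv mem_interior_cball)
qed

lemma uniform_boundedness:
  fixes T :: "'i \<Rightarrow> 'a::banach \<Rightarrow>\<^sub>L 'b::real_normed_vector"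
  assumes "\<And>x. bounded ((\<lambda>i. blinfun_apply (T i) x) ` I)"
  shows "bounded (T ` I)"
proof -
  define S where "S n = {x. \<forall>i\<in>I. norm (blinfun_apply (T i) x) \<le> real n}" for n
  have "closed (S n)" for n
  proof -
    have "S n = (\<Inter>i\<in>I. {x. norm (blinfun_apply (T i) x) \<le> real n})" unfolding S_def by auto
    then show ?thesis by (auto intro!: closed_INT closed_Collect_le continuous_intros)
  qed
  moreover have "(\<Union>n. S n) = UNIV"
  proof -
    have "\<exists>n. x \<in> S n" for x
    proof -
      obtain B where "\<forall>y\<in>(\<lambda>i. blinfun_apply (T i) x) ` I. norm y \<le> B" using assms bounded_iff by blast
      moreover obtain n where "B \<le> real n" using real_arch_simple by blast
      ultimately have "x \<in> S n" unfolding S_def by (auto intro: order_trans)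
      then show ?thesis ..
    qed
    then show ?thesis by auto
  qed
  ultimately obtain n x e where e: "e > 0" "cball x e \<subseteq> S n" by (rule closed_cover_interior)
  \<comment> \<open>A vector of norm \<open>e\<close> is the difference of two points of the ball
    contained in \<open>S n\<close>, which costs the factor 2.\<close>
  have "norm (T i) \<le> 2 * real n / e" if i: "i \<in> I" for i
  proof (rule norm_blinfun_bound)
    show "0 \<le> 2 * real n / e" using e by simp
    fix y
    show "norm (blinfun_apply (T i) y) \<le> 2 * real n / e * norm y"
    proof (cases "y = 0")
      case False
      define z where "z = (e / norm y) *\<^sub>R y"
      have nz: "norm z = e" unfolding z_def using False e by simp
      have "x + z \<in> S n" "x \<in> S n" using e nz by (auto intro!: subsetD[OF e(2)] simp: dist_norm)
      then have "norm (blinfun_apply (T i) (x + z)) \<le> real n" "norm (blinfun_apply (T i) x) \<le> real n"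
        using i unfolding S_def by auto
      moreover have "blinfun_apply (T i) z = blinfun_apply (T i) (x + z) - blinfun_apply (T i) x"
        by (simp add: blinfun.add_right)
      ultimately have "norm (blinfun_apply (T i) z) \<le> 2 * real n"
        by (metis add_mono mult_2 norm_triangle_ineq4 order_trans)
      then have "(e / norm y) * norm (blinfun_apply (T i) y) \<le> 2 * real n"
        unfolding z_def using e by (simp add: blinfun.scaleR_right)
      then show ?thesis using False e by (simp add: field_simps)
    qed simp
  qed
  then show ?thesis unfolding bounded_iff by blast
qed

text \<open>By Baire, the closure of some sublevel set of \<open>norm (G x)\<close> contains a ball.
  Hence every \<open>x\<close> has an approximant with relative error 1/2 and controlled image.
  Iterating on the remainder writes \<open>x\<close> as a series whose image converges absolutely,
  and closedness of the graph identifies the limit of the images with \<open>G x\<close>.\<close>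

lemma closed_graph:
  fixes G :: "'a::banach \<Rightarrow> 'b::banach"
  assumes lin: "linear G"
    and cl: "\<And>X x y. X \<longlonglongrightarrow> x \<Longrightarrow> (\<lambda>n. G (X n)) \<longlonglongrightarrow> y \<Longrightarrow> G x = y"
  shows "bounded_linear G"
proof -
  interpret linear G by (rule lin)
  define V where "V r = {x. norm (G x) \<le> r}" for r
  have "(\<Union>n. closure (V (real n))) = UNIV"
  proof -
    have "\<exists>n. x \<in> closure (V (real n))" for x
    proof -
      obtain n where "norm (G x) \<le> real n" using real_arch_simple by blast
      then have "x \<in> V (real n)" unfolding V_def by simp
      then have "x \<in> closure (V (real n))" by (rule subsetD[OF closure_subset])
      then show ?thesis ..
    qed
    then show ?thesis by auto
  qed
  then obtain n x0 e where e: "e > 0" "cball x0 e \<subseteq> closure (V (real n))"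
    using closed_cover_interior[of "\<lambda>n. closure (V (real n))"] closed_closure by metis
  define K where "K = 2 * (real n + 1) / e"
  have K: "K > 0" unfolding K_def using e by simp
  \<comment> \<open>The ball lies in the closure of the sublevel set only. Approximating both
    \<open>x0 + z\<close> and \<open>x0\<close> within e/4, where \<open>z\<close> has norm
    \<open>e\<close>, leaves the relative error 1/2.\<close>
  have approx: "\<exists>y. norm (x - y) \<le> norm x / 2 \<and> norm (G y) \<le> K * norm x" for x
  proof (cases "x = 0")
    case True
    then show ?thesis by (intro exI[of _ 0]) (auto simp: zero)
  next
    case False
    define z where "z = (e / norm x) *\<^sub>R x"
    have nz: "norm z = e" unfolding z_def using False e by simp
    have "x0 + z \<in> closure (V (real n))" "x0 \<in> closure (V (real n))"
      using e nz by (auto intro!: subsetD[OF e(2)] simp: dist_norm)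
    moreover have "e / 4 > 0" using e by simp
    ultimately obtain p q where p: "p \<in> V (real n)" "dist p (x0 + z) < e / 4"
      and q: "q \<in> V (real n)" "dist q x0 < e / 4"
      unfolding closure_approachable by meson
    define y where "y = (norm x / e) *\<^sub>R (p - q)"
    have xz: "x = (norm x / e) *\<^sub>R z" unfolding z_def using False e by simp
    have "norm (z - (p - q)) \<le> e / 2"
    proof -
      have "z - (p - q) = (q - x0) - (p - (x0 + z))" by simp
      then have "norm (z - (p - q)) \<le> norm (q - x0) + norm (p - (x0 + z))"
        by (metis norm_triangle_ineq4)
      then show ?thesis using p q by (simp add: dist_norm)
    qed
    moreover have "x - y = (norm x / e) *\<^sub>R (z - (p - q))"
      unfolding y_def by (subst xz) (simp add: scaleR_diff_right)
    ultimately have "norm (x - y) \<le> norm x / 2"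
      using e mult_left_mono[of "norm (z - (p - q))" "e/2" "norm x / e"] by simp
    moreover have "norm (G (p - q)) \<le> 2 * real n"
      using p q norm_triangle_ineq4[of "G p" "G q"] unfolding V_def by (simp add: diff)
    moreover have "G y = (norm x / e) *\<^sub>R G (p - q)" unfolding y_def by (rule scale)
    ultimately have "norm (G y) \<le> K * norm x"
      unfolding K_def using e mult_left_mono[of "norm (G (p - q))" "2 * (real n + 1)" "norm x / e"]
      by (simp add: field_simps)
    with \<open>norm (x - y) \<le> norm x / 2\<close> show ?thesis by blast
  qed
  then obtain A where A: "\<And>x. norm (x - A x) \<le> norm x / 2" "\<And>x. norm (G (A x)) \<le> K * norm x" by metis
  show ?thesis
  proof (rule bounded_linear_intro[where K = "2 * K"])
    fix x
    define r where "r k = ((\<lambda>z. z - A z) ^^ k) x" for k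
    have rS: "r (Suc k) = r k - A (r k)" for k unfolding r_def by simp
    have rn: "norm (r k) \<le> norm x * (1/2)^k" for k
    proof (induction k)
      case (Suc k)
      then show ?case using A(1)[of "r k"] unfolding rS by simp
    qed (simp add: r_def)
    define s where "s k = (\<Sum>i<k. A (r i))" for k
    have sx: "s k = x - r k" for k
      by (induction k) (auto simp: s_def rS, auto simp: r_def)
    have "r \<longlonglongrightarrow> 0"
    proof (rule Lim_null_comparison)
      show "\<forall>\<^sub>F k in sequentially. norm (r k) \<le> norm x * (1/2)^k" using rn by simp
      have "(\<lambda>k. norm x * (1/2)^k) \<longlonglongrightarrow> norm x * 0"
        by (intro tendsto_intros LIMSEQ_power_zero) auto
      then show "(\<lambda>k. norm x * (1/2)^k) \<longlonglongrightarrow> 0" by simp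
    qed
    then have "(\<lambda>k. x - r k) \<longlonglongrightarrow> x - 0" by (intro tendsto_intros)
    then have s: "s \<longlonglongrightarrow> x" using sx[abs_def] by simp
    have b: "norm (G (A (r i))) \<le> (K * norm x) * (1/2)^i" for i
      using order_trans[OF A(2)[of "r i"] mult_left_mono[OF rn[of i], of K]] K by (simp add: mult.assoc)
    have sumg: "summable (\<lambda>i. (K * norm x) * (1/2::real)^i)"
      by (intro summable_mult summable_geometric) simp
    have sm: "summable (\<lambda>i. norm (G (A (r i))))"
      by (rule summable_comparison_test'[OF sumg, of 0]) (use b in auto)
    have "(\<lambda>k. \<Sum>i<k. G (A (r i))) \<longlonglongrightarrow> (\<Sum>i. G (A (r i)))"
      using summable_LIMSEQ[OF summable_norm_cancel[OF sm]] .
    moreover have "G (s k) = (\<Sum>i<k. G (A (r i)))" for k unfolding s_def by (rule sum)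
    ultimately have "G x = (\<Sum>i. G (A (r i)))" using cl[OF s] by simp
    then have "norm (G x) \<le> (\<Sum>i. norm (G (A (r i))))" using summable_norm[OF sm] by simp
    also have "\<dots> \<le> (\<Sum>i. (K * norm x) * (1/2::real)^i)" by (intro suminf_le b sm sumg)
    also have "\<dots> = K * norm x * 2"
      by (subst suminf_mult) (auto simp: suminf_geometric summable_geometric)
    finally show "norm (G x) \<le> norm x * (2 * K)" by (simp add: mult_ac)
  qed (auto simp: add scale)
qed

section \<open>Bochner integrals in non-separable spaces\<close>

text \<open>In a non-separable space a difference of Borel functions need not be Borel. Here the
  subtrahend takes finitely many values, so the norm splits into finitely many pieces, on each of
  which a constant is subtracted.\<close>

lemma norm_diff_simple_measurable:
  fixes F :: "'s \<Rightarrow> 'v::real_normed_vector"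
  assumes F: "F \<in> borel_measurable M" and s: "simple_function M s"
  shows "(\<lambda>x. norm (F x - s x)) \<in> borel_measurable M"
proof -
  have fin: "finite (s ` space M)" using s by (simp add: simple_function_def)
  have m: "(\<lambda>x. norm (F x - y)) \<in> borel_measurable M" for y
    by (rule measurable_compose[OF F borel_measurable_continuous_onI]) (intro continuous_intros)
  have "(\<lambda>x. \<Sum>y\<in>s ` space M. indicat_real (s -` {y} \<inter> space M) x * norm (F x - y)) \<in> borel_measurable M"
    by (intro borel_measurable_sum borel_measurable_times borel_measurable_indicator m simple_functionD(2)[OF s])
  also have "?this \<longleftrightarrow> ?thesis"
  proof (rule measurable_cong)
    fix x assume x: "x \<in> space M"
    have "(\<Sum>y\<in>s ` space M. indicat_real (s -` {y} \<inter> space M) x * norm (F x - y))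
      = (\<Sum>y\<in>s ` space M. if y = s x then norm (F x - s x) else 0)"
      using x by (intro sum.cong) (auto simp: indicator_def)
    also have "\<dots> = norm (F x - s x)" using x fin by (simp add: sum.delta)
    finally show "(\<Sum>y\<in>s ` space M. indicat_real (s -` {y} \<inter> space M) x * norm (F x - y)) = norm (F x - s x)" .
  qed
  finally show ?thesis .
qed

lemma simple_bochner_integral_diff_le:
  fixes F :: "'s \<Rightarrow> 'v::real_normed_vector"
  assumes F: "F \<in> borel_measurable M"
    and s: "Bochner_Integration.simple_bochner_integrable M s"
    and t: "Bochner_Integration.simple_bochner_integrable M t"
  shows "ennreal (norm (Bochner_Integration.simple_bochner_integral M s -
      Bochner_Integration.simple_bochner_integral M t)) \<le>
    (\<integral>\<^sup>+ x. norm (F x - s x) \<partial>M) + (\<integral>\<^sup>+ x. norm (F x - t x) \<partial>M)"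
    (is "ennreal (norm (?s - ?t)) \<le> ?S + ?T")
proof -
  note [measurable] = norm_diff_simple_measurable[OF F]
  have sf: "simple_function M s" "simple_function M t"
    using s t by (auto elim: Bochner_Integration.simple_bochner_integrable.cases)
  have "ennreal (norm (?s - ?t)) = norm (Bochner_Integration.simple_bochner_integral M (\<lambda>x. s x - t x))"
    using s t by (subst Bochner_Integration.simple_bochner_integral_diff) auto
  also have "\<dots> \<le> Bochner_Integration.simple_bochner_integral M (\<lambda>x. norm (s x - t x))"
    using Bochner_Integration.simple_bochner_integrable_compose2[of "(-)" M "s" "t"] s t
    by (auto intro!: Bochner_Integration.simple_bochner_integral_norm_bound)
  also have "\<dots> = (\<integral>\<^sup>+x. norm (s x - t x) \<partial>M)"
    using Bochner_Integration.simple_bochner_integrable_compose2[of "\<lambda>x y. norm (x - y)" M "s" "t"] s t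
    by (auto intro!: Bochner_Integration.simple_bochner_integral_eq_nn_integral)
  also have "\<dots> \<le> (\<integral>\<^sup>+x. ennreal (norm (F x - s x)) + ennreal (norm (F x - t x)) \<partial>M)"
  proof (rule nn_integral_mono)
    fix x
    have "norm (s x - t x) \<le> norm (F x - s x) + norm (F x - t x)"
      by (metis dual_order.refl norm_diff_triangle_le norm_minus_commute)
    then show "ennreal (norm (s x - t x)) \<le> ennreal (norm (F x - s x)) + ennreal (norm (F x - t x))"
      by (metis ennreal_leI ennreal_plus norm_ge_zero)
  qed
  also have "\<dots> = ?S + ?T"
    using sf by (intro nn_integral_add) auto
  finally show ?thesis .
qed

text \<open>The set \<open>D\<close> replaces separability of the space: only the values of
  \<open>F\<close> have to lie in a separable set. Greedy simple functions then converge to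
  \<open>F\<close> pointwise with errors dominated by \<open>norm (F x)\<close>.\<close>

lemma has_Bochner_integral_exists:
  fixes F :: "'s \<Rightarrow> 'v::banach"
  assumes F: "F \<in> borel_measurable M" and D: "countable D" "\<And>x. x \<in> space M \<Longrightarrow> F x \<in> closure D"
    and fin: "(\<integral>\<^sup>+x. ennreal (norm (F x)) \<partial>M) < \<infinity>"
  shows "\<exists>I. has_Bochner_integral M F I"
proof -
  define d where "d = from_nat_into (insert 0 D)"
  have rd: "range d = insert 0 D" unfolding d_def using D by (intro range_from_nat_into) auto
  \<comment> \<open>Start at 0 and move to the next point of the enumeration whenever that point is
    strictly closer to \<open>F x\<close>. The error never increases and finally drops below the
    distance to each listed point. Adding 0 to \<open>D\<close> keeps the enumeration meaningful for
    empty \<open>D\<close>.\<close>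
  define s where "s = rec_nat (\<lambda>x. 0) (\<lambda>i r x. if norm (F x - d i) < norm (F x - r x) then d i else r x)"
  have s0: "s 0 x = 0" and sS: "s (Suc i) x = (if norm (F x - d i) < norm (F x - s i x) then d i else s i x)" for i x
    unfolding s_def by auto
  have nF: "(\<lambda>x. norm (F x - y)) \<in> borel_measurable M" for y
    by (rule measurable_compose[OF F borel_measurable_continuous_onI]) (intro continuous_intros)
  have sf: "simple_function M (s i)" for i
  proof (induction i)
    case 0
    then show ?case by (simp add: s0[abs_def])
  next
    case (Suc i)
    have "simple_function M (\<lambda>x. if norm (F x - d i) < norm (F x - s i x) then d i else s i x)"
      using Suc nF norm_diff_simple_measurable[OF F Suc] by (intro simple_function_If borel_measurable_less) auto
    then show ?case by (simp add: sS[abs_def])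
  qed
  have dec: "norm (F x - s (Suc i) x) \<le> norm (F x - s i x)" for i x
    by (simp add: sS)
  have dec': "norm (F x - s j x) \<le> norm (F x - s i x)" if "i \<le> j" for i j x
    using dec that by (rule lift_Suc_antimono_le)
  have le: "norm (F x - s i x) \<le> norm (F x)" for i x using dec'[of 0 i x] by (simp add: s0)
  have led: "norm (F x - s (Suc i) x) \<le> norm (F x - d i)" for i x by (simp add: sS)
  have conv: "(\<lambda>i. norm (F x - s i x)) \<longlonglongrightarrow> 0" if x: "x \<in> space M" for x
  proof (rule LIMSEQ_I)
    fix r :: real assume r: "r > 0"
    obtain y where y: "y \<in> D" "dist y (F x) < r" using D(2)[OF x] r unfolding closure_approachable by blast
    then obtain k where k: "y = d k" using rd by (metis insertI2 rangeE)
    show "\<exists>no. \<forall>n\<ge>no. norm (norm (F x - s n x) - 0) < r"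
    proof (intro exI allI impI)
      fix n assume "Suc k \<le> n"
      from dec'[OF this, of x] led[of x k] y k show "norm (norm (F x - s n x) - 0) < r"
        by (simp add: dist_norm norm_minus_commute)
    qed
  qed
  have si: "Bochner_Integration.simple_bochner_integrable M (s i)" for i
  proof (rule Bochner_Integration.simple_bochner_integrableI_bounded[OF sf])
    have "(\<integral>\<^sup>+x. ennreal (norm (s i x)) \<partial>M) \<le> (\<integral>\<^sup>+x. 2 * ennreal (norm (F x)) \<partial>M)"
    proof (rule nn_integral_mono)
      fix x
      have "norm (s i x) \<le> norm (F x) + norm (F x - s i x)"
        by (metis add.commute norm_minus_commute norm_triangle_sub)
      then have "norm (s i x) \<le> 2 * norm (F x)" using le[of x i] by simp
      then show "ennreal (norm (s i x)) \<le> 2 * ennreal (norm (F x))"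
        by (metis ennreal_leI ennreal_mult' ennreal_numeral zero_le_numeral)
    qed
    also have "\<dots> = 2 * (\<integral>\<^sup>+x. ennreal (norm (F x)) \<partial>M)"
      using nF[of 0] by (intro nn_integral_cmult) simp
    also have "\<dots> < \<infinity>" using fin by (simp add: ennreal_mult_less_top)
    finally show "(\<integral>\<^sup>+x. ennreal (norm (s i x)) \<partial>M) < \<infinity>" .
  qed
  have lim: "(\<lambda>i. \<integral>\<^sup>+x. ennreal (norm (F x - s i x)) \<partial>M) \<longlonglongrightarrow> 0"
  proof -
    have "(\<lambda>i. \<integral>\<^sup>+x. ennreal (norm (F x - s i x)) \<partial>M) \<longlonglongrightarrow> (\<integral>\<^sup>+x. 0 \<partial>M)"
    proof (rule nn_integral_dominated_convergence[where w = "\<lambda>x. ennreal (norm (F x))"])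
      show "AE x in M. (\<lambda>i. ennreal (norm (F x - s i x))) \<longlonglongrightarrow> 0"
      proof (rule AE_I2)
        fix x assume "x \<in> space M"
        then have "(\<lambda>i. ennreal (norm (F x - s i x))) \<longlonglongrightarrow> ennreal 0" by (intro tendsto_ennrealI conv)
        then show "(\<lambda>i. ennreal (norm (F x - s i x))) \<longlonglongrightarrow> 0" by simp
      qed
    qed (use norm_diff_simple_measurable[OF F sf] nF[of 0] fin le in \<open>auto intro!: ennreal_leI\<close>)
    then show ?thesis by simp
  qed
  define J where "J i = Bochner_Integration.simple_bochner_integral M (s i)" for i
  have "Cauchy J"
  proof (rule metric_CauchyI)
    fix e :: real assume e: "e > 0"
    then have "(0::ennreal) < ennreal (e / 2)" by simp
    then have "\<forall>\<^sub>F i in sequentially. (\<integral>\<^sup>+x. ennreal (norm (F x - s i x)) \<partial>M) < ennreal (e / 2)"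
      by (rule order_tendstoD(2)[OF lim])
    then obtain N where N: "\<And>i. i \<ge> N \<Longrightarrow> (\<integral>\<^sup>+x. ennreal (norm (F x - s i x)) \<partial>M) < ennreal (e / 2)"
      unfolding eventually_sequentially by blast
    show "\<exists>M. \<forall>m\<ge>M. \<forall>n\<ge>M. dist (J m) (J n) < e"
    proof (intro exI allI impI)
      fix m n assume mn: "N \<le> m" "N \<le> n"
      have "ennreal (norm (J m - J n)) \<le> (\<integral>\<^sup>+ x. norm (F x - s m x) \<partial>M) + (\<integral>\<^sup>+ x. norm (F x - s n x) \<partial>M)"
        unfolding J_def by (intro simple_bochner_integral_diff_le F si)
      also have "\<dots> < ennreal (e / 2) + ennreal (e / 2)"
        by (intro add_strict_mono N mn)
      also have "\<dots> = ennreal e" using e by (simp flip: ennreal_plus)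
      finally show "dist (J m) (J n) < e" by (simp add: dist_norm ennreal_less_iff)
    qed
  qed
  then obtain I where "J \<longlonglongrightarrow> I" by (auto simp: Cauchy_convergent_iff convergent_def)
  then show ?thesis
    unfolding has_Bochner_integral_def J_def using F si lim by blast
qed

section \<open>Bochner integrals and bounded linear maps\<close>

lemma has_Bochner_integral_bounded_linear:
  fixes F :: "'s \<Rightarrow> 'v::banach" and L :: "'v \<Rightarrow> 'w::banach"
  assumes h: "has_Bochner_integral M F I" and L: "bounded_linear L"
  shows "has_Bochner_integral M (\<lambda>x. L (F x)) (L I)"
proof -
  interpret L: bounded_linear L by (rule L)
  obtain s where F: "F \<in> borel_measurable M" and si: "\<And>i::nat. Bochner_Integration.simple_bochner_integrable M (s i)"
    and lim: "(\<lambda>i. \<integral>\<^sup>+ x. ennreal (norm (F x - s i x)) \<partial>M) \<longlonglongrightarrow> 0"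
    and J: "(\<lambda>i. Bochner_Integration.simple_bochner_integral M (s i)) \<longlonglongrightarrow> I"
    using h unfolding has_Bochner_integral_def by blast
  have sf: "simple_function M (s i)" for i
    using si[of i] by (auto elim: Bochner_Integration.simple_bochner_integrable.cases)
  obtain K where K: "K > 0" "\<And>x. norm (L x) \<le> norm x * K" using L.pos_bounded by blast
  show ?thesis unfolding has_Bochner_integral_def
  proof (intro conjI exI[of _ "\<lambda>i x. L (s i x)"] allI)
    show "(\<lambda>x. L (F x)) \<in> borel_measurable M"
      by (rule measurable_compose[OF F borel_measurable_continuous_onI]) (rule L.continuous_on[OF continuous_on_id])
    show "Bochner_Integration.simple_bochner_integrable M (\<lambda>x. L (s i x))" for i
      using Bochner_Integration.simple_bochner_integrable_compose2[of "\<lambda>x y. L x", OF _ si si] by (simp add: L.zero)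
    have "(\<lambda>i. Bochner_Integration.simple_bochner_integral M (\<lambda>x. L (s i x)))
      = (\<lambda>i. L (Bochner_Integration.simple_bochner_integral M (s i)))"
      by (intro ext Bochner_Integration.simple_bochner_integral_linear si L.linear)
    then show "(\<lambda>i. Bochner_Integration.simple_bochner_integral M (\<lambda>x. L (s i x))) \<longlonglongrightarrow> L I"
      using L.tendsto[OF J] by simp
    show "(\<lambda>i. \<integral>\<^sup>+ x. ennreal (norm (L (F x) - L (s i x))) \<partial>M) \<longlonglongrightarrow> 0"
    proof (rule tendsto_sandwich[OF _ _ tendsto_const])
      have "(\<lambda>i. ennreal K * (\<integral>\<^sup>+ x. ennreal (norm (F x - s i x)) \<partial>M)) \<longlonglongrightarrow> ennreal K * 0"
        by (rule ennreal_tendsto_cmult[OF _ lim]) simp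
      then show "(\<lambda>i. ennreal K * (\<integral>\<^sup>+ x. ennreal (norm (F x - s i x)) \<partial>M)) \<longlonglongrightarrow> 0" by simp
      show "\<forall>\<^sub>F i in sequentially. (\<integral>\<^sup>+ x. ennreal (norm (L (F x) - L (s i x))) \<partial>M)
        \<le> ennreal K * (\<integral>\<^sup>+ x. ennreal (norm (F x - s i x)) \<partial>M)"
      proof (rule eventuallyI)
        fix i
        have "(\<integral>\<^sup>+ x. ennreal (norm (L (F x) - L (s i x))) \<partial>M) \<le> (\<integral>\<^sup>+ x. ennreal K * ennreal (norm (F x - s i x)) \<partial>M)"
          using K by (intro nn_integral_mono) (simp add: L.diff[symmetric] ennreal_mult'[symmetric] mult.commute ennreal_leI)
        also have "\<dots> = ennreal K * (\<integral>\<^sup>+ x. ennreal (norm (F x - s i x)) \<partial>M)"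
          using norm_diff_simple_measurable[OF F sf] by (intro nn_integral_cmult) simp
        finally show "(\<integral>\<^sup>+ x. ennreal (norm (L (F x) - L (s i x))) \<partial>M)
          \<le> ennreal K * (\<integral>\<^sup>+ x. ennreal (norm (F x - s i x)) \<partial>M)" .
      qed
    qed simp
  qed
qed

text \<open>The bridge to the standard integral, where the target is second countable. Uniqueness,
  norm bounds and integral identities are all obtained by passing through it to scalars.\<close>

lemma has_bochner_integral_functional:
  fixes F :: "'s \<Rightarrow> 'v::banach" and L :: "'v \<Rightarrow> 'w::{banach, second_countable_topology}"
  assumes "has_Bochner_integral M F I" "bounded_linear L"
  shows "has_bochner_integral M (\<lambda>x. L (F x)) (L I)"
  using has_Bochner_integral_bounded_linear[OF assms] unfolding has_Bochner_integral_def
  by (auto intro: has_bochner_integral.intros)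

lemma has_Bochner_integral_unique:
  fixes F :: "'s \<Rightarrow> 'v::cbanach"
  assumes "has_Bochner_integral M F I" "has_Bochner_integral M F J"
  shows "I = J"
proof (rule cfunctional_separates)
  fix l :: "'v \<Rightarrow> complex" assume "bounded_linear l"
  then show "l I = l J"
    using assms has_bochner_integral_functional has_bochner_integral_eq by blast
qed

lemma Bochner_integral_eq:
  fixes F :: "'s \<Rightarrow> 'v::cbanach"
  shows "has_Bochner_integral M F I \<Longrightarrow> Bochner_integral M F = I"
  unfolding Bochner_integral_def using has_Bochner_integral_unique by blast

lemma norm_Bochner_integral_le:
  fixes F :: "'s \<Rightarrow> 'v::banach"
  assumes h: "has_Bochner_integral M F I" and le: "(\<integral>\<^sup>+ x. ennreal (norm (F x)) \<partial>M) \<le> ennreal C" and C: "C \<ge> 0"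
  shows "norm I \<le> C"
proof -
  obtain l :: "'v \<Rightarrow> real" where l: "bounded_linear l" "\<And>y. \<bar>l y\<bar> \<le> norm y" "l I = norm I"
    by (rule norming_functional[of I]) blast
  have "has_bochner_integral M (\<lambda>x. l (F x)) (norm I)"
    using has_bochner_integral_functional[OF h l(1)] l(3) by simp
  then have i: "integrable M (\<lambda>x. l (F x))" and e: "integral\<^sup>L M (\<lambda>x. l (F x)) = norm I"
    by (auto simp: has_bochner_integral_iff)
  have "ennreal (norm (norm I)) \<le> (\<integral>\<^sup>+ x. ennreal (norm (l (F x))) \<partial>M)"
    using integral_norm_bound_ennreal[OF i] e by simp
  also have "\<dots> \<le> (\<integral>\<^sup>+ x. ennreal (norm (F x)) \<partial>M)"
    using l(2) by (intro nn_integral_mono ennreal_leI) simp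
  also note le
  finally show ?thesis using C by simp
qed

lemma bounded_bilinear_scaleC: "bounded_bilinear (\<lambda>(c::complex) (x::'a::cbanach). c *\<^sub>C x)"
proof (rule bounded_bilinear.intro)
  show "(r *\<^sub>R c) *\<^sub>C x = r *\<^sub>R (c *\<^sub>C x)" for r c and x :: 'a
    by (simp add: scaleC_of_real[symmetric] scaleC_scaleC scaleR_conv_of_real)
  show "c *\<^sub>C (r *\<^sub>R x) = r *\<^sub>R (c *\<^sub>C x)" for r c and x :: 'a
    by (simp add: scaleC_of_real[symmetric] scaleC_scaleC mult.commute)
  show "\<exists>K. \<forall>c (x::'a). norm (c *\<^sub>C x) \<le> norm c * norm x * K"
    by (intro exI[of _ 1]) (simp add: norm_scaleC)
qed (simp_all add: scaleC_add_left scaleC_add_right)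

text \<open>The integrand is the continuous map (c, t) \<mapsto> c G(t) composed with the measurable
  map t \<mapsto> (f(t), t). Its domain is a separable set, so measurability and separability of the
  range both follow although \<open>G\<close> takes values in an arbitrary Banach space.\<close>

lemma has_Bochner_integral_scaleC_exists:
  fixes G :: "real \<Rightarrow> 'v::cbanach"
  assumes f: "f \<in> borel_measurable half_line" and G: "continuous_on {0<..} G"
    and fin: "(\<integral>\<^sup>+ t. ennreal (cmod (f t) * norm (G t)) \<partial>half_line) < \<infinity>"
  shows "\<exists>I. has_Bochner_integral half_line (\<lambda>t. f t *\<^sub>C G t) I"
proof -
  define A where "A = (UNIV :: complex set) \<times> {0::real<..}"
  define h where "h p = fst p *\<^sub>C G (snd p)" for p
  have ch: "continuous_on A h"
    unfolding h_def A_def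
    by (intro bounded_bilinear.continuous_on[OF bounded_bilinear_scaleC] continuous_intros
        continuous_on_compose2[OF G]) auto
  have sp: "space half_line = {0<..}" unfolding half_line_def by simp
  have id: "(\<lambda>t. t) \<in> borel_measurable half_line"
    unfolding half_line_def by (intro measurable_restrict_space1 measurable_completion) simp
  have "(\<lambda>t. (f t, t)) \<in> measurable half_line (restrict_space borel A)"
    using f id by (intro measurable_restrict_space2 borel_measurable_Pair) (auto simp: A_def sp)
  then have "(\<lambda>t. h (f t, t)) \<in> borel_measurable half_line"
    by (rule measurable_compose[OF _ borel_measurable_continuous_on_restrict[OF ch]])
  then have m: "(\<lambda>t. f t *\<^sub>C G t) \<in> borel_measurable half_line" by (simp add: h_def)
  obtain Q where Q: "countable Q" "Q \<subseteq> A" "A \<subseteq> closure Q" by (rule separable)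
  have "h p \<in> closure (h ` Q)" if p: "p \<in> A" for p
  proof -
    have "p \<in> closure Q" using Q(3) p by blast
    then obtain x where x: "\<And>n. x n \<in> Q" "x \<longlonglongrightarrow> p" using closure_sequential by metis
    then have "(\<lambda>n. h (x n)) \<longlonglongrightarrow> h p"
      using ch Q(2) p unfolding continuous_on_sequentially comp_def by blast
    moreover have "h (x n) \<in> h ` Q" for n using x by blast
    ultimately show ?thesis unfolding closure_sequential by (intro exI[of _ "\<lambda>n. h (x n)"]) simp
  qed
  then have "f t *\<^sub>C G t \<in> closure (h ` Q)" if "t \<in> space half_line" for t
    using that[unfolded sp] by (metis (no_types, lifting) A_def SigmaI UNIV_I fst_conv h_def snd_conv)
  then show ?thesis
    using has_Bochner_integral_exists[OF m, of "h ` Q"] Q(1) fin by (simp add: norm_scaleC)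
qed

section \<open>Convolution on the half-line\<close>

lemma space_half_line [simp]: "space half_line = {0<..}"
  unfolding half_line_def by simp

section \<open>Borel representatives of Lebesgue measurable functions\<close>

lemma lebesgue_AE_eq_measurable:
  fixes k k' :: "real \<Rightarrow> 'c::topological_space"
  assumes k': "k' \<in> borel_measurable lebesgue" and eq: "AE t in lborel. k t = k' t"
  shows "k \<in> borel_measurable lebesgue"
proof (rule measurableI)
  fix B :: "'c set" assume B: "B \<in> sets borel"
  have "AE t in lebesgue. k t = k' t" using eq by (rule AE_completion)
  then have ae: "AE t in lebesgue. t \<in> k' -` B \<longleftrightarrow> t \<in> k -` B" by eventually_elim auto
  have m: "k' -` B \<in> sets lebesgue" using measurable_sets[OF k' B] by simp
  show "k -` B \<inter> space lebesgue \<in> sets lebesgue"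
    using completion.in_sets_AE[OF ae m] by simp
qed auto

text \<open>Functions on the half-line are only Lebesgue measurable, while Fubini's theorem is available for
  \<^term>\<open>lborel\<close>; hence the passage to Borel representatives.\<close>

definition borel_rep :: "(real \<Rightarrow> complex) \<Rightarrow> (real \<Rightarrow> complex) \<Rightarrow> bool" where
  "borel_rep f f' \<longleftrightarrow> f' \<in> borel_measurable borel \<and> (\<forall>t\<le>0. f' t = 0) \<and>
     (AE t in lborel. 0 < t \<longrightarrow> f t = f' t)"

lemma half_line_measurable_iff:
  fixes f :: "real \<Rightarrow> 'v::real_normed_vector"
  shows "f \<in> borel_measurable half_line \<longleftrightarrow> (\<lambda>t. indicat_real {0<..} t *\<^sub>R f t) \<in> borel_measurable lebesgue"
  unfolding half_line_def by (rule borel_measurable_restrict_space_iff) simp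

lemma borel_rep_exists:
  assumes f: "f \<in> borel_measurable half_line"
  obtains f' where "borel_rep f f'"
proof -
  let ?k = "\<lambda>t. indicat_real {0<..} t *\<^sub>R f t"
  have k: "?k \<in> borel_measurable lebesgue" using f half_line_measurable_iff by blast
  have "(\<lambda>t. Re (?k t)) \<in> borel_measurable lebesgue" "(\<lambda>t. Im (?k t)) \<in> borel_measurable lebesgue"
    using k by (intro measurable_compose[OF k borel_measurable_Re] measurable_compose[OF k borel_measurable_Im])+
  note reim = this
  obtain p where p: "p \<in> borel_measurable lborel" "AE t in lborel. Re (?k t) = p t"
    using completion_ex_borel_measurable_real[OF reim(1)] by blast
  obtain q where q: "q \<in> borel_measurable lborel" "AE t in lborel. Im (?k t) = q t"
    using completion_ex_borel_measurable_real[OF reim(2)] by blast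
  have "borel_rep f (\<lambda>t. indicat_real {0<..} t *\<^sub>R Complex (p t) (q t))"
    unfolding borel_rep_def
  proof (intro conjI)
    have "(\<lambda>t. indicat_real {0<..} t *\<^sub>R (complex_of_real (p t) + \<i> * complex_of_real (q t))) \<in> borel_measurable borel"
      using p(1) q(1) by measurable
    then show "(\<lambda>t. indicat_real {0<..} t *\<^sub>R Complex (p t) (q t)) \<in> borel_measurable borel"
      by (simp add: Complex_eq)
    show "AE t in lborel. 0 < t \<longrightarrow> f t = indicat_real {0<..} t *\<^sub>R Complex (p t) (q t)"
      using p(2) q(2) by eventually_elim (auto simp: complex_eq_iff)
  qed auto
  then show thesis by (rule that)
qed

lemma borel_rep_AE:
  assumes "borel_rep f f'"
  shows "AE t in lborel. indicat_real {0<..} t *\<^sub>R f t = f' t"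
proof -
  have "AE t in lborel. 0 < t \<longrightarrow> f t = f' t" and z: "\<And>t. t \<le> 0 \<Longrightarrow> f' t = 0"
    using assms unfolding borel_rep_def by auto
  from this(1) show ?thesis by eventually_elim (auto simp: indicator_def z not_less)
qed

lemma borel_rep_lebesgue:
  assumes "borel_rep f f'"
  shows "f' \<in> borel_measurable lebesgue" "(\<lambda>t. indicat_real {0<..} t *\<^sub>R f t) \<in> borel_measurable lebesgue"
proof -
  show 1: "f' \<in> borel_measurable lebesgue"
    using assms unfolding borel_rep_def by (intro measurable_completion) simp
  show "(\<lambda>t. indicat_real {0<..} t *\<^sub>R f t) \<in> borel_measurable lebesgue"
    by (rule lebesgue_AE_eq_measurable[OF 1 borel_rep_AE[OF assms]])
qed

lemma borel_rep_measurable: "borel_rep f f' \<Longrightarrow> f \<in> borel_measurable half_line"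
  unfolding half_line_measurable_iff by (rule borel_rep_lebesgue)

lemma borel_rep_integral:
  assumes r: "borel_rep f f'"
  shows "(LINT t|half_line. f t) = (LINT t|lborel. f' t)"
    and "integrable half_line f \<longleftrightarrow> integrable lborel f'"
proof -
  have m: "f' \<in> borel_measurable lborel" using r unfolding borel_rep_def by simp
  have ae: "AE t in lebesgue. indicat_real {0<..} t *\<^sub>R f t = f' t"
    by (rule AE_completion[OF borel_rep_AE[OF r]])
  have "(LINT t|half_line. f t) = (LINT t|lebesgue. indicat_real {0<..} t *\<^sub>R f t)"
    unfolding half_line_def by (rule integral_restrict_space) simp
  also have "\<dots> = (LINT t|lebesgue. f' t)"
    by (rule integral_cong_AE[OF borel_rep_lebesgue(2)[OF r] borel_rep_lebesgue(1)[OF r] ae])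
  also have "\<dots> = (LINT t|lborel. f' t)" by (rule integral_completion[OF m])
  finally show "(LINT t|half_line. f t) = (LINT t|lborel. f' t)" .
  have "integrable half_line f \<longleftrightarrow> integrable lebesgue (\<lambda>t. indicat_real {0<..} t *\<^sub>R f t)"
    unfolding half_line_def by (rule integrable_restrict_space) simp
  also have "\<dots> \<longleftrightarrow> integrable lebesgue f'"
    by (rule integrable_cong_AE[OF borel_rep_lebesgue(2)[OF r] borel_rep_lebesgue(1)[OF r] ae])
  also have "\<dots> \<longleftrightarrow> integrable lborel f'" by (rule integrable_completion[OF m])
  finally show "integrable half_line f \<longleftrightarrow> integrable lborel f'" .
qed

lemma nn_integral_half_line: "(\<integral>\<^sup>+t. k t \<partial>half_line) = (\<integral>\<^sup>+t. k t * indicator {0<..} t \<partial>lborel)"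
  unfolding half_line_def by (simp add: nn_integral_restrict_space nn_integral_completion)

lemma borel_rep_nn_integral:
  assumes r: "borel_rep f f'"
  shows "(\<integral>\<^sup>+t. X t (f t) \<partial>half_line) = (\<integral>\<^sup>+t. X t (f' t) * indicator {0<..} t \<partial>lborel)"
proof -
  have "AE t in lborel. 0 < t \<longrightarrow> f t = f' t" using r unfolding borel_rep_def by auto
  then have "AE t in lborel. X t (f t) * indicator {0<..} t = X t (f' t) * indicator {0<..} t"
    by eventually_elim (auto simp: indicator_def)
  then show ?thesis unfolding nn_integral_half_line by (rule nn_integral_cong_AE)
qed

text \<open>\<open>P\<close> need not be measurable, so the affine substitution is applied to a
  Borel null set containing the exceptions.\<close>

lemma AE_lborel_shift:
  fixes s c :: real
  assumes ae: "AE t in lborel. P t" and c: "c \<noteq> 0"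
  shows "AE t in lborel. P (s + c * t)"
proof -
  from ae obtain N where N: "{t\<in>space lborel. \<not> P t} \<subseteq> N" "N \<in> sets lborel" "emeasure lborel N = 0"
    by (rule AE_E)
  have "AE t in lborel. t \<notin> N" using N by (intro AE_not_in) (auto simp: null_sets_def)
  moreover have "Measurable.pred borel (\<lambda>t. t \<notin> N)" using N(2) by (intro pred_intros_logic) simp
  ultimately have "AE t in lborel. s + c * t \<notin> N" using c by (intro AE_borel_affine) auto
  then show ?thesis by eventually_elim (use N(1) in auto)
qed

text \<open>For \<open>s \<ge> 0\<close> the point s + t stays in the half-line, where
  \<open>p\<close> and \<open>p'\<close> agree almost everywhere. The integrands of the Fubini
  identities below have this form.\<close>

lemma borel_rep_mult_shift:
  assumes f: "borel_rep f f'" and p: "borel_rep p p'" and s: "s \<ge> 0"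
  shows "borel_rep (\<lambda>t. f t * p (s + t)) (\<lambda>t. f' t * p' (s + t))"
  unfolding borel_rep_def
proof (intro conjI)
  have [measurable]: "f' \<in> borel_measurable borel" "p' \<in> borel_measurable borel"
    using f p unfolding borel_rep_def by auto
  show "(\<lambda>t. f' t * p' (s + t)) \<in> borel_measurable borel" by measurable
  show "\<forall>t\<le>0. f' t * p' (s + t) = 0" using f unfolding borel_rep_def by simp
  have "AE t in lborel. 0 < t \<longrightarrow> p t = p' t" using p unfolding borel_rep_def by blast
  then have "AE t in lborel. 0 < s + 1 * t \<longrightarrow> p (s + 1 * t) = p' (s + 1 * t)"
    by (rule AE_lborel_shift) simp
  moreover have "AE t in lborel. 0 < t \<longrightarrow> f t = f' t" using f unfolding borel_rep_def by blast
  ultimately show "AE t in lborel. 0 < t \<longrightarrow> f t * p (s + t) = f' t * p' (s + t)"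
    by eventually_elim (use s in auto)
qed

definition conv_borel :: "(real \<Rightarrow> complex) \<Rightarrow> (real \<Rightarrow> complex) \<Rightarrow> real \<Rightarrow> complex" where
  "conv_borel f g r = (LINT s|lborel. f (r - s) * g s)"

text \<open>The representatives vanish at non-positive arguments, which turns the integral over
  {0..r} into one over the whole line. Equality holds at every \<open>r\<close>, not just almost
  everywhere, because changing the factors on null sets leaves each single integral
  unchanged.\<close>

lemma convol_rep:
  assumes f: "borel_rep f f'" and g: "borel_rep g g'"
  shows "convol f g r = conv_borel f' g' r"
proof -
  have z: "\<And>t. t \<le> 0 \<Longrightarrow> f' t = 0" "\<And>t. t \<le> 0 \<Longrightarrow> g' t = 0"
    and [measurable]: "f' \<in> borel_measurable borel" "g' \<in> borel_measurable borel"
    using f g unfolding borel_rep_def by auto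
  have "AE t in lborel. 0 < t \<longrightarrow> f t = f' t" using f unfolding borel_rep_def by blast
  then have "AE t in lborel. 0 < r + (-1) * t \<longrightarrow> f (r + (-1) * t) = f' (r + (-1) * t)"
    by (rule AE_lborel_shift) simp
  moreover have "AE t in lborel. 0 < t \<longrightarrow> g t = g' t" using g unfolding borel_rep_def by blast
  moreover have "AE t in lborel. t \<noteq> 0" "AE t in lborel. t \<noteq> r" by (rule AE_lborel_singleton)+
  ultimately have ae: "AE s in lborel. indicat_real {0..r} s *\<^sub>R (f (r - s) * g s) = f' (r - s) * g' s"
  proof eventually_elim
    case (elim s)
    then show ?case using z(1)[of "r - s"] z(2)[of s] by (auto simp: indicator_def)
  qed
  have m: "(\<lambda>s. f' (r - s) * g' s) \<in> borel_measurable lborel" by measurable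
  then have m': "(\<lambda>s. f' (r - s) * g' s) \<in> borel_measurable lebesgue" by (rule measurable_completion)
  have "convol f g r = (LINT s|lebesgue. indicat_real {0..r} s *\<^sub>R (f (r - s) * g s))"
    unfolding convol_def by (rule integral_restrict_space) simp
  also have "\<dots> = (LINT s|lebesgue. f' (r - s) * g' s)"
    by (intro integral_cong_AE lebesgue_AE_eq_measurable[OF m' ae] m' AE_completion[OF ae])
  also have "\<dots> = conv_borel f' g' r"
    unfolding conv_borel_def by (rule integral_completion[OF m])
  finally show ?thesis .
qed

lemma conv_borel_measurable [measurable]:
  assumes [measurable]: "f \<in> borel_measurable borel" "g \<in> borel_measurable borel"
  shows "conv_borel f g \<in> borel_measurable borel"
  unfolding conv_borel_def[abs_def] by measurable

lemma conv_borel_zero: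
  assumes "\<And>t. t \<le> 0 \<Longrightarrow> f t = 0" "\<And>t. t \<le> 0 \<Longrightarrow> g t = 0" "r \<le> 0"
  shows "conv_borel f g r = 0"
proof -
  have "f (r - s) * g s = 0" for s using assms(1)[of "r - s"] assms(2)[of s] assms(3) by (cases "s \<le> 0") auto
  then have "(\<lambda>s. f (r - s) * g s) = (\<lambda>s. 0)" by blast
  then show ?thesis unfolding conv_borel_def by (simp only: integral_zero)
qed

lemma borel_rep_convol:
  assumes f: "borel_rep f f'" and g: "borel_rep g g'"
  shows "borel_rep (convol f g) (conv_borel f' g')"
  using assms convol_rep[OF f g] conv_borel_zero[of f' g'] unfolding borel_rep_def by auto

lemma convol_measurable:
  assumes "f \<in> borel_measurable half_line" "g \<in> borel_measurable half_line"
  shows "convol f g \<in> borel_measurable half_line"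
  using assms borel_rep_exists borel_rep_convol borel_rep_measurable by metis

section \<open>Fubini identities for convolutions paired with a kernel\<close>

lemma nn_integral_shift:
  fixes k :: "real \<Rightarrow> ennreal"
  assumes "k \<in> borel_measurable borel"
  shows "(\<integral>\<^sup>+r. k r \<partial>lborel) = (\<integral>\<^sup>+t. k (s + t) \<partial>lborel)"
  using nn_integral_real_affine[OF assms, of 1 s] by simp

text \<open>Tonelli's theorem followed by the substitution r = s + t in the inner integral.\<close>

lemma conv_borel_nn_integral:
  fixes f g p :: "real \<Rightarrow> complex"
  assumes [measurable]: "f \<in> borel_measurable borel" "g \<in> borel_measurable borel" "p \<in> borel_measurable borel"
  shows "(\<integral>\<^sup>+r. (\<integral>\<^sup>+s. ennreal (cmod (f (r - s) * g s * p r)) \<partial>lborel) \<partial>lborel)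
    = (\<integral>\<^sup>+s. ennreal (cmod (g s)) * (\<integral>\<^sup>+t. ennreal (cmod (f t * p (s + t))) \<partial>lborel) \<partial>lborel)"
proof -
  have "(\<integral>\<^sup>+r. (\<integral>\<^sup>+s. ennreal (cmod (f (r - s) * g s * p r)) \<partial>lborel) \<partial>lborel)
    = (\<integral>\<^sup>+s. (\<integral>\<^sup>+r. ennreal (cmod (f (r - s) * g s * p r)) \<partial>lborel) \<partial>lborel)"
    by (rule lborel_pair.Fubini') measurable
  also have "\<dots> = (\<integral>\<^sup>+s. (\<integral>\<^sup>+t. ennreal (cmod (g s)) * ennreal (cmod (f t * p (s + t))) \<partial>lborel) \<partial>lborel)"
  proof (rule nn_integral_cong)
    fix s :: real
    have "(\<integral>\<^sup>+r. ennreal (cmod (f (r - s) * g s * p r)) \<partial>lborel)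
      = (\<integral>\<^sup>+t. ennreal (cmod (f (s + t - s) * g s * p (s + t))) \<partial>lborel)"
      by (rule nn_integral_shift[of "\<lambda>r. ennreal (cmod (f (r - s) * g s * p r))" s]) measurable
    then show "(\<integral>\<^sup>+r. ennreal (cmod (f (r - s) * g s * p r)) \<partial>lborel)
      = (\<integral>\<^sup>+t. ennreal (cmod (g s)) * ennreal (cmod (f t * p (s + t))) \<partial>lborel)"
      by (simp add: norm_mult ennreal_mult mult_ac)
  qed
  also have "\<dots> = (\<integral>\<^sup>+s. ennreal (cmod (g s)) * (\<integral>\<^sup>+t. ennreal (cmod (f t * p (s + t))) \<partial>lborel) \<partial>lborel)"
    by (intro nn_integral_cong nn_integral_cmult) measurable
  finally show ?thesis .
qed

lemma conv_borel_integral: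
  assumes [measurable]: "f \<in> borel_measurable borel" "g \<in> borel_measurable borel" "p \<in> borel_measurable borel"
    and fin: "(\<integral>\<^sup>+s. ennreal (cmod (g s)) * (\<integral>\<^sup>+t. ennreal (cmod (f t * p (s + t))) \<partial>lborel) \<partial>lborel) < \<infinity>"
  shows "integrable lborel (\<lambda>r. conv_borel f g r * p r)"
    and "(LINT r|lborel. conv_borel f g r * p r) = (LINT s|lborel. g s * (LINT t|lborel. f t * p (s + t)))"
proof -
  let ?H = "\<lambda>r s. f (r - s) * g s * p r"
  have int: "integrable (lborel \<Otimes>\<^sub>M lborel) (case_prod ?H)"
  proof (rule integrableI_bounded)
    show m: "case_prod ?H \<in> borel_measurable (lborel \<Otimes>\<^sub>M lborel)" by measurable
    have "(\<integral>\<^sup>+z. ennreal (cmod (case_prod ?H z)) \<partial>(lborel \<Otimes>\<^sub>M lborel))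
      = (\<integral>\<^sup>+r. (\<integral>\<^sup>+s. ennreal (cmod (?H r s)) \<partial>lborel) \<partial>lborel)"
      using lborel.nn_integral_fst[of "\<lambda>z. ennreal (cmod (case_prod ?H z))" lborel] m by simp
    also have "\<dots> < \<infinity>" using fin conv_borel_nn_integral[of f g p] by simp
    finally show "(\<integral>\<^sup>+z. ennreal (cmod (case_prod ?H z)) \<partial>(lborel \<Otimes>\<^sub>M lborel)) < \<infinity>" .
  qed
  have c: "(LINT s|lborel. ?H r s) = conv_borel f g r * p r" for r
    unfolding conv_borel_def by simp
  show "integrable lborel (\<lambda>r. conv_borel f g r * p r)"
    using lborel_pair.integrable_fst'[OF int] unfolding prod.case c .
  have "(LINT r|lborel. conv_borel f g r * p r) = (LINT s|lborel. (LINT r|lborel. ?H r s))"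
    using lborel_pair.Fubini_integral[OF int, unfolded c] by (rule sym)
  also have "\<dots> = (LINT s|lborel. g s * (LINT t|lborel. f t * p (s + t)))"
  proof (rule Bochner_Integration.integral_cong[OF refl])
    fix s
    have "(LINT r|lborel. ?H r s) = (LINT t|lborel. ?H (s + t) s)"
      using lborel_integral_real_affine[of 1 "\<lambda>r. ?H r s" s] by simp
    also have "\<dots> = (LINT t|lborel. g s * (f t * p (s + t)))" by (simp add: mult_ac)
    finally show "(LINT r|lborel. ?H r s) = g s * (LINT t|lborel. f t * p (s + t))" by simp
  qed
  finally show "(LINT r|lborel. conv_borel f g r * p r) = (LINT s|lborel. g s * (LINT t|lborel. f t * p (s + t)))" .
qed

lemma rep_iterated:
  assumes f: "borel_rep f f'" and g: "borel_rep g g'" and p: "borel_rep p p'"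
  shows "(\<integral>\<^sup>+s. ennreal (cmod (g s)) * (\<integral>\<^sup>+t. ennreal (cmod (f t * p (s + t))) \<partial>half_line) \<partial>half_line)
    = (\<integral>\<^sup>+s. ennreal (cmod (g' s)) * (\<integral>\<^sup>+t. ennreal (cmod (f' t * p' (s + t))) \<partial>lborel) \<partial>lborel)"
proof -
  have z: "\<And>t. t \<le> 0 \<Longrightarrow> f' t = 0" "\<And>t. t \<le> 0 \<Longrightarrow> g' t = 0"
    using f g unfolding borel_rep_def by auto
  have inner: "(\<integral>\<^sup>+t. ennreal (cmod (f t * p (s + t))) \<partial>half_line)
    = (\<integral>\<^sup>+t. ennreal (cmod (f' t * p' (s + t))) \<partial>lborel)" if s: "s \<ge> 0" for s
    using borel_rep_nn_integral[OF borel_rep_mult_shift[OF f p s], of "\<lambda>t z. ennreal (cmod z)"] z(1)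
    by (simp, intro nn_integral_cong) (auto simp: indicator_def)
  have "(\<integral>\<^sup>+s. ennreal (cmod (g s)) * (\<integral>\<^sup>+t. ennreal (cmod (f t * p (s + t))) \<partial>half_line) \<partial>half_line)
    = (\<integral>\<^sup>+s. ennreal (cmod (g' s)) * (\<integral>\<^sup>+t. ennreal (cmod (f t * p (s + t))) \<partial>half_line) * indicator {0<..} s \<partial>lborel)"
    by (rule borel_rep_nn_integral[OF g])
  also have "\<dots> = (\<integral>\<^sup>+s. ennreal (cmod (g' s)) * (\<integral>\<^sup>+t. ennreal (cmod (f' t * p' (s + t))) \<partial>lborel) \<partial>lborel)"
    using z(2) by (intro nn_integral_cong) (auto simp: indicator_def inner)
  finally show ?thesis .
qed

lemma convol_nn_integral_le:
  assumes f: "f \<in> borel_measurable half_line" and g: "g \<in> borel_measurable half_line"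
    and p: "p \<in> borel_measurable half_line"
  shows "(\<integral>\<^sup>+r. ennreal (cmod (convol f g r * p r)) \<partial>half_line) \<le>
    (\<integral>\<^sup>+s. ennreal (cmod (g s)) * (\<integral>\<^sup>+t. ennreal (cmod (f t * p (s + t))) \<partial>half_line) \<partial>half_line)"
proof -
  obtain f' g' p' where r: "borel_rep f f'" "borel_rep g g'" "borel_rep p p'"
    using f g p borel_rep_exists by metis
  have [measurable]: "f' \<in> borel_measurable borel" "g' \<in> borel_measurable borel" "p' \<in> borel_measurable borel"
    using r unfolding borel_rep_def by auto
  have "(\<integral>\<^sup>+r. ennreal (cmod (convol f g r * p r)) \<partial>half_line)
    = (\<integral>\<^sup>+r. ennreal (cmod (convol f g r * p' r)) * indicator {0<..} r \<partial>lborel)"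
    by (rule borel_rep_nn_integral[OF r(3)])
  also have "\<dots> \<le> (\<integral>\<^sup>+r. (\<integral>\<^sup>+s. ennreal (cmod (f' (r - s) * g' s * p' r)) \<partial>lborel) \<partial>lborel)"
  proof (rule nn_integral_mono)
    fix x
    have "ennreal (cmod (conv_borel f' g' x)) \<le> (\<integral>\<^sup>+s. ennreal (cmod (f' (x - s) * g' s)) \<partial>lborel)"
    proof (cases "integrable lborel (\<lambda>s. f' (x - s) * g' s)")
      case True
      then show ?thesis unfolding conv_borel_def by (rule integral_norm_bound_ennreal)
    next
      \<comment> \<open>An integral that does not exist has the value 0, so the estimate needs no
        finiteness assumption.\<close>
      case False
      then show ?thesis unfolding conv_borel_def by (simp add: not_integrable_integral_eq)
    qed
    then have "ennreal (cmod (conv_borel f' g' x)) * ennreal (cmod (p' x))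
      \<le> (\<integral>\<^sup>+s. ennreal (cmod (f' (x - s) * g' s)) \<partial>lborel) * ennreal (cmod (p' x))"
      by (rule mult_right_mono) simp
    also have "\<dots> = (\<integral>\<^sup>+s. ennreal (cmod (f' (x - s) * g' s)) * ennreal (cmod (p' x)) \<partial>lborel)"
      by (rule nn_integral_multc[symmetric]) measurable
    finally show "ennreal (cmod (convol f g x * p' x)) * indicator {0<..} x
      \<le> (\<integral>\<^sup>+s. ennreal (cmod (f' (x - s) * g' s * p' x)) \<partial>lborel)"
      by (auto simp: convol_rep[OF r(1,2)] norm_mult ennreal_mult indicator_def)
  qed
  also have "\<dots> = (\<integral>\<^sup>+s. ennreal (cmod (g' s)) * (\<integral>\<^sup>+t. ennreal (cmod (f' t * p' (s + t))) \<partial>lborel) \<partial>lborel)"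
    by (rule conv_borel_nn_integral) measurable
  also note rep_iterated[OF r, symmetric]
  finally show ?thesis .
qed

text \<open>The common source of all multiplicativity statements: exponentials as kernel
  \<open>p\<close> give the product rule for transforms, orbits of the semigroup under a functional
  give \<Phi>(f * g) = \<Phi>(f) \<Phi>(g), and a reflected function gives associativity.\<close>

lemma convol_integral:
  assumes f: "f \<in> borel_measurable half_line" and g: "g \<in> borel_measurable half_line"
    and p: "p \<in> borel_measurable half_line"
    and fin: "(\<integral>\<^sup>+s. ennreal (cmod (g s)) * (\<integral>\<^sup>+t. ennreal (cmod (f t * p (s + t))) \<partial>half_line) \<partial>half_line) < \<infinity>"
  shows "integrable half_line (\<lambda>r. convol f g r * p r)"
    and "(LINT r|half_line. convol f g r * p r) = (LINT s|half_line. g s * (LINT t|half_line. f t * p (s + t)))"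
proof -
  obtain f' g' p' where r: "borel_rep f f'" "borel_rep g g'" "borel_rep p p'"
    using f g p borel_rep_exists by metis
  have [measurable]: "f' \<in> borel_measurable borel" "g' \<in> borel_measurable borel" "p' \<in> borel_measurable borel"
    using r unfolding borel_rep_def by auto
  have fin': "(\<integral>\<^sup>+s. ennreal (cmod (g' s)) * (\<integral>\<^sup>+t. ennreal (cmod (f' t * p' (s + t))) \<partial>lborel) \<partial>lborel) < \<infinity>"
    using fin rep_iterated[OF r] by simp
  note cb = conv_borel_integral[OF _ _ _ fin']
  have rc: "borel_rep (\<lambda>r. convol f g r * p r) (\<lambda>r. conv_borel f' g' r * p' r)"
    using borel_rep_mult_shift[OF borel_rep_convol[OF r(1,2)] r(3), of 0] by simp
  show "integrable half_line (\<lambda>r. convol f g r * p r)"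
    unfolding borel_rep_integral(2)[OF rc] by (rule cb) measurable
  have inner: "(LINT t|half_line. f t * p (s + t)) = (LINT t|lborel. f' t * p' (s + t))" if "s \<ge> 0" for s
    by (rule borel_rep_integral(1)[OF borel_rep_mult_shift[OF r(1,3) that]])
  have ro: "borel_rep (\<lambda>s. g s * (LINT t|half_line. f t * p (s + t))) (\<lambda>s. g' s * (LINT t|lborel. f' t * p' (s + t)))"
    unfolding borel_rep_def
  proof (intro conjI)
    show "(\<lambda>s. g' s * (LINT t|lborel. f' t * p' (s + t))) \<in> borel_measurable borel" by measurable
    show "\<forall>s\<le>0. g' s * (LINT t|lborel. f' t * p' (s + t)) = 0" using r(2) unfolding borel_rep_def by simp
    have "AE s in lborel. 0 < s \<longrightarrow> g s = g' s" using r(2) unfolding borel_rep_def by blast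
    then show "AE s in lborel. 0 < s \<longrightarrow> g s * (LINT t|half_line. f t * p (s + t)) = g' s * (LINT t|lborel. f' t * p' (s + t))"
      by eventually_elim (auto simp: inner)
  qed
  have "(LINT r|half_line. convol f g r * p r) = (LINT r|lborel. conv_borel f' g' r * p' r)"
    by (rule borel_rep_integral(1)[OF rc])
  also have "\<dots> = (LINT s|lborel. g' s * (LINT t|lborel. f' t * p' (s + t)))"
    by (rule cb) measurable
  also note borel_rep_integral(1)[OF ro, symmetric]
  finally show "(LINT r|half_line. convol f g r * p r) = (LINT s|half_line. g s * (LINT t|half_line. f t * p (s + t)))" .
qed

lemma half_line_measurable_lborel:
  "f \<in> borel_measurable borel \<Longrightarrow> f \<in> borel_measurable half_line"
  unfolding half_line_def by (intro measurable_restrict_space1 measurable_completion) simp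

lemma half_line_measurable_continuous:
  fixes f :: "real \<Rightarrow> 'v::real_normed_vector"
  assumes "continuous_on {0<..} f"
  shows "f \<in> borel_measurable half_line"
  unfolding half_line_def using assms by (intro continuous_imp_measurable_on_sets_lebesgue) auto

lemma convol_half_line:
  assumes f: "f \<in> borel_measurable half_line" and g: "g \<in> borel_measurable half_line"
  shows "convol f g r = (LINT s|half_line. indicat_real {..r} s *\<^sub>R (f (r - s) * g s))"
proof -
  obtain f' g' where r: "borel_rep f f'" "borel_rep g g'" using f g borel_rep_exists by metis
  have z: "\<And>t. t \<le> 0 \<Longrightarrow> f' t = 0" "\<And>t. t \<le> 0 \<Longrightarrow> g' t = 0"
    and [measurable]: "f' \<in> borel_measurable borel" "g' \<in> borel_measurable borel"
    using r unfolding borel_rep_def by auto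
  have "borel_rep (\<lambda>s. indicat_real {..r} s *\<^sub>R (f (r - s) * g s)) (\<lambda>s. f' (r - s) * g' s)"
    unfolding borel_rep_def
  proof (intro conjI)
    show "(\<lambda>s. f' (r - s) * g' s) \<in> borel_measurable borel" by measurable
    show "\<forall>s\<le>0. f' (r - s) * g' s = 0" by (simp add: z)
    have "AE t in lborel. 0 < t \<longrightarrow> f t = f' t" using r unfolding borel_rep_def by blast
    then have "AE t in lborel. 0 < r + (-1) * t \<longrightarrow> f (r + (-1) * t) = f' (r + (-1) * t)"
      by (rule AE_lborel_shift) simp
    moreover have "AE t in lborel. 0 < t \<longrightarrow> g t = g' t" using r unfolding borel_rep_def by blast
    moreover have "AE t in lborel. t \<noteq> r" by (rule AE_lborel_singleton)
    ultimately show "AE s in lborel. 0 < s \<longrightarrow> indicat_real {..r} s *\<^sub>R (f (r - s) * g s) = f' (r - s) * g' s"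
    proof eventually_elim
      case (elim s)
      then show ?case using z(1)[of "r - s"] by (auto simp: indicator_def)
    qed
  qed
  from borel_rep_integral(1)[OF this] show ?thesis
    using convol_rep[OF r] by (simp add: conv_borel_def)
qed

lemma nn_integral_half_line_atMost: "(\<integral>\<^sup>+t. indicator {..r} t \<partial>half_line) \<le> ennreal \<bar>r\<bar>"
proof -
  have "(\<integral>\<^sup>+t. indicator {..r} t \<partial>half_line) = (\<integral>\<^sup>+t. indicator {0<..r} t \<partial>lborel)"
    unfolding nn_integral_half_line by (intro nn_integral_cong) (auto simp: indicator_def)
  also have "\<dots> = emeasure lborel {0<..r}" by simp
  also have "\<dots> \<le> ennreal \<bar>r\<bar>" by (cases "0 \<le> r") auto
  finally show ?thesis .
qed

text \<open>For fixed \<open>r\<close>, convolving with \<open>g\<close> at \<open>r\<close> is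
  pairing with p(s) = g(r - s), cut off beyond \<open>r\<close>, so \<open>convol_integral\<close>
  applies. Its finiteness condition concerns arguments up to \<open>r\<close> alone, where
  \<open>g\<close> and \<open>E\<close> are bounded and \<open>F\<close> is integrable.\<close>

lemma convol_assoc:
  assumes g: "continuous_on {0..} g" and E: "continuous_on {0..} E"
    and F: "F \<in> borel_measurable half_line"
    and Fin: "(\<integral>\<^sup>+t. ennreal (cmod (F t)) * indicator {..r} t \<partial>half_line) < \<infinity>"
  shows "convol g (convol E F) r = convol (convol g E) F r"
proof -
  have gm: "g \<in> borel_measurable half_line" and Em: "E \<in> borel_measurable half_line"
    using g E by (auto intro!: half_line_measurable_continuous intro: continuous_on_subset)
  define p where "p s = indicat_real {..r} s *\<^sub>R g (r - s)" for s
  have pm: "p \<in> borel_measurable half_line"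
    unfolding p_def
    by (intro half_line_measurable_lborel borel_measurable_continuous_on_indicator
        continuous_on_compose2[OF g] continuous_intros) auto
  have "bounded (g ` {0..r})" "bounded (E ` {0..r})"
    by (intro compact_imp_bounded compact_continuous_image continuous_on_subset[OF g] continuous_on_subset[OF E]; auto)+
  then obtain A B where "\<forall>y\<in>g ` {0..r}. norm y \<le> A" "\<forall>y\<in>E ` {0..r}. norm y \<le> B"
    unfolding bounded_iff by auto
  then have A: "\<And>t. 0 \<le> t \<Longrightarrow> t \<le> r \<Longrightarrow> cmod (g t) \<le> max A 0"
    and B: "\<And>t. 0 \<le> t \<Longrightarrow> t \<le> r \<Longrightarrow> cmod (E t) \<le> max B 0" by force+
  define K where "K = max B 0 * max A 0"
  have K: "K \<ge> 0" unfolding K_def by simp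
  have bd: "cmod (E t * p (s + t)) \<le> K * (indicat_real {..r} t * indicat_real {..r} s)" if "s > 0" "t > 0" for s t
  proof (cases "s + t \<le> r")
    case True
    then have "cmod (E t) * cmod (g (r - (s + t))) \<le> max B 0 * max A 0"
      using that by (intro mult_mono A B) auto
    then show ?thesis using True that unfolding p_def K_def by (simp add: norm_mult)
  qed (use K in \<open>auto simp: p_def\<close>)
  have "(\<integral>\<^sup>+s. ennreal (cmod (F s)) * (\<integral>\<^sup>+t. ennreal (cmod (E t * p (s + t))) \<partial>half_line) \<partial>half_line)
    \<le> (\<integral>\<^sup>+s. ennreal (K * \<bar>r\<bar>) * (ennreal (cmod (F s)) * indicator {..r} s) \<partial>half_line)"
  proof (rule nn_integral_mono)
    fix s assume "s \<in> space half_line"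
    then have s: "s > 0" by simp
    have "(\<integral>\<^sup>+t. ennreal (cmod (E t * p (s + t))) \<partial>half_line)
      \<le> (\<integral>\<^sup>+t. ennreal (K * indicat_real {..r} s) * indicator {..r} t \<partial>half_line)"
    proof (rule nn_integral_mono)
      fix t assume "t \<in> space half_line"
      then have "t > 0" by simp
      from bd[OF s this] show "ennreal (cmod (E t * p (s + t))) \<le> ennreal (K * indicat_real {..r} s) * indicator {..r} t"
        using K by (auto simp: indicator_def intro: ennreal_leI split: if_splits)
    qed
    also have "\<dots> = ennreal (K * indicat_real {..r} s) * (\<integral>\<^sup>+t. indicator {..r} t \<partial>half_line)"
      by (intro nn_integral_cmult half_line_measurable_lborel) simp
    also have "\<dots> \<le> ennreal (K * indicat_real {..r} s) * ennreal \<bar>r\<bar>"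
      by (intro mult_left_mono nn_integral_half_line_atMost) simp
    also have "\<dots> = ennreal (K * \<bar>r\<bar>) * indicator {..r} s"
      using K by (auto simp: indicator_def ennreal_mult)
    finally have "ennreal (cmod (F s)) * (\<integral>\<^sup>+t. ennreal (cmod (E t * p (s + t))) \<partial>half_line)
      \<le> ennreal (cmod (F s)) * (ennreal (K * \<bar>r\<bar>) * indicator {..r} s)"
      by (rule mult_left_mono) simp
    then show "ennreal (cmod (F s)) * (\<integral>\<^sup>+t. ennreal (cmod (E t * p (s + t))) \<partial>half_line)
      \<le> ennreal (K * \<bar>r\<bar>) * (ennreal (cmod (F s)) * indicator {..r} s)" by (simp add: mult_ac)
  qed
  also have "\<dots> = ennreal (K * \<bar>r\<bar>) * (\<integral>\<^sup>+s. ennreal (cmod (F s)) * indicator {..r} s \<partial>half_line)"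
    using F half_line_measurable_lborel[of "indicator {..r} :: real \<Rightarrow> ennreal"]
    by (intro nn_integral_cmult borel_measurable_times_ennreal) auto
  also have "\<dots> < \<infinity>" using Fin by (simp add: ennreal_mult_less_top)
  finally have fin: "(\<integral>\<^sup>+s. ennreal (cmod (F s)) * (\<integral>\<^sup>+t. ennreal (cmod (E t * p (s + t))) \<partial>half_line) \<partial>half_line) < \<infinity>" .
  have inner: "(LINT t|half_line. E t * p (s + t)) = indicat_real {..r} s *\<^sub>R convol g E (r - s)" if s: "s > 0" for s
  proof -
    have "(LINT t|half_line. E t * p (s + t)) =
      (LINT t|half_line. indicat_real {..r} s *\<^sub>R (indicat_real {..r - s} t *\<^sub>R (g (r - s - t) * E t)))"
      using s by (intro Bochner_Integration.integral_cong) (auto simp: p_def indicator_def algebra_simps)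
    also have "\<dots> = indicat_real {..r} s *\<^sub>R (LINT t|half_line. indicat_real {..r - s} t *\<^sub>R (g (r - s - t) * E t))"
      by (rule integral_scaleR_right)
    finally show ?thesis by (simp only: convol_half_line[OF gm Em])
  qed
  have "convol g (convol E F) r = (LINT s|half_line. convol E F s * p s)"
    unfolding convol_half_line[OF gm convol_measurable[OF Em F]]
    by (intro Bochner_Integration.integral_cong) (auto simp: p_def mult.commute)
  also have "\<dots> = (LINT s|half_line. F s * (LINT t|half_line. E t * p (s + t)))"
    by (rule convol_integral(2)[OF Em F pm fin])
  also have "\<dots> = (LINT s|half_line. indicat_real {..r} s *\<^sub>R (convol g E (r - s) * F s))"
    by (intro Bochner_Integration.integral_cong) (auto simp: inner)
  also have "\<dots> = convol (convol g E) F r"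
    by (rule convol_half_line[OF convol_measurable[OF gm Em] F, symmetric])
  finally show ?thesis .
qed

section \<open>Exponential kernels and the inversion of \<mu> + d/dt\<close>

definition exp_kernel :: "complex \<Rightarrow> real \<Rightarrow> complex" where
  "exp_kernel \<mu> t = exp (- \<mu> * complex_of_real t)"

lemma continuous_exp_kernel: "continuous_on S (exp_kernel \<mu>)"
  unfolding exp_kernel_def by (intro continuous_intros)

lemma exp_kernel_measurable: "exp_kernel \<mu> \<in> borel_measurable half_line"
  by (intro half_line_measurable_continuous continuous_exp_kernel)

lemma C1_ray_has_derivative:
  assumes "C1_ray f" "t \<ge> 0"
  shows "(f has_vector_derivative deriv_ray f t) (at t within {0..})"
  using assms unfolding C1_ray_def deriv_ray_def by (auto simp: vector_derivative_works)

lemma C1_ray_continuous: "C1_ray f \<Longrightarrow> continuous_on {0..} f"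
  unfolding continuous_on_eq_continuous_within
  using C1_ray_has_derivative has_vector_derivative_continuous by fastforce

text \<open>\<Phi> of this function is (\<mu> - \<Delta>) \<Phi>(f), because \<Phi>(f') = - \<Delta>
  \<Phi>(f) for the generating functions \<open>f\<close>.\<close>

definition resolvend_fun :: "(real \<Rightarrow> complex) \<Rightarrow> complex \<Rightarrow> real \<Rightarrow> complex" where
  "resolvend_fun f \<mu> t = \<mu> * f t + deriv_ray f t"

lemma continuous_resolvend_fun: "C1_ray f \<Longrightarrow> continuous_on {0..} (resolvend_fun f \<mu>)"
  unfolding resolvend_fun_def using C1_ray_continuous
  by (intro continuous_intros) (auto simp: C1_ray_def)

text \<open>The integrand is the derivative in \<open>s\<close> of - exp(-\<mu> s) f(r - s). The
  boundary term at s = r vanishes since f(0) = 0, and the one at s = 0 is f(r).\<close>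

lemma convol_resolvend_exp:
  assumes f: "C1_ray f" "f 0 = 0" and r: "r \<ge> 0"
  shows "convol (resolvend_fun f \<mu>) (exp_kernel \<mu>) r = f r"
proof -
  define H where "H s = - (exp_kernel \<mu> s * f (r - s))" for s
  have "(H has_vector_derivative (resolvend_fun f \<mu> (r - s) * exp_kernel \<mu> s)) (at s within {0..r})"
    if s: "s \<in> {0..r}" for s
  proof -
    have d1: "(f has_vector_derivative deriv_ray f (r - s)) (at (r - s) within (\<lambda>s. r - s) ` {0..r})"
      using s by (intro has_vector_derivative_within_subset[OF C1_ray_has_derivative[OF f(1)]]) auto
    have d2: "((\<lambda>s. r - s) has_vector_derivative (-1)) (at s within {0..r})"
      by (auto intro!: derivative_eq_intros)
    have d3: "((\<lambda>s. f (r - s)) has_vector_derivative (-1) *\<^sub>R deriv_ray f (r - s)) (at s within {0..r})"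
      using vector_diff_chain_within[OF d2 d1] by (simp add: comp_def)
    have d4: "(exp_kernel \<mu> has_vector_derivative (- \<mu> * exp_kernel \<mu> s)) (at s within {0..r})"
      unfolding exp_kernel_def
      by (rule has_vector_derivative_real_field) (auto intro!: derivative_eq_intros)
    show ?thesis unfolding H_def
      by (rule derivative_eq_intros d4 d3 refl)+ (simp add: resolvend_fun_def algebra_simps)
  qed
  then have hi: "((\<lambda>s. resolvend_fun f \<mu> (r - s) * exp_kernel \<mu> s) has_integral H r - H 0) {0..r}"
    by (intro fundamental_theorem_of_calculus r)
  have co: "continuous_on {0..r} (\<lambda>s. resolvend_fun f \<mu> (r - s) * exp_kernel \<mu> s)"
    by (intro continuous_intros continuous_exp_kernel
        continuous_on_compose2[OF continuous_resolvend_fun[OF f(1)]]) auto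
  have "convol (resolvend_fun f \<mu>) (exp_kernel \<mu>) r = integral {0..r} (\<lambda>s. resolvend_fun f \<mu> (r - s) * exp_kernel \<mu> s)"
    unfolding convol_def
    by (intro lebesgue_integral_eq_integral continuous_imp_integrable_real co) auto
  also have "\<dots> = H r - H 0" using hi by (rule integral_unique)
  also have "\<dots> = f r" unfolding H_def exp_kernel_def using f(2) by simp
  finally show ?thesis .
qed

section \<open>Test functions and their transforms\<close>

definition test_fun :: "(real \<Rightarrow> complex) \<Rightarrow> bool" where
  "test_fun f \<longleftrightarrow> integrable half_line f \<and> (\<exists>a>0. \<exists>b. \<forall>t. t \<notin> {a..b} \<longrightarrow> f t = 0)"

text \<open>The exponent has a positive sign: a character with value \<mu> at the generator formally
  maps T(t) to exp(\<mu> t). The integral converges for every \<mu> because test functions have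
  compact support.\<close>

definition laplace :: "(real \<Rightarrow> complex) \<Rightarrow> complex \<Rightarrow> complex" where
  "laplace f \<mu> = (LINT t|half_line. f t * exp (\<mu> * complex_of_real t))"

lemma test_fun_measurable: "test_fun f \<Longrightarrow> f \<in> borel_measurable half_line"
  unfolding test_fun_def by auto

lemma test_fun_mult_integrable:
  assumes f: "test_fun f" and k: "k \<in> borel_measurable half_line"
    and bd: "\<And>a b. 0 < a \<Longrightarrow> \<exists>K. \<forall>t\<in>{a..b}. cmod (k t) \<le> K"
  shows "integrable half_line (\<lambda>t. f t * k t)"
proof -
  obtain a b where ab: "a > 0" "\<And>t. t \<notin> {a..b} \<Longrightarrow> f t = 0" and i: "integrable half_line f"
    using f unfolding test_fun_def by blast
  obtain K where K: "\<forall>t\<in>{a..b}. cmod (k t) \<le> K" using bd[OF ab(1)] by blast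
  show ?thesis
  proof (rule Bochner_Integration.integrable_bound)
    show "integrable half_line (\<lambda>t. K *\<^sub>R f t)" using i by simp
    show "(\<lambda>t. f t * k t) \<in> borel_measurable half_line"
      using k test_fun_measurable[OF f] by (rule borel_measurable_times[rotated])
    show "AE t in half_line. norm (f t * k t) \<le> norm (K *\<^sub>R f t)"
    proof (rule AE_I2)
      fix t
      show "norm (f t * k t) \<le> norm (K *\<^sub>R f t)"
      proof (cases "t \<in> {a..b}")
        case True
        then have "cmod (k t) \<le> \<bar>K\<bar>" using K by force
        from mult_left_mono[OF this, of "cmod (f t)"] show ?thesis by (simp add: norm_mult mult.commute)
      qed (simp add: ab(2))
    qed
  qed
qed

lemma test_fun_exp_integrable:
  assumes f: "test_fun f"
  shows "integrable half_line (\<lambda>t. f t * exp (\<mu> * complex_of_real t))"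
proof (rule test_fun_mult_integrable[OF f])
  have c: "continuous_on S (\<lambda>t. exp (\<mu> * complex_of_real t))" for S :: "real set" by (intro continuous_intros)
  show "(\<lambda>t. exp (\<mu> * complex_of_real t)) \<in> borel_measurable half_line"
    by (rule half_line_measurable_continuous[OF c])
  show "\<exists>K. \<forall>t\<in>{a..b}. cmod (exp (\<mu> * complex_of_real t)) \<le> K" for a b :: real
    using compact_imp_bounded[OF compact_continuous_image[OF c compact_Icc]] unfolding bounded_iff by blast
qed

lemma test_fun_add:
  assumes "test_fun f" "test_fun g"
  shows "test_fun (\<lambda>t. f t + g t)"
proof -
  obtain a b where ab: "a > 0" "\<And>t. t \<notin> {a..b} \<Longrightarrow> f t = 0" and i: "integrable half_line f"
    using assms unfolding test_fun_def by blast
  obtain c d where cd: "c > 0" "\<And>t. t \<notin> {c..d} \<Longrightarrow> g t = 0" and j: "integrable half_line g"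
    using assms unfolding test_fun_def by blast
  have "f t + g t = 0" if "t \<notin> {min a c..max b d}" for t
  proof -
    have "f t = 0" by (rule ab(2)) (use that in auto)
    moreover have "g t = 0" by (rule cd(2)) (use that in auto)
    ultimately show ?thesis by simp
  qed
  then show ?thesis unfolding test_fun_def
    using ab(1) cd(1) i j by (intro conjI exI[of _ "min a c"] exI[of _ "max b d"]) auto
qed

lemma test_fun_scale: "test_fun f \<Longrightarrow> test_fun (\<lambda>t. c * f t)"
  unfolding test_fun_def by auto

lemma laplace_add: "test_fun f \<Longrightarrow> test_fun g \<Longrightarrow> laplace (\<lambda>t. f t + g t) \<mu> = laplace f \<mu> + laplace g \<mu>"
  unfolding laplace_def using test_fun_exp_integrable by (simp add: algebra_simps)

lemma laplace_scale: "laplace (\<lambda>t. c * f t) \<mu> = c * laplace f \<mu>"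
  unfolding laplace_def by (simp add: mult.assoc)

text \<open>Dominated convergence: along a convergent sequence of parameters the exponentials are
  uniformly bounded on the support of \<open>f\<close>. This is what makes the resolvent set
  open.\<close>

lemma laplace_continuous:
  assumes f: "test_fun f"
  shows "isCont (laplace f) \<mu>"
proof -
  obtain a b where ab: "a > 0" "\<And>t. t \<notin> {a..b} \<Longrightarrow> f t = 0" and i: "integrable half_line f"
    using f unfolding test_fun_def by blast
  have "(\<lambda>n. laplace f (X n)) \<longlonglongrightarrow> laplace f \<mu>" if X: "X \<longlonglongrightarrow> \<mu>" for X
  proof -
    obtain R where R: "\<And>n. norm (X n) \<le> R" using convergent_imp_Bseq[OF convergentI[OF X]] unfolding Bseq_def by blast
    show ?thesis unfolding laplace_def
    proof (rule integral_dominated_convergence)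
      show "(\<lambda>t. f t * exp (\<mu> * complex_of_real t)) \<in> borel_measurable half_line"
        "\<And>n. (\<lambda>t. f t * exp (X n * complex_of_real t)) \<in> borel_measurable half_line"
        using test_fun_exp_integrable[OF f] by auto
      show "integrable half_line (\<lambda>t. cmod (f t) * exp (R * \<bar>b\<bar>))" using i by simp
      show "AE t in half_line. (\<lambda>n. f t * exp (X n * complex_of_real t)) \<longlonglongrightarrow> f t * exp (\<mu> * complex_of_real t)"
        by (intro AE_I2 tendsto_intros X)
      show "AE t in half_line. norm (f t * exp (X n * complex_of_real t)) \<le> cmod (f t) * exp (R * \<bar>b\<bar>)" for n
      proof (rule AE_I2)
        fix t
        show "norm (f t * exp (X n * complex_of_real t)) \<le> cmod (f t) * exp (R * \<bar>b\<bar>)"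
        proof (cases "t \<in> {a..b}")
          case True
          have "Re (X n) * t \<le> R * \<bar>b\<bar>"
            using True ab(1) R[of n] abs_Re_le_cmod[of "X n"] by (intro mult_mono) auto
          then show ?thesis by (simp add: norm_mult mult_left_mono)
        qed (simp add: ab(2))
      qed
    qed
  qed
  then show ?thesis unfolding continuous_at_sequentially comp_def by blast
qed

lemma test_fun_convol:
  assumes f: "test_fun f" and g: "test_fun g"
  shows "test_fun (convol f g)" and "laplace (convol f g) \<mu> = laplace f \<mu> * laplace g \<mu>"
proof -
  note fm = test_fun_measurable[OF f] and gm = test_fun_measurable[OF g]
  obtain a b where ab: "a > 0" "\<And>t. t \<notin> {a..b} \<Longrightarrow> f t = 0"
    using f unfolding test_fun_def by blast
  obtain c d where cd: "c > 0" "\<And>t. t \<notin> {c..d} \<Longrightarrow> g t = 0"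
    using g unfolding test_fun_def by blast
  have main: "integrable half_line (\<lambda>r. convol f g r * exp (\<mu> * complex_of_real r)) \<and>
    laplace (convol f g) \<mu> = laplace f \<mu> * laplace g \<mu>" for \<mu>
  proof -
    let ?p = "\<lambda>t. exp (\<mu> * complex_of_real t)"
    have pm: "?p \<in> borel_measurable half_line"
      by (rule half_line_measurable_continuous) (intro continuous_intros)
    have pe: "?p (s + t) = ?p s * ?p t" for s t by (simp add: exp_add[symmetric] algebra_simps)
    have if1: "(\<integral>\<^sup>+t. ennreal (cmod (f t * ?p t)) \<partial>half_line) < \<infinity>"
      and ig1: "(\<integral>\<^sup>+t. ennreal (cmod (g t * ?p t)) \<partial>half_line) < \<infinity>"
      using test_fun_exp_integrable f g by (auto simp: integrable_iff_bounded)
    have "(\<integral>\<^sup>+s. ennreal (cmod (g s)) * (\<integral>\<^sup>+t. ennreal (cmod (f t * ?p (s + t))) \<partial>half_line) \<partial>half_line)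
      = (\<integral>\<^sup>+s. ennreal (cmod (g s * ?p s)) * (\<integral>\<^sup>+t. ennreal (cmod (f t * ?p t)) \<partial>half_line) \<partial>half_line)"
    proof (rule nn_integral_cong)
      fix s
      have "(\<integral>\<^sup>+t. ennreal (cmod (f t * ?p (s + t))) \<partial>half_line)
        = (\<integral>\<^sup>+t. ennreal (cmod (?p s)) * ennreal (cmod (f t * ?p t)) \<partial>half_line)"
        by (intro nn_integral_cong) (simp only: pe norm_mult ennreal_mult'[symmetric] norm_ge_zero mult_ac)
      also have "\<dots> = ennreal (cmod (?p s)) * (\<integral>\<^sup>+t. ennreal (cmod (f t * ?p t)) \<partial>half_line)"
        using fm pm by (intro nn_integral_cmult) measurable
      finally show "ennreal (cmod (g s)) * (\<integral>\<^sup>+t. ennreal (cmod (f t * ?p (s + t))) \<partial>half_line)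
        = ennreal (cmod (g s * ?p s)) * (\<integral>\<^sup>+t. ennreal (cmod (f t * ?p t)) \<partial>half_line)"
        by (simp only: norm_mult ennreal_mult norm_ge_zero mult.assoc)
    qed
    also have "\<dots> = (\<integral>\<^sup>+s. ennreal (cmod (g s * ?p s)) \<partial>half_line) * (\<integral>\<^sup>+t. ennreal (cmod (f t * ?p t)) \<partial>half_line)"
      using gm pm by (intro nn_integral_multc) measurable
    also have "\<dots> < \<infinity>" using if1 ig1 by (simp add: ennreal_mult_less_top)
    finally have fin: "(\<integral>\<^sup>+s. ennreal (cmod (g s)) * (\<integral>\<^sup>+t. ennreal (cmod (f t * ?p (s + t))) \<partial>half_line) \<partial>half_line) < \<infinity>" .
    note ci = convol_integral[OF fm gm pm fin]
    have "(LINT t|half_line. f t * ?p (s + t)) = ?p s * laplace f \<mu>" for s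
    proof -
      have "(LINT t|half_line. f t * ?p (s + t)) = (LINT t|half_line. ?p s * (f t * ?p t))"
        by (intro Bochner_Integration.integral_cong refl) (simp only: pe mult_ac)
      then show ?thesis by (simp add: laplace_def)
    qed
    then have "laplace (convol f g) \<mu> = (LINT s|half_line. g s * (?p s * laplace f \<mu>))"
      using ci(2) by (simp add: laplace_def)
    also have "\<dots> = laplace f \<mu> * laplace g \<mu>" unfolding laplace_def by (simp add: mult.assoc[symmetric] mult.commute)
    finally show ?thesis using ci(1) by blast
  qed
  show "laplace (convol f g) \<mu> = laplace f \<mu> * laplace g \<mu>" using main by blast
  \<comment> \<open>At \<mu> = 0 the exponential factor is 1.\<close>
  have "integrable half_line (convol f g)" using main[of 0] by simp
  moreover have "convol f g t = 0" if "t \<notin> {a + c..b + d}" for t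
  proof -
    have "f (t - s) * g s = 0" for s
      using ab(2)[of "t - s"] cd(2)[of s] that by (cases "s \<in> {c..d}") auto
    then have "(\<lambda>s. f (t - s) * g s) = (\<lambda>s. 0)" by blast
    then show ?thesis unfolding convol_def by (simp only: integral_zero)
  qed
  ultimately show "test_fun (convol f g)" unfolding test_fun_def
    using ab(1) cd(1) by (intro conjI exI[of _ "a + c"] exI[of _ "b + d"]) auto
qed

lemma convol_exp_kernel:
  assumes F: "F \<in> borel_measurable half_line"
  shows "convol (exp_kernel \<mu>) F r =
    exp_kernel \<mu> r * (LINT s|half_line. indicat_real {..r} s *\<^sub>R (F s * exp (\<mu> * complex_of_real s)))"
proof -
  have "convol (exp_kernel \<mu>) F r
    = (LINT s|half_line. exp_kernel \<mu> r * (indicat_real {..r} s *\<^sub>R (F s * exp (\<mu> * complex_of_real s))))"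
    unfolding convol_half_line[OF exp_kernel_measurable F]
  proof (intro Bochner_Integration.integral_cong refl)
    fix s
    have "exp_kernel \<mu> (r - s) = exp_kernel \<mu> r * exp (\<mu> * complex_of_real s)"
      unfolding exp_kernel_def by (simp add: exp_add[symmetric] algebra_simps)
    then show "indicat_real {..r} s *\<^sub>R (exp_kernel \<mu> (r - s) * F s) =
      exp_kernel \<mu> r * (indicat_real {..r} s *\<^sub>R (F s * exp (\<mu> * complex_of_real s)))" by simp
  qed
  also have "\<dots> = exp_kernel \<mu> r * (LINT s|half_line. indicat_real {..r} s *\<^sub>R (F s * exp (\<mu> * complex_of_real s)))"
    by (rule integral_mult_right_zero)
  finally show ?thesis .
qed

text \<open>The convolution is the exponential times a truncated transform of \<open>F\<close>. To
  the left of the support the truncation is 0, to the right it is the full transform, and in between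
  it is bounded by the absolute integral \<open>K\<close>.\<close>

lemma convol_exp_kernel_test:
  assumes F: "test_fun F"
  obtains a b K where "a > 0" "\<And>r. r < a \<Longrightarrow> convol (exp_kernel \<mu>) F r = 0"
    "\<And>r. r \<ge> b \<Longrightarrow> convol (exp_kernel \<mu>) F r = laplace F \<mu> * exp_kernel \<mu> r"
    "\<And>r. cmod (convol (exp_kernel \<mu>) F r) \<le> K * cmod (exp_kernel \<mu> r)" "K \<ge> 0" "b > 0"
proof -
  note Fm = test_fun_measurable[OF F]
  obtain a b where ab: "a > 0" "\<And>t. t \<notin> {a..b} \<Longrightarrow> F t = 0"
    using F unfolding test_fun_def by blast
  note cv = convol_exp_kernel[OF Fm, of \<mu>]
  define K where "K = (LINT s|half_line. cmod (F s * exp (\<mu> * complex_of_real s)))"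
  show thesis
  proof (rule that[of a "max b 1" K])
    show "a > 0" by (rule ab)
    show "convol (exp_kernel \<mu>) F r = 0" if "r < a" for r
    proof -
      have "(\<lambda>s. indicat_real {..r} s *\<^sub>R (F s * exp (\<mu> * complex_of_real s))) = (\<lambda>s. 0)"
        using ab(2) that by (auto simp: indicator_def fun_eq_iff)
      then show ?thesis unfolding cv by (simp only: integral_zero mult_zero_right)
    qed
    show "convol (exp_kernel \<mu>) F r = laplace F \<mu> * exp_kernel \<mu> r" if "r \<ge> max b 1" for r
    proof -
      have "(\<lambda>s. indicat_real {..r} s *\<^sub>R (F s * exp (\<mu> * complex_of_real s))) = (\<lambda>s. F s * exp (\<mu> * complex_of_real s))"
        using ab(2) that by (auto simp: indicator_def fun_eq_iff)
      then show ?thesis unfolding cv laplace_def by (simp only: mult.commute)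
    qed
    show "cmod (convol (exp_kernel \<mu>) F r) \<le> K * cmod (exp_kernel \<mu> r)" for r
    proof -
      have "cmod (LINT s|half_line. indicat_real {..r} s *\<^sub>R (F s * exp (\<mu> * complex_of_real s))) \<le> K"
        unfolding K_def
      proof (rule Bochner_Integration.integral_norm_bound_integral)
        show i: "integrable half_line (\<lambda>s. cmod (F s * exp (\<mu> * complex_of_real s)))"
          by (intro integrable_norm test_fun_exp_integrable F)
        show "integrable half_line (\<lambda>s. indicat_real {..r} s *\<^sub>R (F s * exp (\<mu> * complex_of_real s)))"
        proof (rule Bochner_Integration.integrable_bound[OF test_fun_exp_integrable[OF F, of \<mu>]])
          show "(\<lambda>s. indicat_real {..r} s *\<^sub>R (F s * exp (\<mu> * complex_of_real s))) \<in> borel_measurable half_line"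
            by (rule borel_measurable_scaleR[OF half_line_measurable_lborel
                  borel_measurable_integrable[OF test_fun_exp_integrable[OF F]]]) simp
        qed (auto simp: indicator_def)
      qed (auto simp: indicator_def)
      from mult_left_mono[OF this, of "cmod (exp_kernel \<mu> r)"] show ?thesis
        unfolding cv norm_mult by (simp only: norm_ge_zero mult.commute)
    qed
    show "K \<ge> 0" unfolding K_def by simp
  qed auto
qed

section \<open>Weighted convolution algebras and multipliers\<close>

text \<open>Bounds are asked for on {a..b} with a > 0 only, because the norm of a strongly
  continuous semigroup may be unbounded near 0.\<close>

definition weight_fun :: "(real \<Rightarrow> real) \<Rightarrow> bool" where
  "weight_fun \<omega> \<longleftrightarrow> \<omega> \<in> borel_measurable half_line \<and> (\<forall>t>0. 0 < \<omega> t) \<and>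
     (\<forall>s>0. \<forall>t>0. \<omega> (s + t) \<le> \<omega> s * \<omega> t) \<and> (\<forall>a>0. \<forall>b. \<exists>K. \<forall>t\<in>{a..b}. \<omega> t \<le> K)"

lemma L1w_norm_measurable:
  assumes "weight_fun \<omega>" "f \<in> borel_measurable half_line"
  shows "(\<lambda>t. ennreal (cmod (f t) * \<omega> t)) \<in> borel_measurable half_line"
proof -
  have [measurable]: "\<omega> \<in> borel_measurable half_line" using assms unfolding weight_fun_def by blast
  note [measurable] = assms(2)
  show ?thesis by measurable
qed

lemma L1w_measurable: "f \<in> L1w \<omega> \<Longrightarrow> f \<in> borel_measurable half_line"
  unfolding L1w_def by blast

lemma L1w_fin: "f \<in> L1w \<omega> \<Longrightarrow> (\<integral>\<^sup>+ t. ennreal (cmod (f t) * \<omega> t) \<partial>half_line) < \<infinity>"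
  unfolding L1w_def by blast

lemma L1w_add:
  assumes w: "weight_fun \<omega>" and f: "f \<in> L1w \<omega>" and g: "g \<in> L1w \<omega>"
  shows "(\<lambda>t. f t + g t) \<in> L1w \<omega>"
proof -
  have "(\<integral>\<^sup>+ t. ennreal (cmod (f t + g t) * \<omega> t) \<partial>half_line)
    \<le> (\<integral>\<^sup>+ t. ennreal (cmod (f t) * \<omega> t) + ennreal (cmod (g t) * \<omega> t) \<partial>half_line)"
  proof (rule nn_integral_mono)
    fix t assume "t \<in> space half_line"
    then have w0: "\<omega> t \<ge> 0" using w unfolding weight_fun_def by (simp add: less_imp_le)
    have "cmod (f t + g t) * \<omega> t \<le> cmod (f t) * \<omega> t + cmod (g t) * \<omega> t"
      using mult_right_mono[OF norm_triangle_ineq[of "f t" "g t"] w0] by (simp add: algebra_simps)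
    then show "ennreal (cmod (f t + g t) * \<omega> t) \<le> ennreal (cmod (f t) * \<omega> t) + ennreal (cmod (g t) * \<omega> t)"
      using w0 by (simp add: ennreal_leI flip: ennreal_plus)
  qed
  also have "\<dots> = (\<integral>\<^sup>+ t. ennreal (cmod (f t) * \<omega> t) \<partial>half_line) + (\<integral>\<^sup>+ t. ennreal (cmod (g t) * \<omega> t) \<partial>half_line)"
    using L1w_norm_measurable[OF w] L1w_measurable f g by (intro nn_integral_add) auto
  also have "\<dots> < \<infinity>" using L1w_fin f g by simp
  finally show ?thesis
    using borel_measurable_add[OF L1w_measurable[OF f] L1w_measurable[OF g]] unfolding L1w_def by blast
qed

lemma L1w_scale:
  assumes w: "weight_fun \<omega>" and f: "f \<in> L1w \<omega>"
  shows "(\<lambda>t. c * f t) \<in> L1w \<omega>"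
proof -
  have "(\<integral>\<^sup>+ t. ennreal (cmod (c * f t) * \<omega> t) \<partial>half_line) = (\<integral>\<^sup>+ t. ennreal (cmod c) * ennreal (cmod (f t) * \<omega> t) \<partial>half_line)"
    by (intro nn_integral_cong) (simp add: norm_mult ennreal_mult'[symmetric] mult.assoc)
  also have "\<dots> = ennreal (cmod c) * (\<integral>\<^sup>+ t. ennreal (cmod (f t) * \<omega> t) \<partial>half_line)"
    by (intro nn_integral_cmult L1w_norm_measurable[OF w] L1w_measurable[OF f])
  also have "\<dots> < \<infinity>" using L1w_fin[OF f] by (simp add: ennreal_mult_less_top)
  finally show ?thesis
    using borel_measurable_times[OF borel_measurable_const L1w_measurable[OF f]] unfolding L1w_def by blast
qed

lemma L1w_diff:
  assumes "weight_fun \<omega>" "f \<in> L1w \<omega>" "g \<in> L1w \<omega>"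
  shows "(\<lambda>t. f t - g t) \<in> L1w \<omega>"
  using L1w_add[OF assms(1,2) L1w_scale[OF assms(1,3), of "-1"]] by simp

lemma L1w_mono:
  assumes f: "f \<in> L1w \<omega>" and le: "\<And>t. t > 0 \<Longrightarrow> \<omega>' t \<le> \<omega> t"
  shows "f \<in> L1w \<omega>'"
proof -
  have "(\<integral>\<^sup>+ t. ennreal (cmod (f t) * \<omega>' t) \<partial>half_line) \<le> (\<integral>\<^sup>+ t. ennreal (cmod (f t) * \<omega> t) \<partial>half_line)"
    using le by (intro nn_integral_mono ennreal_leI mult_left_mono) auto
  also have "\<dots> < \<infinity>" by (rule L1w_fin[OF f])
  finally show ?thesis using f unfolding L1w_def by blast
qed

text \<open>Submultiplicativity separates the variables in \<omega>(s + t). This supplies the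
  finiteness condition of \<open>convol_integral\<close> for every kernel dominated by the
  weight.\<close>

lemma L1w_iterated_finite:
  assumes w: "weight_fun \<omega>" and f: "f \<in> L1w \<omega>" and g: "g \<in> L1w \<omega>"
    and le: "\<And>t. t > 0 \<Longrightarrow> cmod (k t) \<le> C * \<omega> t" and C: "C \<ge> 0"
  shows "(\<integral>\<^sup>+s. ennreal (cmod (g s)) * (\<integral>\<^sup>+t. ennreal (cmod (f t * k (s + t))) \<partial>half_line) \<partial>half_line) < \<infinity>"
proof -
  let ?F = "\<integral>\<^sup>+ t. ennreal (cmod (f t) * \<omega> t) \<partial>half_line"
  have "(\<integral>\<^sup>+s. ennreal (cmod (g s)) * (\<integral>\<^sup>+t. ennreal (cmod (f t * k (s + t))) \<partial>half_line) \<partial>half_line)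
    \<le> (\<integral>\<^sup>+s. ennreal (cmod (g s) * \<omega> s) * (ennreal C * ?F) \<partial>half_line)"
  proof (rule nn_integral_mono)
    fix s assume "s \<in> space half_line"
    then have s: "s > 0" by simp
    then have ws: "\<omega> s \<ge> 0" using w unfolding weight_fun_def by (simp add: less_imp_le)
    have "(\<integral>\<^sup>+t. ennreal (cmod (f t * k (s + t))) \<partial>half_line)
      \<le> (\<integral>\<^sup>+t. ennreal (C * \<omega> s) * ennreal (cmod (f t) * \<omega> t) \<partial>half_line)"
    proof (rule nn_integral_mono)
      fix t assume "t \<in> space half_line"
      then have t: "t > 0" by simp
      have "cmod (k (s + t)) \<le> C * \<omega> (s + t)" using s t by (intro le) simp
      also have "\<dots> \<le> C * (\<omega> s * \<omega> t)" using w s t C unfolding weight_fun_def by (intro mult_left_mono) auto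
      finally have "cmod (f t) * cmod (k (s + t)) \<le> cmod (f t) * (C * (\<omega> s * \<omega> t))" by (rule mult_left_mono) simp
      then show "ennreal (cmod (f t * k (s + t))) \<le> ennreal (C * \<omega> s) * ennreal (cmod (f t) * \<omega> t)"
        using C ws by (simp add: norm_mult ennreal_leI mult_ac flip: ennreal_mult')
    qed
    also have "\<dots> = ennreal (C * \<omega> s) * ?F"
      by (intro nn_integral_cmult L1w_norm_measurable[OF w] L1w_measurable[OF f])
    finally have "ennreal (cmod (g s)) * (\<integral>\<^sup>+t. ennreal (cmod (f t * k (s + t))) \<partial>half_line)
      \<le> ennreal (cmod (g s)) * (ennreal (C * \<omega> s) * ?F)" by (rule mult_left_mono) simp
    also have "\<dots> = ennreal (cmod (g s) * \<omega> s) * (ennreal C * ?F)"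
      using ws C by (simp add: ennreal_mult mult_ac)
    finally show "ennreal (cmod (g s)) * (\<integral>\<^sup>+t. ennreal (cmod (f t * k (s + t))) \<partial>half_line)
      \<le> ennreal (cmod (g s) * \<omega> s) * (ennreal C * ?F)" .
  qed
  also have "\<dots> = (\<integral>\<^sup>+ t. ennreal (cmod (g t) * \<omega> t) \<partial>half_line) * (ennreal C * ?F)"
    by (intro nn_integral_multc L1w_norm_measurable[OF w] L1w_measurable[OF g])
  also have "\<dots> < \<infinity>" using L1w_fin[OF f] L1w_fin[OF g] by (simp add: ennreal_mult_less_top)
  finally show ?thesis .
qed

text \<open>The estimate for paired convolutions is applied with the weight itself as the
  kernel.\<close>

lemma L1w_convol:
  assumes w: "weight_fun \<omega>" and f: "f \<in> L1w \<omega>" and g: "g \<in> L1w \<omega>"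
  shows "convol f g \<in> L1w \<omega>"
proof -
  have wm: "(\<lambda>t. complex_of_real (\<omega> t)) \<in> borel_measurable half_line"
  proof -
    have [measurable]: "\<omega> \<in> borel_measurable half_line" using w unfolding weight_fun_def by blast
    show ?thesis by measurable
  qed
  have wp: "\<omega> t \<ge> 0" if "t > 0" for t using w that unfolding weight_fun_def by (simp add: less_imp_le)
  have "(\<integral>\<^sup>+ t. ennreal (cmod (convol f g t) * \<omega> t) \<partial>half_line)
    = (\<integral>\<^sup>+ t. ennreal (cmod (convol f g t * complex_of_real (\<omega> t))) \<partial>half_line)"
    using wp by (intro nn_integral_cong) (simp add: norm_mult)
  also have "\<dots> \<le> (\<integral>\<^sup>+s. ennreal (cmod (g s)) * (\<integral>\<^sup>+t. ennreal (cmod (f t * complex_of_real (\<omega> (s + t)))) \<partial>half_line) \<partial>half_line)"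
    by (rule convol_nn_integral_le[OF L1w_measurable[OF f] L1w_measurable[OF g] wm])
  also have "\<dots> < \<infinity>"
    by (rule L1w_iterated_finite[OF w f g, of "\<lambda>t. complex_of_real (\<omega> t)" 1]) (use wp in auto)
  finally show ?thesis using convol_measurable[OF L1w_measurable[OF f] L1w_measurable[OF g]] unfolding L1w_def by blast
qed

lemma L1w_integrable_bounded:
  assumes w: "weight_fun \<omega>" and f: "integrable half_line f"
    and bd: "\<And>t. t > 0 \<Longrightarrow> f t \<noteq> 0 \<Longrightarrow> \<omega> t \<le> K"
  shows "f \<in> L1w \<omega>"
proof -
  have "(\<integral>\<^sup>+ t. ennreal (cmod (f t) * \<omega> t) \<partial>half_line) \<le> (\<integral>\<^sup>+ t. ennreal (cmod (f t)) * ennreal \<bar>K\<bar> \<partial>half_line)"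
  proof (rule nn_integral_mono)
    fix t assume "t \<in> space half_line"
    then have t: "t > 0" by simp
    have "cmod (f t) * \<omega> t \<le> cmod (f t) * \<bar>K\<bar>"
      using bd[OF t] by (cases "f t = 0") (auto intro!: mult_left_mono)
    then show "ennreal (cmod (f t) * \<omega> t) \<le> ennreal (cmod (f t)) * ennreal \<bar>K\<bar>"
      by (simp add: ennreal_leI flip: ennreal_mult')
  qed
  also have "\<dots> = (\<integral>\<^sup>+ t. ennreal (cmod (f t)) \<partial>half_line) * ennreal \<bar>K\<bar>"
    using f by (intro nn_integral_multc) auto
  also have "\<dots> < \<infinity>" using f by (simp add: integrable_iff_bounded ennreal_mult_less_top)
  finally show ?thesis using f unfolding L1w_def by auto
qed

lemma test_fun_L1w:
  assumes w: "weight_fun \<omega>" and f: "test_fun f"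
  shows "f \<in> L1w \<omega>"
proof -
  obtain a b where ab: "a > 0" "\<And>t. t \<notin> {a..b} \<Longrightarrow> f t = 0" and i: "integrable half_line f"
    using f unfolding test_fun_def by blast
  obtain K where "\<forall>t\<in>{a..b}. \<omega> t \<le> K" using w ab(1) unfolding weight_fun_def by meson
  then show ?thesis using ab(2) by (intro L1w_integrable_bounded[OF w i]) blast
qed

text \<open>One has \<omega>(b + 1) \<le> \<omega>(t) \<omega>(b + 1 - t), and the last factor is
  bounded since b + 1 - t \<ge> 1 stays away from 0. Consequently a truncated element of the
  weighted space is integrable and therefore a test function.\<close>

lemma weight_fun_lower_bound:
  assumes w: "weight_fun \<omega>" and a: "a > 0"
  shows "\<exists>c>0. \<forall>t\<in>{a..b}. c \<le> \<omega> t"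
proof -
  obtain K where K: "\<forall>t\<in>{1..b + 1 - a}. \<omega> t \<le> K" using w unfolding weight_fun_def by (meson zero_less_one)
  show ?thesis
  proof (cases "a \<le> b")
    case True
    have wb: "\<omega> (b + 1) > 0" using w a True unfolding weight_fun_def by simp
    have "\<omega> (b + 1) / max K 1 \<le> \<omega> t" if t: "t \<in> {a..b}" for t
    proof -
      have wt: "\<omega> t > 0" using w a t unfolding weight_fun_def by simp
      have "\<omega> (t + (b + 1 - t)) \<le> \<omega> t * \<omega> (b + 1 - t)"
        using w a t unfolding weight_fun_def by (metis atLeastAtMost_iff diff_add_cancel diff_gt_0_iff_gt less_add_one less_le_trans not_less order.strict_trans1)
      also have "\<omega> (b + 1 - t) \<le> K" using K t by auto
      then have "\<omega> t * \<omega> (b + 1 - t) \<le> \<omega> t * max K 1" using wt by (intro mult_left_mono) auto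
      finally show ?thesis by (simp add: field_simps)
    qed
    then show ?thesis using wb by (intro exI[of _ "\<omega> (b + 1) / max K 1"]) auto
  qed (auto intro: exI[of _ 1])
qed

definition truncate :: "nat \<Rightarrow> (real \<Rightarrow> complex) \<Rightarrow> real \<Rightarrow> complex" where
  "truncate n f t = indicat_real {1 / real (Suc n)..real (Suc n)} t *\<^sub>R f t"

lemma truncate_test_fun:
  assumes w: "weight_fun \<omega>" and f: "f \<in> L1w \<omega>"
  shows "test_fun (truncate n f)"
proof -
  let ?a = "1 / real (Suc n)" and ?b = "real (Suc n)"
  obtain c where c: "c > 0" "\<forall>t\<in>{?a..?b}. c \<le> \<omega> t" using weight_fun_lower_bound[OF w, of ?a ?b] by auto
  have "integrable half_line (truncate n f)"
  proof (rule integrableI_bounded)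
    show "truncate n f \<in> borel_measurable half_line"
      unfolding truncate_def[abs_def]
      by (rule borel_measurable_scaleR[OF half_line_measurable_lborel L1w_measurable[OF f]]) simp
    have "(\<integral>\<^sup>+ t. ennreal (cmod (truncate n f t)) \<partial>half_line) \<le> (\<integral>\<^sup>+ t. ennreal (1 / c) * ennreal (cmod (f t) * \<omega> t) \<partial>half_line)"
    proof (rule nn_integral_mono)
      fix t assume t: "t \<in> space half_line"
      then have wp: "\<omega> t > 0" using w unfolding weight_fun_def by simp
      have "cmod (truncate n f t) \<le> 1 / c * (cmod (f t) * \<omega> t)"
      proof (cases "t \<in> {?a..?b}")
        case True
        then have "cmod (f t) * c \<le> cmod (f t) * \<omega> t" using c by (intro mult_left_mono) auto
        then show ?thesis using True c by (simp add: truncate_def field_simps)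
      qed (use wp c in \<open>auto simp: truncate_def\<close>)
      then show "ennreal (cmod (truncate n f t)) \<le> ennreal (1 / c) * ennreal (cmod (f t) * \<omega> t)"
        using c by (simp add: ennreal_leI flip: ennreal_mult')
    qed
    also have "\<dots> = ennreal (1 / c) * (\<integral>\<^sup>+ t. ennreal (cmod (f t) * \<omega> t) \<partial>half_line)"
      by (intro nn_integral_cmult L1w_norm_measurable[OF w] L1w_measurable[OF f])
    also have "\<dots> < \<infinity>" using L1w_fin[OF f] by (simp add: ennreal_mult_less_top)
    finally show "(\<integral>\<^sup>+ t. ennreal (cmod (truncate n f t)) \<partial>half_line) < \<infinity>" .
  qed
  moreover have "\<forall>t. t \<notin> {?a..?b} \<longrightarrow> truncate n f t = 0" by (auto simp: truncate_def)
  ultimately show ?thesis unfolding test_fun_def by (intro conjI exI[of _ ?a] exI[of _ ?b]) auto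
qed

lemma truncate_tendsto:
  assumes w: "weight_fun \<omega>" and f: "f \<in> L1w \<omega>"
  shows "(\<lambda>n. \<integral>\<^sup>+ t. ennreal (cmod (f t - truncate n f t) * \<omega> t) \<partial>half_line) \<longlonglongrightarrow> 0"
proof -
  have wp: "\<omega> t \<ge> 0" if "t > 0" for t using w that unfolding weight_fun_def by (simp add: less_imp_le)
  have "(\<lambda>n. \<integral>\<^sup>+ t. ennreal (cmod (f t - truncate n f t) * \<omega> t) \<partial>half_line) \<longlonglongrightarrow> (\<integral>\<^sup>+ t. 0 \<partial>half_line)"
  proof (rule nn_integral_dominated_convergence[where w = "\<lambda>t. ennreal (cmod (f t) * \<omega> t)"])
    show "(\<lambda>t. ennreal (cmod (f t - truncate n f t) * \<omega> t)) \<in> borel_measurable half_line" for n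
      using test_fun_measurable[OF truncate_test_fun[OF w f]] L1w_measurable[OF f]
      by (intro L1w_norm_measurable[OF w] borel_measurable_diff)
    show "(\<lambda>t. ennreal (cmod (f t) * \<omega> t)) \<in> borel_measurable half_line"
      by (rule L1w_norm_measurable[OF w L1w_measurable[OF f]])
    show "AE t in half_line. ennreal (cmod (f t - truncate n f t) * \<omega> t) \<le> ennreal (cmod (f t) * \<omega> t)" for n
      using wp by (intro AE_I2) (auto intro!: ennreal_leI simp: truncate_def indicator_def)
    show "(\<integral>\<^sup>+ t. ennreal (cmod (f t) * \<omega> t) \<partial>half_line) < \<infinity>" by (rule L1w_fin[OF f])
    show "AE t in half_line. (\<lambda>n. ennreal (cmod (f t - truncate n f t) * \<omega> t)) \<longlonglongrightarrow> 0"
    proof (rule AE_I2)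
      fix t assume "t \<in> space half_line"
      then have t: "t > 0" by simp
      obtain N where N: "t \<le> real N" "1 / t \<le> real N"
        using real_arch_simple[of "max t (1 / t)"] by auto
      have "ennreal (cmod (f t - truncate n f t) * \<omega> t) = 0" if n: "n \<ge> N" for n
      proof -
        have "1 / t \<le> real (Suc n)" "t \<le> real (Suc n)" using N n by auto
        then have "t \<in> {1 / real (Suc n)..real (Suc n)}" using t by (simp add: field_simps)
        then show ?thesis by (simp add: truncate_def)
      qed
      then show "(\<lambda>n. ennreal (cmod (f t - truncate n f t) * \<omega> t)) \<longlonglongrightarrow> 0"
        by (intro tendsto_eventually eventually_sequentiallyI[of N])
    qed
  qed auto
  then show ?thesis by simp
qed

section \<open>The algebra of multipliers\<close>

lemma multipliersD:
  assumes "R \<in> multipliers"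
  shows "blinfun_apply R (c *\<^sub>C u) = c *\<^sub>C blinfun_apply R u"
    and "blinfun_apply R (u * v) = blinfun_apply R u * v"
    and "blinfun_apply R (u * v) = u * blinfun_apply R v"
proof -
  show "blinfun_apply R (c *\<^sub>C u) = c *\<^sub>C blinfun_apply R u" and 1: "blinfun_apply R (u * v) = blinfun_apply R u * v" for u v
    using assms unfolding multipliers_def by blast+
  show "blinfun_apply R (u * v) = u * blinfun_apply R v" using 1[of v u] by (simp add: mult.commute)
qed

lemma multipliers_compose: "R \<in> multipliers \<Longrightarrow> S \<in> multipliers \<Longrightarrow> R o\<^sub>L S \<in> multipliers"
  unfolding multipliers_def by auto

lemma mult_scaleC_right: "x * (c *\<^sub>C y) = c *\<^sub>C (x * (y :: 'a::comm_cbanach_algebra))"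
  using mult_scaleC_left[of c y x] by (simp add: mult.commute)

lemma multipliers_add: "R \<in> multipliers \<Longrightarrow> S \<in> multipliers \<Longrightarrow> R + S \<in> multipliers"
  unfolding multipliers_def by (auto simp: blinfun.add_left scaleC_add_right distrib_right)

lemma multipliers_scaleC: "R \<in> multipliers \<Longrightarrow> c *\<^sub>C R \<in> multipliers"
  unfolding multipliers_def by (auto simp: scaleC_blinfun.rep_eq scaleC_scaleC mult_scaleC_right mult.commute)

lemma closed_multipliers: "closed (multipliers :: ('a::comm_cbanach_algebra \<Rightarrow>\<^sub>L 'a) set)"
proof -
  have "multipliers = (\<Inter>c. \<Inter>u. {R :: 'a \<Rightarrow>\<^sub>L 'a. blinfun_apply R (c *\<^sub>C u) = c *\<^sub>C blinfun_apply R u}) \<inter>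
     (\<Inter>u. \<Inter>v. {R. blinfun_apply R (u * v) = blinfun_apply R u * v})"
    unfolding multipliers_def by auto
  also have "closed \<dots>"
    by (intro closed_Int closed_INT ballI closed_Collect_eq continuous_intros
        bounded_linear.continuous_on[OF bounded_linear_scaleC])
  finally show ?thesis .
qed

section \<open>The operators \<open>\<Phi>(f)\<close> and the Arveson ideal\<close>

lemma has_Bochner_integral_add_eq:
  fixes F G :: "'s \<Rightarrow> 'v::cbanach"
  assumes "has_Bochner_integral M F I" "has_Bochner_integral M G J"
    and "has_Bochner_integral M (\<lambda>x. F x + G x) K"
  shows "K = I + J"
proof (rule cfunctional_separates)
  fix l :: "'v \<Rightarrow> complex" assume l: "bounded_linear l"
  interpret bounded_linear l by (rule l)
  have "has_bochner_integral M (\<lambda>x. l (F x) + l (G x)) (l I + l J)"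
    using assms has_bochner_integral_functional l by (intro has_bochner_integral_add) blast+
  then show "l K = l (I + J)"
    using has_bochner_integral_functional[OF assms(3) l] has_bochner_integral_eq by (simp add: add) blast
qed

lemma has_Bochner_integral_half_line_cong:
  assumes h: "has_Bochner_integral half_line F I" and eq: "\<And>t. t > 0 \<Longrightarrow> F t = G t"
  shows "has_Bochner_integral half_line G I"
proof -
  have "F \<in> borel_measurable half_line \<longleftrightarrow> G \<in> borel_measurable half_line"
    using eq by (intro measurable_cong) simp
  moreover have "(\<integral>\<^sup>+ x. ennreal (norm (F x - s x)) \<partial>half_line) = (\<integral>\<^sup>+ x. ennreal (norm (G x - s x)) \<partial>half_line)" for s
    using eq by (intro nn_integral_cong) simp
  ultimately show ?thesis using h unfolding has_Bochner_integral_def by simp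
qed

lemma scaleC_minus1: "(- 1) *\<^sub>C x = - (x :: 'v::cbanach)"
  using scaleC_of_real[of "-1" x] by simp

text \<open>The locale serves twice: for \<open>T\<close> on the given algebra and for the induced
  semigroup on the normalization. \<open>nonzero\<close> makes the weight strictly positive, and
  \<open>cancel\<close> makes multipliers commute.\<close>

locale multiplier_flow =
  fixes T :: "real \<Rightarrow> 'a::comm_cbanach_algebra \<Rightarrow>\<^sub>L 'a"
  assumes semigroup: "multiplier_semigroup T" and cont: "strongly_continuous T"
    and nonzero: "t > 0 \<Longrightarrow> T t \<noteq> 0"
    and cancel: "(\<And>v. x * v = 0) \<Longrightarrow> x = (0::'a)"
begin

lemma T_mult: "t > 0 \<Longrightarrow> T t \<in> multipliers"
  using semigroup unfolding multiplier_semigroup_def by blast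

lemma T_add: "s > 0 \<Longrightarrow> t > 0 \<Longrightarrow> T (s + t) = T s o\<^sub>L T t"
  using semigroup unfolding multiplier_semigroup_def by blast

lemma T_cont: "continuous_on {0<..} (\<lambda>t. blinfun_apply (T t) u)"
  using cont unfolding strongly_continuous_def by blast

text \<open>Evaluate R S (u v) in two ways: one gives (S u)(R v), the other (R u)(S v). Exchanging
  the roles of the factors shows that (R S u) v and (S R u) v agree for all
  \<open>v\<close>.\<close>

lemma multipliers_commute:
  assumes R: "R \<in> multipliers" and S: "S \<in> (multipliers :: ('a \<Rightarrow>\<^sub>L 'a) set)"
  shows "R o\<^sub>L S = S o\<^sub>L R"
proof (rule blinfun_eqI)
  fix u
  have "blinfun_apply (R o\<^sub>L S) u - blinfun_apply (S o\<^sub>L R) u = 0"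
  proof (rule cancel)
    fix v
    have "blinfun_apply R (blinfun_apply S (u * v)) = blinfun_apply S u * blinfun_apply R v"
      by (simp add: multipliersD(2)[OF S] multipliersD(3)[OF R])
    moreover have "blinfun_apply R (blinfun_apply S (u * v)) = blinfun_apply R u * blinfun_apply S v"
      by (simp add: multipliersD(3)[OF S] multipliersD(2)[OF R])
    moreover have "blinfun_apply R (blinfun_apply S (u * v)) = blinfun_apply R (blinfun_apply S u) * v"
      by (simp add: multipliersD(2)[OF S] multipliersD(2)[OF R])
    moreover have "blinfun_apply S (blinfun_apply R u) * v = blinfun_apply S (blinfun_apply R u * v)"
      by (simp add: multipliersD(2)[OF S])
    moreover have "\<dots> = blinfun_apply R u * blinfun_apply S v" by (simp add: multipliersD(3)[OF S])
    ultimately show "(blinfun_apply (R o\<^sub>L S) u - blinfun_apply (S o\<^sub>L R) u) * v = 0"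
      by (simp add: left_diff_distrib)
  qed
  then show "blinfun_apply (R o\<^sub>L S) u = blinfun_apply (S o\<^sub>L R) u" by simp
qed

lemma norm_T_le: "norm (blinfun_apply (T t) u) \<le> weight T t * norm u"
  unfolding weight_def by (rule norm_blinfun)

text \<open>The operator norm is lower semicontinuous in \<open>t\<close>: a superlevel set is a
  union over vectors of open sets, which also disposes of the uncountable supremum.\<close>

lemma weight_measurable: "weight T \<in> borel_measurable half_line"
  unfolding borel_measurable_iff_greater
proof
  fix a :: real
  have "{t \<in> space half_line. a < weight T t} \<in> sets half_line"
  proof (cases "a < 0")
    case True
    then have "{t \<in> space half_line. a < weight T t} = space half_line"
      unfolding weight_def by (auto intro: less_le_trans)
    then show ?thesis by (simp only: sets.top)
  next
    case False
    have eq: "{t \<in> space half_line. a < weight T t} =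
      (\<Union>u. {t \<in> {0<..}. norm (blinfun_apply (T t) u) \<in> {a * norm u<..}})"
    proof (intro set_eqI iffI)
      fix t assume t: "t \<in> {t \<in> space half_line. a < weight T t}"
      have "\<exists>u. a * norm u < norm (blinfun_apply (T t) u)"
      proof (rule ccontr)
        assume "\<not> ?thesis"
        then have "norm (T t) \<le> a" using False by (intro norm_blinfun_bound) (auto simp: not_less)
        then show False using t by (simp add: weight_def)
      qed
      then show "t \<in> (\<Union>u. {t \<in> {0<..}. norm (blinfun_apply (T t) u) \<in> {a * norm u<..}})" using t by auto
    next
      fix t assume "t \<in> (\<Union>u. {t \<in> {0<..}. norm (blinfun_apply (T t) u) \<in> {a * norm u<..}})"
      then obtain u where u: "t > 0" "a * norm u < norm (blinfun_apply (T t) u)" by auto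
      then have "a * norm u < weight T t * norm u" using norm_T_le[of t u] by linarith
      then have "a < weight T t" by (rule mult_right_less_imp_less) simp
      then show "t \<in> {t \<in> space half_line. a < weight T t}" using u by simp
    qed
    have "open {t \<in> {0<..}. norm (blinfun_apply (T t) u) \<in> {a * norm u<..}}" for u
    proof -
      have "open ({0<..} \<inter> (\<lambda>t. norm (blinfun_apply (T t) u)) -` {a * norm u<..})"
        by (intro continuous_open_preimage continuous_on_norm T_cont) auto
      then show ?thesis by (simp add: Int_def vimage_def)
    qed
    then have "open (\<Union>u. {t \<in> {0<..}. norm (blinfun_apply (T t) u) \<in> {a * norm u<..}})" by blast
    then have "{t \<in> space half_line. a < weight T t} \<in> sets lebesgue" unfolding eq by auto
    then show ?thesis unfolding half_line_def by (subst sets_restrict_space_iff) auto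
  qed
  then show "{w \<in> space half_line. a < weight T w} \<in> sets half_line" .
qed

text \<open>Strong continuity gives bounds on compact intervals for each vector separately; the
  uniform boundedness principle turns them into bounds of the operator norm.\<close>

lemma weight_fun_T: "weight_fun (weight T)"
  unfolding weight_fun_def
proof (intro conjI allI impI)
  show "weight T \<in> borel_measurable half_line" by (rule weight_measurable)
  show "0 < weight T t" if "t > 0" for t using nonzero[OF that] unfolding weight_def by simp
  show "weight T (s + t) \<le> weight T s * weight T t" if "s > 0" "t > 0" for s t
    unfolding weight_def T_add[OF that] by (rule norm_blinfun_compose)
  show "\<exists>K. \<forall>t\<in>{a..b}. weight T t \<le> K" if "a > 0" for a b
  proof -
    have "bounded ((\<lambda>t. blinfun_apply (T t) u) ` {a..b})" for u
      using that by (intro compact_imp_bounded compact_continuous_image continuous_on_subset[OF T_cont]) auto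
    then have "bounded (T ` {a..b})" by (rule uniform_boundedness)
    then show ?thesis unfolding bounded_iff weight_def by blast
  qed
qed

lemma weight_pos: "t > 0 \<Longrightarrow> weight T t > 0"
  using weight_fun_T unfolding weight_fun_def by blast

lemma weight_nonneg: "weight T t \<ge> 0"
  unfolding weight_def by simp

lemma Phi_nn_integral_le:
  "(\<integral>\<^sup>+ t. ennreal (cmod (f t) * norm (blinfun_apply (T t) u)) \<partial>half_line)
    \<le> (\<integral>\<^sup>+ t. ennreal (cmod (f t) * weight T t * norm u) \<partial>half_line)"
  using norm_T_le by (intro nn_integral_mono ennreal_leI) (simp add: mult.assoc mult_left_mono)

lemma Phi_nn_integral_eq:
  assumes f: "f \<in> L1w (weight T)"
  shows "(\<integral>\<^sup>+ t. ennreal (cmod (f t) * weight T t * norm u) \<partial>half_line)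
    = (\<integral>\<^sup>+ t. ennreal (cmod (f t) * weight T t) \<partial>half_line) * ennreal (norm u)"
  using weight_nonneg L1w_norm_measurable[OF weight_fun_T L1w_measurable[OF f]]
  by (simp add: ennreal_mult nn_integral_multc)

lemma Phi_exists:
  assumes f: "f \<in> L1w (weight T)"
  shows "\<exists>I. has_Bochner_integral half_line (\<lambda>t. f t *\<^sub>C blinfun_apply (T t) u) I"
proof (rule has_Bochner_integral_scaleC_exists[OF L1w_measurable[OF f] T_cont])
  have "(\<integral>\<^sup>+ t. ennreal (cmod (f t) * norm (blinfun_apply (T t) u)) \<partial>half_line)
    \<le> (\<integral>\<^sup>+ t. ennreal (cmod (f t) * weight T t) \<partial>half_line) * ennreal (norm u)"
    by (rule ord_le_eq_trans[OF Phi_nn_integral_le Phi_nn_integral_eq[OF f]])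
  also have "\<dots> < \<infinity>" using L1w_fin[OF f] by (simp add: ennreal_mult_less_top)
  finally show "(\<integral>\<^sup>+ t. ennreal (cmod (f t) * norm (blinfun_apply (T t) u)) \<partial>half_line) < \<infinity>" .
qed

text \<open>\<open>Phi\<close> is given through \<open>Blinfun\<close>, which returns the intended
  map when that map is bounded linear. The weighted integral of \<open>f\<close> provides the
  bound.\<close>

lemma Phi_has_integral:
  assumes f: "f \<in> L1w (weight T)"
  shows "has_Bochner_integral half_line (\<lambda>t. f t *\<^sub>C blinfun_apply (T t) u) (blinfun_apply (Phi T f) u)"
proof -
  define I where "I u = Bochner_integral half_line (\<lambda>t. f t *\<^sub>C blinfun_apply (T t) u)" for u
  have hI: "has_Bochner_integral half_line (\<lambda>t. f t *\<^sub>C blinfun_apply (T t) u) (I u)" for u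
    using Phi_exists[OF f, of u] Bochner_integral_eq unfolding I_def by metis
  define K where "K = enn2real (\<integral>\<^sup>+ t. ennreal (cmod (f t) * weight T t) \<partial>half_line)"
  have "bounded_linear I"
  proof (rule bounded_linear_intro[where K = K])
    show "I (u + v) = I u + I v" for u v
      by (rule has_Bochner_integral_add_eq[OF hI[of u] hI[of v]])
        (use hI[of "u + v"] in \<open>simp add: blinfun.add_right scaleC_add_right\<close>)
    show "I (r *\<^sub>R u) = r *\<^sub>R I u" for r u
    proof (rule has_Bochner_integral_unique[OF hI])
      have "(\<lambda>t. f t *\<^sub>C blinfun_apply (T t) (r *\<^sub>R u)) = (\<lambda>t. r *\<^sub>R (f t *\<^sub>C blinfun_apply (T t) u))"
        by (simp add: blinfun.scaleR_right bounded_bilinear.scaleR_right[OF bounded_bilinear_scaleC])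
      then show "has_Bochner_integral half_line (\<lambda>t. f t *\<^sub>C blinfun_apply (T t) (r *\<^sub>R u)) (r *\<^sub>R I u)"
        using has_Bochner_integral_bounded_linear[OF hI[of u] bounded_linear_scaleR_right[of r]] by simp
    qed
    show "norm (I u) \<le> norm u * K" for u
    proof (rule norm_Bochner_integral_le[OF hI])
      have "(\<integral>\<^sup>+ t. ennreal (norm (f t *\<^sub>C blinfun_apply (T t) u)) \<partial>half_line)
        \<le> (\<integral>\<^sup>+ t. ennreal (cmod (f t) * weight T t) \<partial>half_line) * ennreal (norm u)"
        unfolding norm_scaleC by (rule ord_le_eq_trans[OF Phi_nn_integral_le Phi_nn_integral_eq[OF f]])
      also have "\<dots> = ennreal K * ennreal (norm u)" unfolding K_def using L1w_fin[OF f] by simp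
      also have "\<dots> = ennreal (norm u * K)"
        using ennreal_mult'[of "norm u" K] by (simp add: mult.commute)
      finally show "(\<integral>\<^sup>+ t. ennreal (norm (f t *\<^sub>C blinfun_apply (T t) u)) \<partial>half_line) \<le> ennreal (norm u * K)" .
    qed (simp add: K_def)
  qed
  then have "blinfun_apply (Phi T f) = I"
    unfolding Phi_def I_def[symmetric] using bounded_linear_Blinfun_apply[of I] by (simp add: I_def[abs_def])
  then show ?thesis using hI by simp
qed

lemma Phi_unique:
  assumes "f \<in> L1w (weight T)" "has_Bochner_integral half_line (\<lambda>t. f t *\<^sub>C blinfun_apply (T t) u) I"
  shows "blinfun_apply (Phi T f) u = I"
  by (rule has_Bochner_integral_unique[OF Phi_has_integral[OF assms(1)] assms(2)])

lemma Phi_functional: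
  assumes f: "f \<in> L1w (weight T)" and l: "bounded_linear l" "\<And>c z. l (c *\<^sub>C z) = c * l z"
  shows "has_bochner_integral half_line (\<lambda>t. f t * l (blinfun_apply (T t) u)) (l (blinfun_apply (Phi T f) u))"
  using has_bochner_integral_functional[OF Phi_has_integral[OF f] l(1)] by (simp add: l(2))

lemma Phi_cong:
  assumes f: "f \<in> L1w (weight T)" and g: "g \<in> L1w (weight T)" and eq: "\<And>t. t > 0 \<Longrightarrow> f t = g t"
  shows "Phi T f = Phi T g"
proof (rule blinfun_eqI, rule cfunctional_separates)
  fix u and l :: "'a \<Rightarrow> complex"
  assume l: "bounded_linear l" "\<And>c z. l (c *\<^sub>C z) = c * l z"
  have "(LINT t|half_line. f t * l (blinfun_apply (T t) u)) = (LINT t|half_line. g t * l (blinfun_apply (T t) u))"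
    by (intro Bochner_Integration.integral_cong) (auto simp: eq)
  then show "l (blinfun_apply (Phi T f) u) = l (blinfun_apply (Phi T g) u)"
    using Phi_functional[OF f l] Phi_functional[OF g l] by (metis has_bochner_integral_integral_eq)
qed

lemma Phi_add:
  assumes f: "f \<in> L1w (weight T)" and g: "g \<in> L1w (weight T)"
  shows "Phi T (\<lambda>t. f t + g t) = Phi T f + Phi T g"
proof (rule blinfun_eqI)
  fix u
  show "blinfun_apply (Phi T (\<lambda>t. f t + g t)) u = blinfun_apply (Phi T f + Phi T g) u"
    unfolding blinfun.add_left
    by (rule has_Bochner_integral_add_eq[OF Phi_has_integral[OF f] Phi_has_integral[OF g]])
      (use Phi_has_integral[OF L1w_add[OF weight_fun_T f g]] in \<open>simp add: scaleC_add_left\<close>)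
qed

lemma Phi_scale:
  assumes f: "f \<in> L1w (weight T)"
  shows "Phi T (\<lambda>t. c * f t) = c *\<^sub>C Phi T f"
proof (rule blinfun_eqI)
  fix u
  show "blinfun_apply (Phi T (\<lambda>t. c * f t)) u = blinfun_apply (c *\<^sub>C Phi T f) u"
    unfolding scaleC_blinfun.rep_eq
    by (rule Phi_unique[OF L1w_scale[OF weight_fun_T f]])
      (use has_Bochner_integral_bounded_linear[OF Phi_has_integral[OF f] bounded_linear_scaleC[of c]] in \<open>simp add: scaleC_scaleC\<close>)
qed

lemma Phi_diff:
  assumes f: "f \<in> L1w (weight T)" and g: "g \<in> L1w (weight T)"
  shows "Phi T (\<lambda>t. f t - g t) = Phi T f - Phi T g"
  using Phi_add[OF f L1w_scale[OF weight_fun_T g, of "-1"]] Phi_scale[OF g, of "-1"]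
  by (simp add: scaleC_minus1)

lemma Phi_multipliers:
  assumes f: "f \<in> L1w (weight T)"
  shows "Phi T f \<in> multipliers"
  unfolding multipliers_def
proof (intro CollectI conjI allI)
  fix c u v
  show "blinfun_apply (Phi T f) (c *\<^sub>C u) = c *\<^sub>C blinfun_apply (Phi T f) u"
  proof (rule Phi_unique[OF f])
    have "has_Bochner_integral half_line (\<lambda>t. c *\<^sub>C (f t *\<^sub>C blinfun_apply (T t) u)) (c *\<^sub>C blinfun_apply (Phi T f) u)"
      by (rule has_Bochner_integral_bounded_linear[OF Phi_has_integral[OF f] bounded_linear_scaleC])
    then show "has_Bochner_integral half_line (\<lambda>t. f t *\<^sub>C blinfun_apply (T t) (c *\<^sub>C u)) (c *\<^sub>C blinfun_apply (Phi T f) u)"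
      by (rule has_Bochner_integral_half_line_cong) (simp add: multipliersD(1)[OF T_mult] scaleC_scaleC mult.commute)
  qed
  show "blinfun_apply (Phi T f) (u * v) = blinfun_apply (Phi T f) u * v"
  proof (rule cfunctional_separates)
    fix l :: "'a \<Rightarrow> complex" assume l: "bounded_linear l" "\<And>c z. l (c *\<^sub>C z) = c * l z"
    have "has_bochner_integral half_line (\<lambda>t. l (f t *\<^sub>C blinfun_apply (T t) u * v)) (l (blinfun_apply (Phi T f) u * v))"
      by (rule has_bochner_integral_functional[OF Phi_has_integral[OF f]
            bounded_linear_compose[OF l(1) bounded_linear_mult_left]])
    moreover have "(LINT t|half_line. l (f t *\<^sub>C blinfun_apply (T t) u * v)) = (LINT t|half_line. f t * l (blinfun_apply (T t) (u * v)))"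
      by (intro Bochner_Integration.integral_cong) (auto simp: mult_scaleC_left l(2) multipliersD(2)[OF T_mult])
    ultimately show "l (blinfun_apply (Phi T f) (u * v)) = l (blinfun_apply (Phi T f) u * v)"
      using Phi_functional[OF f l] by (metis has_bochner_integral_integral_eq)
  qed
qed

lemma Phi_norm_le:
  assumes f: "f \<in> L1w (weight T)" and C: "C \<ge> 0"
    and le: "(\<integral>\<^sup>+ t. ennreal (cmod (f t) * weight T t) \<partial>half_line) \<le> ennreal C"
  shows "norm (Phi T f) \<le> C"
proof (rule norm_blinfun_bound[OF C])
  fix u
  show "norm (blinfun_apply (Phi T f) u) \<le> C * norm u"
  proof (rule norm_Bochner_integral_le[OF Phi_has_integral[OF f]])
    have "(\<integral>\<^sup>+ t. ennreal (norm (f t *\<^sub>C blinfun_apply (T t) u)) \<partial>half_line)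
      \<le> (\<integral>\<^sup>+ t. ennreal (cmod (f t) * weight T t) \<partial>half_line) * ennreal (norm u)"
      unfolding norm_scaleC by (rule ord_le_eq_trans[OF Phi_nn_integral_le Phi_nn_integral_eq[OF f]])
    also have "\<dots> \<le> ennreal C * ennreal (norm u)" by (intro mult_right_mono le) simp
    also have "\<dots> = ennreal (C * norm u)" using C by (simp add: ennreal_mult)
    finally show "(\<integral>\<^sup>+ t. ennreal (norm (f t *\<^sub>C blinfun_apply (T t) u)) \<partial>half_line) \<le> ennreal (C * norm u)" .
  qed (use C in simp)
qed

text \<open>The kernel t \<mapsto> l(T(t) u) is paired with the convolution, and the semigroup law
  rewrites its value at s + t. The factors come out in reverse order, so commutativity of
  multipliers is used at the end.\<close>

lemma Phi_convol:
  assumes f: "f \<in> L1w (weight T)" and g: "g \<in> L1w (weight T)"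
  shows "Phi T (convol f g) = Phi T f o\<^sub>L Phi T g"
proof -
  have "Phi T (convol f g) = Phi T g o\<^sub>L Phi T f"
  proof (rule blinfun_eqI, rule cfunctional_separates)
    fix u and l :: "'a \<Rightarrow> complex"
    assume l: "bounded_linear l" "\<And>c z. l (c *\<^sub>C z) = c * l z"
    interpret l: bounded_linear l by (rule l(1))
    obtain K where K: "K > 0" "\<And>x. norm (l x) \<le> norm x * K" using l.pos_bounded by blast
    let ?k = "\<lambda>t. l (blinfun_apply (T t) u)"
    have km: "?k \<in> borel_measurable half_line"
      by (rule half_line_measurable_continuous) (intro l.continuous_on T_cont)
    have kb: "cmod (?k t) \<le> (K * norm u) * weight T t" for t
      using order_trans[OF K(2) mult_right_mono[OF norm_T_le, of K]] K(1) by (simp add: mult_ac)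
    note c = convol_integral[OF L1w_measurable[OF f] L1w_measurable[OF g] km
        L1w_iterated_finite[OF weight_fun_T f g kb]]
    have "l (blinfun_apply (Phi T (convol f g)) u) = (LINT r|half_line. convol f g r * ?k r)"
      using Phi_functional[OF L1w_convol[OF weight_fun_T f g] l] by (metis has_bochner_integral_integral_eq)
    also have "\<dots> = (LINT s|half_line. g s * (LINT t|half_line. f t * ?k (s + t)))"
      using K by (intro c) simp
    also have "\<dots> = (LINT s|half_line. g s * l (blinfun_apply (T s) (blinfun_apply (Phi T f) u)))"
    proof (intro Bochner_Integration.integral_cong refl)
      fix s assume "s \<in> space half_line"
      then have s: "s > 0" by simp
      have "has_bochner_integral half_line (\<lambda>t. f t * (\<lambda>x. l (blinfun_apply (T s) x)) (blinfun_apply (T t) u))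
        ((\<lambda>x. l (blinfun_apply (T s) x)) (blinfun_apply (Phi T f) u))"
        by (rule Phi_functional[OF f bounded_linear_compose[OF l(1) blinfun.bounded_linear_right]])
          (simp add: multipliersD(1)[OF T_mult[OF s]] l(2))
      then have "(LINT t|half_line. f t * l (blinfun_apply (T s) (blinfun_apply (T t) u))) = l (blinfun_apply (T s) (blinfun_apply (Phi T f) u))"
        by (metis has_bochner_integral_integral_eq)
      moreover have "(LINT t|half_line. f t * ?k (s + t)) = (LINT t|half_line. f t * l (blinfun_apply (T s) (blinfun_apply (T t) u)))"
        using s by (intro Bochner_Integration.integral_cong) (auto simp: T_add)
      ultimately show "g s * (LINT t|half_line. f t * ?k (s + t)) = g s * l (blinfun_apply (T s) (blinfun_apply (Phi T f) u))" by simp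
    qed
    also have "\<dots> = l (blinfun_apply (Phi T g) (blinfun_apply (Phi T f) u))"
      using Phi_functional[OF g l] by (metis has_bochner_integral_integral_eq)
    finally show "l (blinfun_apply (Phi T (convol f g)) u) = l (blinfun_apply (Phi T g o\<^sub>L Phi T f) u)" by simp
  qed
  also have "\<dots> = Phi T f o\<^sub>L Phi T g"
    by (rule multipliers_commute[OF Phi_multipliers[OF g] Phi_multipliers[OF f]])
  finally show ?thesis .
qed

lemma Phi_tendsto:
  assumes f: "f \<in> L1w (weight T)" and fn: "\<And>n::nat. fn n \<in> L1w (weight T)"
    and lim: "(\<lambda>n. \<integral>\<^sup>+ t. ennreal (cmod (f t - fn n t) * weight T t) \<partial>half_line) \<longlonglongrightarrow> 0"
  shows "(\<lambda>n. Phi T (fn n)) \<longlonglongrightarrow> Phi T f"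
proof (rule LIMSEQ_I)
  fix r :: real assume r: "r > 0"
  have "\<forall>\<^sub>F n in sequentially. (\<integral>\<^sup>+ t. ennreal (cmod (f t - fn n t) * weight T t) \<partial>half_line) < ennreal (r / 2)"
    using r by (intro order_tendstoD(2)[OF lim]) simp
  then obtain N where N: "\<And>n. n \<ge> N \<Longrightarrow> (\<integral>\<^sup>+ t. ennreal (cmod (f t - fn n t) * weight T t) \<partial>half_line) < ennreal (r / 2)"
    unfolding eventually_sequentially by blast
  have "norm (Phi T (fn n) - Phi T f) < r" if "n \<ge> N" for n
  proof -
    have "norm (Phi T (\<lambda>t. f t - fn n t)) \<le> r / 2"
      using r N[OF that] by (intro Phi_norm_le L1w_diff[OF weight_fun_T] f fn) auto
    then show ?thesis using r by (simp add: Phi_diff[OF f fn] norm_minus_commute)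
  qed
  then show "\<exists>no. \<forall>n\<ge>no. norm (Phi T (fn n) - Phi T f) < r" by blast
qed

section \<open>The Arveson ideal as a closed commutative algebra\<close>

lemma closed_ideal: "closed (arveson_ideal T)"
  unfolding arveson_ideal_def by simp

lemma Phi_in_ideal: "f \<in> L1w (weight T) \<Longrightarrow> Phi T f \<in> arveson_ideal T"
  unfolding arveson_ideal_def by (rule subsetD[OF closure_subset imageI])

lemma Phi_test_in_ideal: "test_fun f \<Longrightarrow> Phi T f \<in> arveson_ideal T"
  by (intro Phi_in_ideal test_fun_L1w[OF weight_fun_T])

text \<open>Truncations converge in the weighted norm, which dominates the operator norm. Algebraic
  properties of the ideal may thus be checked on test functions, for which the transform is defined
  at every \<mu>.\<close>

lemma ideal_test_dense: "arveson_ideal T = closure (Phi T ` Collect test_fun)"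
proof
  have "Phi T f \<in> closure (Phi T ` Collect test_fun)" if f: "f \<in> L1w (weight T)" for f
  proof -
    have "(\<lambda>n. Phi T (truncate n f)) \<longlonglongrightarrow> Phi T f"
      by (rule Phi_tendsto[OF f test_fun_L1w[OF weight_fun_T truncate_test_fun[OF weight_fun_T f]]
            truncate_tendsto[OF weight_fun_T f]])
    moreover have "Phi T (truncate n f) \<in> Phi T ` Collect test_fun" for n
      using truncate_test_fun[OF weight_fun_T f] by blast
    ultimately show ?thesis unfolding closure_sequential by (intro exI[of _ "\<lambda>n. Phi T (truncate n f)"]) simp
  qed
  then show "arveson_ideal T \<subseteq> closure (Phi T ` Collect test_fun)"
    unfolding arveson_ideal_def by (intro closure_minimal) auto
  show "closure (Phi T ` Collect test_fun) \<subseteq> arveson_ideal T"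
    unfolding arveson_ideal_def using test_fun_L1w[OF weight_fun_T] by (intro closure_mono) auto
qed

lemma ideal_sequence:
  assumes "x \<in> arveson_ideal T"
  obtains f where "\<And>n::nat. test_fun (f n)" "(\<lambda>n. Phi T (f n)) \<longlonglongrightarrow> x"
proof -
  obtain y where y: "\<And>n::nat. y n \<in> Phi T ` Collect test_fun" "y \<longlonglongrightarrow> x"
    using assms unfolding ideal_test_dense closure_sequential by blast
  then have "\<forall>n. \<exists>f. test_fun f \<and> y n = Phi T f" by blast
  then obtain f where "\<And>n. test_fun (f n) \<and> y n = Phi T (f n)" by metis
  then have "(\<lambda>n. Phi T (f n)) = y" and f: "\<And>n. test_fun (f n)" by (simp_all add: fun_eq_iff)
  with y(2) have "(\<lambda>n. Phi T (f n)) \<longlonglongrightarrow> x" by (simp only:)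
  with f show thesis by (rule that)
qed

lemma ideal_multipliers: "arveson_ideal T \<subseteq> multipliers"
  unfolding arveson_ideal_def using Phi_multipliers by (intro closure_minimal closed_multipliers) auto

lemma ideal_add:
  assumes x: "x \<in> arveson_ideal T" and y: "y \<in> arveson_ideal T"
  shows "x + y \<in> arveson_ideal T"
proof -
  obtain f where f: "\<And>n::nat. test_fun (f n)" "(\<lambda>n. Phi T (f n)) \<longlonglongrightarrow> x" by (rule ideal_sequence[OF x]) blast
  obtain g where g: "\<And>n::nat. test_fun (g n)" "(\<lambda>n. Phi T (g n)) \<longlonglongrightarrow> y" by (rule ideal_sequence[OF y]) blast
  have "Phi T (f n) + Phi T (g n) \<in> arveson_ideal T" for n
    using Phi_test_in_ideal[OF test_fun_add[OF f(1) g(1)]]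
    by (simp add: Phi_add test_fun_L1w[OF weight_fun_T] f(1) g(1))
  then show ?thesis by (rule closed_sequentially[OF closed_ideal _ tendsto_add[OF f(2) g(2)]])
qed

lemma ideal_scale:
  assumes x: "x \<in> arveson_ideal T"
  shows "c *\<^sub>C x \<in> arveson_ideal T"
proof -
  obtain f where f: "\<And>n::nat. test_fun (f n)" "(\<lambda>n. Phi T (f n)) \<longlonglongrightarrow> x" by (rule ideal_sequence[OF x]) blast
  have "c *\<^sub>C Phi T (f n) \<in> arveson_ideal T" for n
    using Phi_test_in_ideal[OF test_fun_scale[OF f(1)]]
    by (simp add: Phi_scale test_fun_L1w[OF weight_fun_T] f(1))
  then show ?thesis
    by (rule closed_sequentially[OF closed_ideal _ bounded_linear.tendsto[OF bounded_linear_scaleC f(2)]])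
qed

lemma ideal_compose:
  assumes x: "x \<in> arveson_ideal T" and y: "y \<in> arveson_ideal T"
  shows "x o\<^sub>L y \<in> arveson_ideal T"
proof -
  obtain f where f: "\<And>n::nat. test_fun (f n)" "(\<lambda>n. Phi T (f n)) \<longlonglongrightarrow> x" by (rule ideal_sequence[OF x]) blast
  obtain g where g: "\<And>n::nat. test_fun (g n)" "(\<lambda>n. Phi T (g n)) \<longlonglongrightarrow> y" by (rule ideal_sequence[OF y]) blast
  have "Phi T (f n) o\<^sub>L Phi T (g n) \<in> arveson_ideal T" for n
    using Phi_test_in_ideal[OF test_fun_convol(1)[OF f(1) g(1)]]
    by (simp add: Phi_convol test_fun_L1w[OF weight_fun_T] f(1) g(1))
  then show ?thesis
    by (rule closed_sequentially[OF closed_ideal _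
          bounded_bilinear.tendsto[OF bounded_bilinear_blinfun_compose f(2) g(2)]])
qed

lemma ideal_commute:
  assumes "x \<in> arveson_ideal T" "y \<in> arveson_ideal T"
  shows "x o\<^sub>L y = y o\<^sub>L x"
  by (rule multipliers_commute[OF subsetD[OF ideal_multipliers assms(1)] subsetD[OF ideal_multipliers assms(2)]])

text \<open>Averages of the semigroup over short intervals {t..t + h} converge strongly to T(t).
  Density of the range of T(t) is thereby passed on to the operators \<Phi>(q).\<close>

lemma Phi_approximates_T:
  assumes t: "t > 0"
  shows "blinfun_apply (T t) u \<in> closure {blinfun_apply (Phi T q) u | q. q \<in> L1w (weight T)}"
  unfolding closure_approachable
proof (intro allI impI)
  fix e :: real assume e: "e > 0"
  have "\<exists>d>0. \<forall>s\<in>{0<..}. dist s t < d \<longrightarrow> dist (blinfun_apply (T s) u) (blinfun_apply (T t) u) < e / 2"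
  proof -
    have "\<forall>e>0. \<exists>d>0. \<forall>s\<in>{0<..}. dist s t < d \<longrightarrow> dist (blinfun_apply (T s) u) (blinfun_apply (T t) u) < e"
      by (rule bspec[OF T_cont[of u, unfolded continuous_on_iff]]) (use t in simp)
    then show ?thesis using half_gt_zero[OF e] by blast
  qed
  then obtain d where d: "d > 0" "\<And>s. s > 0 \<Longrightarrow> dist s t < d \<Longrightarrow> dist (blinfun_apply (T s) u) (blinfun_apply (T t) u) < e / 2"
    by auto
  define h where "h = d / 2"
  have h: "h > 0" "h < d" unfolding h_def using d by auto
  \<comment> \<open>Normalized to total mass 1, so \<Phi>(q) u - T(t) u is the average of T(s) u -
    T(t) u.\<close>
  define q where "q s = complex_of_real (1 / h * indicat_real {t..t + h} s)" for s
  have nq: "(\<integral>\<^sup>+ s. ennreal (cmod (q s)) \<partial>half_line) = 1"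
  proof -
    have "(\<integral>\<^sup>+ s. ennreal (cmod (q s)) \<partial>half_line) = (\<integral>\<^sup>+ s. ennreal (1 / h) * indicator {t..t + h} s \<partial>lborel)"
      unfolding nn_integral_half_line using t h by (intro nn_integral_cong) (auto simp: q_def indicator_def norm_divide)
    also have "\<dots> = ennreal (1 / h) * emeasure lborel {t..t + h}"
      by (intro nn_integral_cmult_indicator) simp
    also have "\<dots> = 1" using h by (simp flip: ennreal_mult')
    finally show ?thesis .
  qed
  have qm: "q \<in> borel_measurable half_line"
    unfolding q_def[abs_def] by (intro half_line_measurable_lborel) measurable
  have qi: "integrable half_line q" using qm nq by (intro integrableI_bounded) auto
  have "test_fun q" unfolding test_fun_def
    using qi t by (intro conjI exI[of _ t] exI[of _ "t + h"]) (auto simp: q_def)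
  then have qL: "q \<in> L1w (weight T)" by (rule test_fun_L1w[OF weight_fun_T])
  have "norm (blinfun_apply (Phi T q) u - blinfun_apply (T t) u) \<le> e / 2"
  proof -
    have qI: "has_bochner_integral half_line q 1"
    proof -
      have "(LINT s|half_line. q s) = complex_of_real (LINT s|half_line. 1 / h * indicat_real {t..t + h} s)"
        unfolding q_def by (rule integral_complex_of_real)
      also have "(LINT s|half_line. 1 / h * indicat_real {t..t + h} s) = enn2real (\<integral>\<^sup>+ s. ennreal (1 / h * indicat_real {t..t + h} s) \<partial>half_line)"
        using h by (intro integral_eq_nn_integral half_line_measurable_lborel) auto
      also have "(\<integral>\<^sup>+ s. ennreal (1 / h * indicat_real {t..t + h} s) \<partial>half_line) = 1"
      proof -
        have "cmod (q s) = 1 / h * indicat_real {t..t + h} s" for s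
          using h by (auto simp: q_def indicator_def norm_divide)
        then show ?thesis using nq by simp
      qed
      finally show ?thesis using qi by (simp add: has_bochner_integral_iff)
    qed
    obtain l :: "'a \<Rightarrow> real" where l: "bounded_linear l" "\<And>y. \<bar>l y\<bar> \<le> norm y"
      "l (blinfun_apply (Phi T q) u - blinfun_apply (T t) u) = norm (blinfun_apply (Phi T q) u - blinfun_apply (T t) u)"
      by (rule norming_functional[of "blinfun_apply (Phi T q) u - blinfun_apply (T t) u"]) blast
    interpret l: bounded_linear l by (rule l(1))
    let ?x = "blinfun_apply (T t) u"
    have 1: "has_bochner_integral half_line (\<lambda>s. l (q s *\<^sub>C blinfun_apply (T s) u)) (l (blinfun_apply (Phi T q) u))"
      by (rule has_bochner_integral_functional[OF Phi_has_integral[OF qL] l(1)])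
    have "has_bochner_integral half_line (\<lambda>s. l (q s *\<^sub>C ?x)) (l (1 *\<^sub>C ?x))"
      by (rule has_bochner_integral_bounded_linear[OF bounded_linear_compose[OF l(1)
              bounded_bilinear.bounded_linear_left[OF bounded_bilinear_scaleC]] qI])
    then have 2: "has_bochner_integral half_line (\<lambda>s. l (q s *\<^sub>C ?x)) (l ?x)" by (simp add: scaleC_one)
    have 3: "has_bochner_integral half_line (\<lambda>s. l (q s *\<^sub>C blinfun_apply (T s) u) - l (q s *\<^sub>C ?x))
       (norm (blinfun_apply (Phi T q) u - ?x))"
      using has_bochner_integral_diff[OF 1 2] l(3) by (simp add: l.diff)
    then have i3: "integrable half_line (\<lambda>s. l (q s *\<^sub>C blinfun_apply (T s) u) - l (q s *\<^sub>C ?x))"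
      and e3: "(LINT s|half_line. l (q s *\<^sub>C blinfun_apply (T s) u) - l (q s *\<^sub>C ?x)) = norm (blinfun_apply (Phi T q) u - ?x)"
      by (auto simp: has_bochner_integral_iff)
    have "ennreal (norm (norm (blinfun_apply (Phi T q) u - ?x)))
      \<le> (\<integral>\<^sup>+ s. ennreal (norm (l (q s *\<^sub>C blinfun_apply (T s) u) - l (q s *\<^sub>C ?x))) \<partial>half_line)"
      using integral_norm_bound_ennreal[OF i3] e3 by simp
    also have "\<dots> \<le> (\<integral>\<^sup>+ s. ennreal (cmod (q s)) * ennreal (e / 2) \<partial>half_line)"
    proof (rule nn_integral_mono)
      fix s assume "s \<in> space half_line"
      then have s: "s > 0" by simp
      have "\<bar>l (q s *\<^sub>C (blinfun_apply (T s) u - ?x))\<bar> \<le> cmod (q s) * norm (blinfun_apply (T s) u - ?x)"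
        using l(2)[of "q s *\<^sub>C (blinfun_apply (T s) u - ?x)"] by (simp add: norm_scaleC)
      also have "\<dots> \<le> cmod (q s) * (e / 2)"
      proof (cases "s \<in> {t..t + h}")
        case True
        then have "dist (blinfun_apply (T s) u) ?x < e / 2" using s h by (intro d(2)) (auto simp: dist_real_def)
        then show ?thesis by (intro mult_left_mono) (auto simp: dist_norm)
      qed (simp add: q_def)
      finally have "\<bar>l (q s *\<^sub>C blinfun_apply (T s) u) - l (q s *\<^sub>C ?x)\<bar> \<le> cmod (q s) * (e / 2)"
        by (simp add: l.diff[symmetric] bounded_bilinear.diff_right[OF bounded_bilinear_scaleC, symmetric])
      then show "ennreal (norm (l (q s *\<^sub>C blinfun_apply (T s) u) - l (q s *\<^sub>C ?x))) \<le> ennreal (cmod (q s)) * ennreal (e / 2)"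
        using e by (simp add: ennreal_leI flip: ennreal_mult')
    qed
    also have "\<dots> = ennreal (e / 2)" using nq qm by (subst nn_integral_multc) auto
    finally show ?thesis using e by simp
  qed
  then have "dist (blinfun_apply (Phi T q) u) (blinfun_apply (T t) u) < e" using e by (simp add: dist_norm)
  then show "\<exists>y\<in>{blinfun_apply (Phi T q) u |q. q \<in> L1w (weight T)}. dist y (blinfun_apply (T t) u) < e"
    using qL by blast
qed

end

section \<open>Characters and the Arveson spectrum\<close>

lemma half_line_integral_Icc:
  assumes "a > 0"
  shows "has_bochner_integral half_line (indicat_real {a..b}) (max 0 (b - a))"
proof -
  have n: "(\<integral>\<^sup>+t. ennreal (indicat_real {a..b} t) \<partial>half_line) = ennreal (max 0 (b - a))"
  proof -
    have "(\<integral>\<^sup>+t. ennreal (indicat_real {a..b} t) \<partial>half_line) = (\<integral>\<^sup>+t. indicator {a..b} t \<partial>lborel)"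
      unfolding nn_integral_half_line using assms by (intro nn_integral_cong) (auto simp: indicator_def)
    also have "\<dots> = emeasure lborel {a..b}" by simp
    also have "\<dots> = ennreal (max 0 (b - a))" by (cases "a \<le> b") auto
    finally show ?thesis .
  qed
  show ?thesis
    by (rule has_bochner_integral_nn_integral[OF _ _ _ n]) (auto intro: half_line_measurable_lborel)
qed

lemma test_funI:
  assumes "integrable half_line f" "a > 0" "\<And>t. t \<notin> {a..b} \<Longrightarrow> f t = 0"
  shows "test_fun f"
  using assms unfolding test_fun_def by blast

text \<open>The exponential factor cancels the one in the transform, leaving the length of the
  interval. These functions show that the transform at a given \<mu> is not identically
  zero.\<close>

lemma test_fun_exp_indicator:
  assumes a: "a > 0"
  shows "test_fun (\<lambda>t. exp_kernel \<mu> t * complex_of_real (indicat_real {a..b} t))"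
    and "laplace (\<lambda>t. exp_kernel \<mu> t * complex_of_real (indicat_real {a..b} t)) \<mu> = complex_of_real (max 0 (b - a))"
proof -
  have "integrable half_line (\<lambda>t. complex_of_real (indicat_real {a..b} t))"
    using half_line_integral_Icc[OF a, of b] by (intro integrable_of_real) (auto simp: has_bochner_integral_iff)
  then have t: "test_fun (\<lambda>t. complex_of_real (indicat_real {a..b} t))"
    by (rule test_funI[OF _ a, of _ b]) simp
  have "integrable half_line (\<lambda>t. complex_of_real (indicat_real {a..b} t) * exp (- \<mu> * complex_of_real t))"
    by (rule test_fun_exp_integrable[OF t])
  then have "integrable half_line (\<lambda>t. exp_kernel \<mu> t * complex_of_real (indicat_real {a..b} t))"
    by (simp add: exp_kernel_def mult.commute)
  then show "test_fun (\<lambda>t. exp_kernel \<mu> t * complex_of_real (indicat_real {a..b} t))"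
    by (rule test_funI[OF _ a, of _ b]) simp
  have "exp_kernel \<mu> t * exp (\<mu> * complex_of_real t) = 1" for t
    unfolding exp_kernel_def by (simp add: exp_add[symmetric])
  then have e: "exp_kernel \<mu> t * (x * exp (\<mu> * complex_of_real t)) = x" for t x
    by (metis mult.assoc mult.commute mult.right_neutral)
  have "(LINT t|half_line. complex_of_real (indicat_real {a..b} t)) = complex_of_real (max 0 (b - a))"
    using half_line_integral_Icc[OF a, of b] by (simp add: has_bochner_integral_iff)
  then show "laplace (\<lambda>t. exp_kernel \<mu> t * complex_of_real (indicat_real {a..b} t)) \<mu> = complex_of_real (max 0 (b - a))"
    unfolding laplace_def by (simp only: mult.assoc e)
qed

text \<open>A vanishing transform removes the exponential tail, so the convolution is supported in a
  compact subset of the open half-line.\<close>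

lemma convol_exp_kernel_test_fun:
  assumes F: "test_fun F" and z: "laplace F \<mu> = 0"
  shows "test_fun (convol (exp_kernel \<mu>) F)"
proof -
  obtain a b K where abK: "a > 0" "\<And>r. r < a \<Longrightarrow> convol (exp_kernel \<mu>) F r = 0"
    "\<And>r. r \<ge> b \<Longrightarrow> convol (exp_kernel \<mu>) F r = laplace F \<mu> * exp_kernel \<mu> r"
    "\<And>r. cmod (convol (exp_kernel \<mu>) F r) \<le> K * cmod (exp_kernel \<mu> r)" "K \<ge> 0" "b > 0"
    by (rule convol_exp_kernel_test[OF F, of \<mu>]) blast
  let ?h = "convol (exp_kernel \<mu>) F"
  have hz: "?h r = 0" if "r \<notin> {a..b}" for r
    using that abK(2)[of r] abK(3)[of r] z by auto
  have "integrable half_line ?h"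
  proof (rule Bochner_Integration.integrable_bound)
    show "integrable half_line (\<lambda>t. K *\<^sub>R (exp_kernel \<mu> t * complex_of_real (indicat_real {a..b} t)))"
      using test_fun_exp_indicator(1)[OF abK(1), of \<mu> b] unfolding test_fun_def by simp
    show "?h \<in> borel_measurable half_line"
      by (rule convol_measurable[OF exp_kernel_measurable test_fun_measurable[OF F]])
    show "AE t in half_line. norm (?h t) \<le> norm (K *\<^sub>R (exp_kernel \<mu> t * complex_of_real (indicat_real {a..b} t)))"
      using abK(4,5) hz by (intro AE_I2) (auto simp: indicator_def norm_mult)
  qed
  then show ?thesis unfolding test_fun_def using abK(1) hz by blast
qed

text \<open>A test function \<open>F\<close> whose Laplace transform vanishes at \<open>\<mu>\<close> while that of \<open>(\<mu> + d/dt)\<^sup>-\<^sup>1 F\<close>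
  does not; up to the exponential factor the latter is a tent function.\<close>

lemma laplace_zero_witness:
  obtains F where "test_fun F" "laplace F \<mu> = 0" "laplace (convol (exp_kernel \<mu>) F) \<mu> \<noteq> 0"
proof -
  define A where "A = (\<lambda>a b t. exp_kernel \<mu> t * complex_of_real (indicat_real {a..b} t))"
  define F where "F t = A 1 2 t + (- 1) * A 2 3 t" for t
  have tA: "test_fun (A 1 2)" "test_fun (A 2 3)" "laplace (A 1 2) \<mu> = 1" "laplace (A 2 3) \<mu> = 1"
    unfolding A_def using test_fun_exp_indicator[of 1 \<mu> 2] test_fun_exp_indicator[of 2 \<mu> 3] by auto
  have F: "test_fun F" unfolding F_def by (intro test_fun_add test_fun_scale tA)
  have z: "laplace F \<mu> = 0"
    unfolding F_def using tA by (simp only: laplace_add[OF tA(1) test_fun_scale[OF tA(2)]] laplace_scale) simp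
  \<comment> \<open>The antiderivative of the indicator of {1..2} minus that of {2..3}: a tent on
    {1..3} with height 1 at 2.\<close>
  define H where "H r = max 0 (min r 2 - 1) - max 0 (min r 3 - 2)" for r :: real
  have ee: "exp_kernel \<mu> t * exp (\<mu> * complex_of_real t) = 1" for t
    unfolding exp_kernel_def by (simp add: exp_add[symmetric])
  have cv: "convol (exp_kernel \<mu>) F r = exp_kernel \<mu> r * complex_of_real (H r)" for r
  proof -
    have "indicat_real {..r} s *\<^sub>R (F s * exp (\<mu> * complex_of_real s))
      = complex_of_real (indicat_real {1..min r 2} s - indicat_real {2..min r 3} s)" for s
      using ee[of s] by (auto simp: F_def A_def indicator_def algebra_simps)
    moreover have "has_bochner_integral half_line (\<lambda>s. complex_of_real (indicat_real {1..min r 2} s - indicat_real {2..min r 3} s)) (complex_of_real (H r))"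
      unfolding H_def
      by (intro has_bochner_integral_of_real has_bochner_integral_diff half_line_integral_Icc) auto
    ultimately show ?thesis unfolding convol_exp_kernel[OF test_fun_measurable[OF F]]
      by (simp add: has_bochner_integral_iff)
  qed
  have "laplace (convol (exp_kernel \<mu>) F) \<mu> = (LINT r|half_line. complex_of_real (H r))"
    unfolding laplace_def cv using ee by (intro Bochner_Integration.integral_cong refl) (metis mult.assoc mult.commute mult.right_neutral)
  also have "\<dots> = complex_of_real (LINT r|half_line. H r)" by (rule integral_complex_of_real)
  finally have l: "laplace (convol (exp_kernel \<mu>) F) \<mu> = complex_of_real (LINT r|half_line. H r)" .
  have "integrable half_line (\<lambda>r. convol (exp_kernel \<mu>) F r * exp (\<mu> * complex_of_real r))"
    by (rule test_fun_exp_integrable[OF convol_exp_kernel_test_fun[OF F z]])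
  also have "(\<lambda>r. convol (exp_kernel \<mu>) F r * exp (\<mu> * complex_of_real r)) = (\<lambda>r. complex_of_real (H r))"
    unfolding cv using ee by (intro ext) (metis mult.assoc mult.commute mult.right_neutral)
  finally have iH: "integrable half_line H" by (simp add: complex_of_real_integrable_eq)
  \<comment> \<open>The tent is at least 1/2 on {3/2..2}, hence its integral is at least
    1/4.\<close>
  have hb: "has_bochner_integral half_line (\<lambda>r. 1 / 2 * indicat_real {3/2..2} r) (1 / 2 * max 0 (2 - 3 / 2))"
    by (intro has_bochner_integral_mult_right half_line_integral_Icc) auto
  then have "1 / 4 = (LINT r|half_line. 1 / 2 * indicat_real {3/2..2} r)"
    by (simp only: has_bochner_integral_iff) simp
  also have "\<dots> \<le> (LINT r|half_line. H r)"
    using hb by (intro integral_mono iH) (auto simp: has_bochner_integral_iff H_def indicator_def)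
  finally have "laplace (convol (exp_kernel \<mu>) F) \<mu> \<noteq> 0" unfolding l by auto
  with F z that show thesis by blast
qed

lemma test_fun_locally_integrable:
  assumes "test_fun F"
  shows "(\<integral>\<^sup>+t. ennreal (cmod (F t)) * indicator {..r} t \<partial>half_line) < \<infinity>"
proof -
  have "(\<integral>\<^sup>+t. ennreal (cmod (F t)) * indicator {..r} t \<partial>half_line) \<le> (\<integral>\<^sup>+t. ennreal (cmod (F t)) \<partial>half_line)"
    by (intro nn_integral_mono) (auto simp: indicator_def)
  also have "\<dots> < \<infinity>" using assms unfolding test_fun_def integrable_iff_bounded by blast
  finally show ?thesis .
qed

text \<open>Associativity reduces this to the convolution of \<mu> f0 + f0' with the exponential,
  which is f0. It is a pointwise statement, so it also covers the case in which the convolution with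
  \<open>F\<close> has an exponential tail and need not lie in the weighted space.\<close>

lemma convol_resolvend_assoc:
  assumes f: "C1_ray f\<^sub>0" "f\<^sub>0 0 = 0" and F: "test_fun F"
  shows "convol (resolvend_fun f\<^sub>0 \<mu>) (convol (exp_kernel \<mu>) F) r = convol f\<^sub>0 F r"
proof -
  have "convol (resolvend_fun f\<^sub>0 \<mu>) (convol (exp_kernel \<mu>) F) r
    = convol (convol (resolvend_fun f\<^sub>0 \<mu>) (exp_kernel \<mu>)) F r"
    by (rule convol_assoc[OF continuous_resolvend_fun[OF f(1)] continuous_exp_kernel
          test_fun_measurable[OF F] test_fun_locally_integrable[OF F]])
  also have "\<dots> = convol f\<^sub>0 F r"
    unfolding convol_def[of _ F]
    by (intro Bochner_Integration.integral_cong refl) (simp add: convol_resolvend_exp[OF f])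
  finally show ?thesis .
qed

section \<open>The generator as a fraction in the Arveson ideal, and its characters\<close>

context multiplier_flow begin

lemma generating_functionD:
  assumes "generating_function T f\<^sub>0"
  shows "C1_ray f\<^sub>0" "f\<^sub>0 0 = 0" "f\<^sub>0 \<in> L1w (weight T)" "deriv_ray f\<^sub>0 \<in> L1w (weight T)"
    "resolvend_fun f\<^sub>0 \<mu> \<in> L1w (weight T)"
    "Phi T (resolvend_fun f\<^sub>0 \<mu>) = \<mu> *\<^sub>C Phi T f\<^sub>0 + Phi T (deriv_ray f\<^sub>0)"
proof -
  show 1: "C1_ray f\<^sub>0" "f\<^sub>0 0 = 0" "f\<^sub>0 \<in> L1w (weight T)" "deriv_ray f\<^sub>0 \<in> L1w (weight T)"
    using assms unfolding generating_function_def Omega_L1w_def by auto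
  show "resolvend_fun f\<^sub>0 \<mu> \<in> L1w (weight T)"
    unfolding resolvend_fun_def by (intro L1w_add L1w_scale weight_fun_T 1)
  show "Phi T (resolvend_fun f\<^sub>0 \<mu>) = \<mu> *\<^sub>C Phi T f\<^sub>0 + Phi T (deriv_ray f\<^sub>0)"
    unfolding resolvend_fun_def
    by (simp add: Phi_add[OF L1w_scale[OF weight_fun_T 1(3)] 1(4)] Phi_scale[OF 1(3)])
qed

text \<open>\<Phi> turns convolution into composition, does not increase norms and has dense range
  in the ideal, so it carries the density of f0 * L1 over to the ideal.\<close>

lemma Phi_generating_Omega:
  assumes f: "generating_function T f\<^sub>0"
  shows "Phi T f\<^sub>0 \<in> Omega (arveson_ideal T) blinfun_compose"
proof -
  note fL = generating_functionD(3)[OF f]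
  have "Phi T g \<in> closure (blinfun_compose (Phi T f\<^sub>0) ` arveson_ideal T)" if g: "g \<in> L1w (weight T)" for g
    unfolding closure_approachable
  proof (intro allI impI)
    fix e :: real assume e: "e > 0"
    have "f\<^sub>0 \<in> Omega_L1w (weight T)" using f unfolding generating_function_def by blast
    then have "\<forall>\<epsilon>>0. \<exists>h\<in>L1w (weight T).
      (\<integral>\<^sup>+ t. ennreal (cmod (convol f\<^sub>0 h t - g t) * weight T t) \<partial>half_line) < ennreal \<epsilon>"
      using g unfolding Omega_L1w_def by blast
    then obtain h where h: "h \<in> L1w (weight T)"
      "(\<integral>\<^sup>+ t. ennreal (cmod (convol f\<^sub>0 h t - g t) * weight T t) \<partial>half_line) < ennreal (e / 2)"
      using half_gt_zero[OF e] by blast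
    have "norm (Phi T (\<lambda>t. convol f\<^sub>0 h t - g t)) \<le> e / 2"
      using e h(2) by (intro Phi_norm_le L1w_diff weight_fun_T L1w_convol fL h(1) g) auto
    then have "norm ((Phi T f\<^sub>0 o\<^sub>L Phi T h) - Phi T g) \<le> e / 2"
      by (simp add: Phi_diff[OF L1w_convol[OF weight_fun_T fL h(1)] g] Phi_convol[OF fL h(1)])
    then have "dist (Phi T f\<^sub>0 o\<^sub>L Phi T h) (Phi T g) < e" using e by (simp add: dist_norm)
    then show "\<exists>y\<in>blinfun_compose (Phi T f\<^sub>0) ` arveson_ideal T. dist y (Phi T g) < e"
      using Phi_in_ideal[OF h(1)] by blast
  qed
  then have "arveson_ideal T \<subseteq> closure (blinfun_compose (Phi T f\<^sub>0) ` arveson_ideal T)"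
    unfolding arveson_ideal_def[of T] by (intro closure_minimal) auto
  then show ?thesis unfolding Omega_def using Phi_in_ideal[OF fL] by blast
qed

text \<open>Formally (\<mu> - \<Delta>) \<Phi>(e * F) = \<Phi>(F), with e the exponential kernel,
  multiplied by the denominator \<Phi>(f0).\<close>

lemma Phi_resolvend_test:
  assumes f: "generating_function T f\<^sub>0" and F: "test_fun F" and z: "laplace F \<mu> = 0"
  shows "Phi T (resolvend_fun f\<^sub>0 \<mu>) o\<^sub>L Phi T (convol (exp_kernel \<mu>) F) = Phi T f\<^sub>0 o\<^sub>L Phi T F"
proof -
  note g = generating_functionD[OF f]
  note h = test_fun_L1w[OF weight_fun_T convol_exp_kernel_test_fun[OF F z]]
  note FL = test_fun_L1w[OF weight_fun_T F]
  have "Phi T (convol (resolvend_fun f\<^sub>0 \<mu>) (convol (exp_kernel \<mu>) F)) = Phi T (convol f\<^sub>0 F)"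
    by (rule Phi_cong[OF L1w_convol[OF weight_fun_T g(5) h] L1w_convol[OF weight_fun_T g(3) FL]])
      (rule convol_resolvend_assoc[OF g(1,2) F])
  then show ?thesis by (simp add: Phi_convol[OF g(5) h] Phi_convol[OF g(3) FL])
qed

context
  fixes \<phi> assumes chi: "is_character (arveson_ideal T) blinfun_compose \<phi>"
begin

lemma char_add: "x \<in> arveson_ideal T \<Longrightarrow> y \<in> arveson_ideal T \<Longrightarrow> \<phi> (x + y) = \<phi> x + \<phi> y"
  and char_scale: "x \<in> arveson_ideal T \<Longrightarrow> \<phi> (c *\<^sub>C x) = c * \<phi> x"
  and char_mult: "x \<in> arveson_ideal T \<Longrightarrow> y \<in> arveson_ideal T \<Longrightarrow> \<phi> (x o\<^sub>L y) = \<phi> x * \<phi> y"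
  and char_nonzero: "\<exists>x\<in>arveson_ideal T. \<phi> x \<noteq> 0"
  using chi unfolding is_character_def by blast+

text \<open>If \<open>\<phi> y = 1\<close> with \<open>\<parallel>y\<parallel> < 1\<close>, the fixed point of \<open>z \<mapsto> y + y z\<close> gives \<open>\<phi> z = 1 + \<phi> z\<close>.\<close>

lemma char_norm_le:
  assumes x: "x \<in> arveson_ideal T"
  shows "cmod (\<phi> x) \<le> norm x"
proof (rule ccontr)
  assume "\<not> ?thesis"
  then have gt: "norm x < cmod (\<phi> x)" by simp
  then have nz: "\<phi> x \<noteq> 0" using norm_ge_zero[of x] by auto
  define y where "y = (1 / \<phi> x) *\<^sub>C x"
  have y: "y \<in> arveson_ideal T" unfolding y_def by (rule ideal_scale[OF x])
  have fy: "\<phi> y = 1" unfolding y_def using char_scale[OF x] nz by simp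
  have ny: "norm y < 1" unfolding y_def norm_scaleC using gt nz by (simp add: norm_divide field_simps)
  have "\<exists>!z\<in>arveson_ideal T. y + (y o\<^sub>L z) = z"
  proof (rule Banach_fix)
    show "complete (arveson_ideal T)" using closed_ideal by (simp add: complete_eq_closed)
    show "arveson_ideal T \<noteq> {}" using x by blast
    show "(\<lambda>z. y + (y o\<^sub>L z)) ` arveson_ideal T \<subseteq> arveson_ideal T"
      using y ideal_add ideal_compose by blast
    show "dist (y + (y o\<^sub>L z)) (y + (y o\<^sub>L w)) \<le> norm y * dist z w" for z w
    proof -
      have "(y + (y o\<^sub>L z)) - (y + (y o\<^sub>L w)) = y o\<^sub>L (z - w)"
        by (simp add: bounded_bilinear.diff_right[OF bounded_bilinear_blinfun_compose])
      then show ?thesis unfolding dist_norm by (simp add: norm_blinfun_compose)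
    qed
  qed (use ny in auto)
  then obtain z where z: "z \<in> arveson_ideal T" "y + (y o\<^sub>L z) = z" by blast
  have "\<phi> z = \<phi> y + \<phi> y * \<phi> z"
    using char_add[OF y ideal_compose[OF y z(1)]] char_mult[OF y z(1)] z(2) by simp
  then show False using fy by simp
qed

lemma char_diff:
  assumes x: "x \<in> arveson_ideal T" and y: "y \<in> arveson_ideal T"
  shows "\<phi> (x - y) = \<phi> x - \<phi> y" "x - y \<in> arveson_ideal T"
  using char_add[OF x ideal_scale[OF y, of "- 1"]] char_scale[OF y, of "- 1"] ideal_add[OF x ideal_scale[OF y, of "- 1"]]
  by (simp_all add: scaleC_minus1)

lemma char_tendsto:
  assumes "\<And>n::nat. X n \<in> arveson_ideal T" "x \<in> arveson_ideal T" "X \<longlonglongrightarrow> x"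
  shows "(\<lambda>n. \<phi> (X n)) \<longlonglongrightarrow> \<phi> x"
proof (rule Lim_transform2)
  show "(\<lambda>n. \<phi> x) \<longlonglongrightarrow> \<phi> x" by simp
  show "(\<lambda>n. \<phi> x - \<phi> (X n)) \<longlonglongrightarrow> 0"
  proof (rule Lim_null_comparison)
    show "\<forall>\<^sub>F n in sequentially. norm (\<phi> x - \<phi> (X n)) \<le> norm (x - X n)"
      using char_norm_le char_diff assms by (intro always_eventually) metis
    have "(\<lambda>n. norm (x - X n)) \<longlonglongrightarrow> norm (x - x)" by (intro tendsto_intros assms)
    then show "(\<lambda>n. norm (x - X n)) \<longlonglongrightarrow> 0" by simp
  qed
qed

text \<open>A character vanishing at \<open>v\<close> vanishes on the principal ideal of
  \<open>v\<close>, which is dense, hence everywhere by continuity.\<close>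

lemma char_Omega_nonzero:
  assumes v: "v \<in> Omega (arveson_ideal T) blinfun_compose"
  shows "\<phi> v \<noteq> 0"
proof
  assume z: "\<phi> v = 0"
  have vI: "v \<in> arveson_ideal T" using v unfolding Omega_def by blast
  have "\<phi> x = 0" if x: "x \<in> arveson_ideal T" for x
  proof -
    have "x \<in> closure (blinfun_compose v ` arveson_ideal T)" using v x unfolding Omega_def by blast
    then obtain X where X: "\<And>n::nat. X n \<in> blinfun_compose v ` arveson_ideal T" "X \<longlonglongrightarrow> x"
      unfolding closure_sequential by blast
    have "X n \<in> arveson_ideal T \<and> \<phi> (X n) = 0" for n
      using X(1)[of n] ideal_compose[OF vI] char_mult[OF vI] z by auto
    then have "(\<lambda>n. 0) \<longlonglongrightarrow> \<phi> x" using char_tendsto[OF _ x X(2)] by simp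
    then show ?thesis by (simp add: LIMSEQ_const_iff)
  qed
  then show False using char_nonzero by blast
qed

text \<open>The description is well defined: by commutativity the pair (v, u) lies in the graph of
  the quotient u/v, and membership in the graph of u'/v' is the cross-multiplied identity, to which
  the character is applied.\<close>

lemma character_ext_eq:
  assumes u: "u \<in> arveson_ideal T" and v: "v \<in> Omega (arveson_ideal T) blinfun_compose"
  shows "character_ext (arveson_ideal T) blinfun_compose \<phi> (qm (arveson_ideal T) blinfun_compose u v) = \<phi> u / \<phi> v"
  unfolding character_ext_def
proof (rule the_equality)
  show "\<exists>u'\<in>arveson_ideal T. \<exists>v'\<in>Omega (arveson_ideal T) blinfun_compose.
    qm (arveson_ideal T) blinfun_compose u v = qm (arveson_ideal T) blinfun_compose u' v' \<and> \<phi> u / \<phi> v = \<phi> u' / \<phi> v'"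
    using u v by blast
  fix z assume "\<exists>u'\<in>arveson_ideal T. \<exists>v'\<in>Omega (arveson_ideal T) blinfun_compose.
    qm (arveson_ideal T) blinfun_compose u v = qm (arveson_ideal T) blinfun_compose u' v' \<and> z = \<phi> u' / \<phi> v'"
  then obtain u' v' where u': "u' \<in> arveson_ideal T" and v': "v' \<in> Omega (arveson_ideal T) blinfun_compose"
    and eq: "qm (arveson_ideal T) blinfun_compose u v = qm (arveson_ideal T) blinfun_compose u' v'"
    and z: "z = \<phi> u' / \<phi> v'" by blast
  have vI: "v \<in> arveson_ideal T" "v' \<in> arveson_ideal T" using v v' unfolding Omega_def by auto
  have "(v, u) \<in> qm (arveson_ideal T) blinfun_compose u v"
    unfolding qm_def using u vI ideal_commute by auto
  then have "(v, u) \<in> qm (arveson_ideal T) blinfun_compose u' v'" by (simp only: eq)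
  then have "v' o\<^sub>L u = u' o\<^sub>L v" unfolding qm_def by simp
  then have "\<phi> v' * \<phi> u = \<phi> u' * \<phi> v" using char_mult u u' vI by metis
  then show "z = \<phi> u / \<phi> v"
    unfolding z using char_Omega_nonzero[OF v] char_Omega_nonzero[OF v'] by (simp add: field_simps)
qed

text \<open>Clearing the denominator \<phi>(\<Phi>(f0)), which is not zero, turns an equation for
  the extended character into the vanishing of the character at one element of the ideal.\<close>

lemma character_ext_generator_iff:
  assumes f: "generating_function T f\<^sub>0"
  shows "character_ext (arveson_ideal T) blinfun_compose \<phi> (arveson_generator T f\<^sub>0) = \<mu>
    \<longleftrightarrow> \<phi> (Phi T (resolvend_fun f\<^sub>0 \<mu>)) = 0"
proof -
  note g = generating_functionD[OF f]
  note P = Phi_in_ideal[OF g(3)] Phi_in_ideal[OF g(4)]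
  note Om = Phi_generating_Omega[OF f]
  have m: "- Phi T (deriv_ray f\<^sub>0) \<in> arveson_ideal T" "\<phi> (- Phi T (deriv_ray f\<^sub>0)) = - \<phi> (Phi T (deriv_ray f\<^sub>0))"
    using ideal_scale[OF P(2), of "-1"] char_scale[OF P(2), of "-1"] by (simp_all add: scaleC_minus1)
  have "\<phi> (Phi T (resolvend_fun f\<^sub>0 \<mu>)) = \<mu> * \<phi> (Phi T f\<^sub>0) + \<phi> (Phi T (deriv_ray f\<^sub>0))"
    unfolding g(6) using char_add[OF ideal_scale[OF P(1)] P(2)] char_scale[OF P(1)] by simp
  then show ?thesis
    unfolding arveson_generator_def character_ext_eq[OF m(1) Om] m(2)
    using char_Omega_nonzero[OF Om] by (auto simp: field_simps add_eq_0_iff)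
qed

text \<open>The character kills \<Phi>(F) whenever the transform of \<open>F\<close> vanishes at
  \<mu>, so on test functions it is a multiple of that transform. Both are multiplicative and
  nonzero, which forces the multiple to be 1.\<close>

lemma char_Phi_test:
  assumes f: "generating_function T f\<^sub>0"
    and z: "\<phi> (Phi T (resolvend_fun f\<^sub>0 \<mu>)) = 0" and p: "test_fun p"
  shows "\<phi> (Phi T p) = laplace p \<mu>"
proof -
  note g = generating_functionD[OF f]
  have L: "test_fun h \<Longrightarrow> h \<in> L1w (weight T)" for h by (rule test_fun_L1w[OF weight_fun_T])
  have van: "\<phi> (Phi T F) = 0" if F: "test_fun F" "laplace F \<mu> = 0" for F
  proof -
    have "\<phi> (Phi T f\<^sub>0) * \<phi> (Phi T F) = \<phi> (Phi T (resolvend_fun f\<^sub>0 \<mu>)) * \<phi> (Phi T (convol (exp_kernel \<mu>) F))"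
      using Phi_resolvend_test[OF f F] char_mult Phi_in_ideal[OF g(3)] Phi_in_ideal[OF g(5)]
        Phi_test_in_ideal[OF F(1)] Phi_test_in_ideal[OF convol_exp_kernel_test_fun[OF F]] by metis
    then show ?thesis using z char_Omega_nonzero[OF Phi_generating_Omega[OF f]] by simp
  qed
  obtain x where x: "x \<in> arveson_ideal T" "\<phi> x \<noteq> 0" using char_nonzero by blast
  obtain q where q: "test_fun q" "\<phi> (Phi T q) \<noteq> 0"
  proof -
    obtain k where k: "\<And>n::nat. test_fun (k n)" "(\<lambda>n. Phi T (k n)) \<longlonglongrightarrow> x"
      by (rule ideal_sequence[OF x(1)]) blast
    have "\<exists>n. \<phi> (Phi T (k n)) \<noteq> 0"
    proof (rule ccontr)
      assume "\<not> ?thesis"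
      then have "(\<lambda>n. 0) \<longlonglongrightarrow> \<phi> x" using char_tendsto[OF Phi_test_in_ideal[OF k(1)] x(1) k(2)] by simp
      then show False using x(2) by (simp add: LIMSEQ_const_iff)
    qed
    then show thesis using k(1) that by blast
  qed
  \<comment> \<open>The linear combination of \<open>q\<close> and \<open>h\<close> is chosen so
    that its transform vanishes at \<mu>.\<close>
  have ratio: "laplace h \<mu> * \<phi> (Phi T q) = laplace q \<mu> * \<phi> (Phi T h)" if h: "test_fun h" for h
  proof -
    let ?F = "\<lambda>t. laplace h \<mu> * q t + (- laplace q \<mu>) * h t"
    note sc = test_fun_scale[OF q(1), of "laplace h \<mu>"] test_fun_scale[OF h, of "- laplace q \<mu>"]
    have "laplace ?F \<mu> = 0" unfolding laplace_add[OF sc] laplace_scale by simp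
    then have "\<phi> (Phi T ?F) = 0" by (intro van test_fun_add sc)
    moreover have "Phi T ?F = laplace h \<mu> *\<^sub>C Phi T q + (- laplace q \<mu>) *\<^sub>C Phi T h"
      unfolding Phi_add[OF L[OF sc(1)] L[OF sc(2)]] Phi_scale[OF L[OF q(1)]] Phi_scale[OF L[OF h]] ..
    moreover have "\<phi> \<dots> = laplace h \<mu> * \<phi> (Phi T q) + (- laplace q \<mu>) * \<phi> (Phi T h)"
      using char_add char_scale ideal_scale Phi_test_in_ideal[OF q(1)] Phi_test_in_ideal[OF h] by metis
    ultimately show ?thesis by simp
  qed
  have lq: "laplace q \<mu> \<noteq> 0" using van[OF q(1)] q(2) by blast
  \<comment> \<open>Proportionality applied to q * q compares squares with first powers and gives
    the factor 1.\<close>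
  have "\<phi> (Phi T (convol q q)) = \<phi> (Phi T q) * \<phi> (Phi T q)"
    using Phi_convol[OF L[OF q(1)] L[OF q(1)]] char_mult Phi_test_in_ideal[OF q(1)] by simp
  then have "laplace q \<mu> = \<phi> (Phi T q)"
    using ratio[OF test_fun_convol(1)[OF q(1) q(1)]] test_fun_convol(2)[OF q(1) q(1), of \<mu>] lq q(2) by simp
  then show ?thesis using ratio[OF p] q(2) lq by simp
qed

end

section \<open>The norm criterion for the Arveson spectrum\<close>

lemma sigma_ar_laplace_le:
  assumes f: "generating_function T f\<^sub>0" and mu: "\<mu> \<in> sigma_ar T f\<^sub>0" and p: "test_fun p"
  shows "cmod (laplace p \<mu>) \<le> norm (Phi T p)"
proof -
  obtain \<phi> where chi: "is_character (arveson_ideal T) blinfun_compose \<phi>"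
    and eq: "character_ext (arveson_ideal T) blinfun_compose \<phi> (arveson_generator T f\<^sub>0) = \<mu>"
    using mu unfolding sigma_ar_def by auto
  have "\<phi> (Phi T (resolvend_fun f\<^sub>0 \<mu>)) = 0" using character_ext_generator_iff[OF chi f] eq by blast
  then have "\<phi> (Phi T p) = laplace p \<mu>" by (rule char_Phi_test[OF chi f _ p])
  then show ?thesis using char_norm_le[OF chi Phi_test_in_ideal[OF p]] by simp
qed

text \<open>The hypothesis makes \<Phi>(p) \<mapsto> p^(\<mu>) well defined and contractive, so it
  extends to the closure, and test function convolution makes the extension multiplicative. It
  remains to see that the resulting character takes the value \<mu> at the generator.\<close>

lemma laplace_le_sigma_ar:
  assumes f: "generating_function T f\<^sub>0"
    and le: "\<And>p. test_fun p \<Longrightarrow> cmod (laplace p \<mu>) \<le> norm (Phi T p)"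
  shows "\<mu> \<in> sigma_ar T f\<^sub>0"
proof -
  note g = generating_functionD[OF f]
  have L: "test_fun h \<Longrightarrow> h \<in> L1w (weight T)" for h by (rule test_fun_L1w[OF weight_fun_T])
  have diff: "cmod (laplace p \<mu> - laplace q \<mu>) \<le> norm (Phi T p - Phi T q)" if p: "test_fun p" and q: "test_fun q" for p q
  proof -
    note t = test_fun_scale[OF q, of "-1"]
    have "laplace (\<lambda>t. p t + (-1) * q t) \<mu> = laplace p \<mu> - laplace q \<mu>"
      unfolding laplace_add[OF p t] laplace_scale by simp
    moreover have "Phi T (\<lambda>t. p t + (-1) * q t) = Phi T p - Phi T q"
      unfolding Phi_add[OF L[OF p] L[OF t]] Phi_scale[OF L[OF q]] scaleC_minus1 by simp
    ultimately show ?thesis using le[OF test_fun_add[OF p t]] by simp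
  qed
  have conv: "convergent (\<lambda>n. laplace (p n) \<mu>)"
    if p: "\<And>n::nat. test_fun (p n)" and c: "(\<lambda>n. Phi T (p n)) \<longlonglongrightarrow> x" for p x
  proof -
    have "Cauchy (\<lambda>n. laplace (p n) \<mu>)"
    proof (rule metric_CauchyI)
      fix e :: real assume "e > 0"
      then obtain N where "\<And>m n. m \<ge> N \<Longrightarrow> n \<ge> N \<Longrightarrow> dist (Phi T (p m)) (Phi T (p n)) < e"
        using metric_CauchyD[OF LIMSEQ_imp_Cauchy[OF c]] by blast
      then show "\<exists>M. \<forall>m\<ge>M. \<forall>n\<ge>M. dist (laplace (p m) \<mu>) (laplace (p n) \<mu>) < e"
        using diff[OF p p] unfolding dist_norm by (meson le_less_trans)
    qed
    then show ?thesis by (simp add: Cauchy_convergent_iff)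
  qed
  have "\<forall>x\<in>arveson_ideal T. \<exists>p. (\<forall>n::nat. test_fun (p n)) \<and> (\<lambda>n. Phi T (p n)) \<longlonglongrightarrow> x"
    using ideal_sequence by metis
  then obtain P where P: "\<And>x n. x \<in> arveson_ideal T \<Longrightarrow> test_fun (P x (n::nat))"
    "\<And>x. x \<in> arveson_ideal T \<Longrightarrow> (\<lambda>n. Phi T (P x n)) \<longlonglongrightarrow> x" by metis
  define \<phi> where "\<phi> x = lim (\<lambda>n. laplace (P x n) \<mu>)" for x
  \<comment> \<open>The limit does not depend on the approximating sequence. Sums, products and
    multiples can therefore be evaluated along termwise combined sequences.\<close>
  have lim: "(\<lambda>n. laplace (p n) \<mu>) \<longlonglongrightarrow> \<phi> x"
    if x: "x \<in> arveson_ideal T" and p: "\<And>n::nat. test_fun (p n)" and c: "(\<lambda>n. Phi T (p n)) \<longlonglongrightarrow> x" for p x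
  proof (rule Lim_transform2)
    show "(\<lambda>n. laplace (P x n) \<mu>) \<longlonglongrightarrow> \<phi> x"
      unfolding \<phi>_def using conv[OF P(1)[OF x] P(2)[OF x]] by (simp add: convergent_LIMSEQ_iff)
    show "(\<lambda>n. laplace (P x n) \<mu> - laplace (p n) \<mu>) \<longlonglongrightarrow> 0"
    proof (rule Lim_null_comparison)
      show "\<forall>\<^sub>F n in sequentially. norm (laplace (P x n) \<mu> - laplace (p n) \<mu>) \<le> norm (Phi T (P x n) - Phi T (p n))"
        using diff[OF P(1)[OF x] p] by (intro always_eventually) blast
      have "(\<lambda>n. norm (Phi T (P x n) - Phi T (p n))) \<longlonglongrightarrow> norm (x - x)"
        by (intro tendsto_intros P(2)[OF x] c)
      then show "(\<lambda>n. norm (Phi T (P x n) - Phi T (p n))) \<longlonglongrightarrow> 0" by simp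
    qed
  qed
  have phiP: "\<phi> (Phi T p) = laplace p \<mu>" if p: "test_fun p" for p
    using lim[OF Phi_test_in_ideal[OF p], of "\<lambda>n. p"] p by (simp add: LIMSEQ_const_iff)
  have chi: "is_character (arveson_ideal T) blinfun_compose \<phi>"
    unfolding is_character_def
  proof (intro conjI ballI allI)
    fix x y assume x: "x \<in> arveson_ideal T" and y: "y \<in> arveson_ideal T"
    note px = P(1)[OF x] and py = P(1)[OF y]
    have "(\<lambda>n. laplace (\<lambda>t. P x n t + P y n t) \<mu>) \<longlonglongrightarrow> \<phi> (x + y)"
      by (rule lim[OF ideal_add[OF x y] test_fun_add[OF px py]])
        (simp only: Phi_add[OF L[OF px] L[OF py]], intro tendsto_intros P(2) x y)
    moreover have "(\<lambda>n. laplace (\<lambda>t. P x n t + P y n t) \<mu>) \<longlonglongrightarrow> \<phi> x + \<phi> y"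
      unfolding laplace_add[OF px py] by (intro tendsto_intros lim x y px py P(2))
    ultimately show "\<phi> (x + y) = \<phi> x + \<phi> y" by (rule LIMSEQ_unique)
    have "(\<lambda>n. laplace (convol (P x n) (P y n)) \<mu>) \<longlonglongrightarrow> \<phi> (x o\<^sub>L y)"
      by (rule lim[OF ideal_compose[OF x y] test_fun_convol(1)[OF px py]])
        (simp only: Phi_convol[OF L[OF px] L[OF py]],
          intro bounded_bilinear.tendsto[OF bounded_bilinear_blinfun_compose] P(2) x y)
    moreover have "(\<lambda>n. laplace (convol (P x n) (P y n)) \<mu>) \<longlonglongrightarrow> \<phi> x * \<phi> y"
      unfolding test_fun_convol(2)[OF px py] by (intro tendsto_intros lim x y px py P(2))
    ultimately show "\<phi> (x o\<^sub>L y) = \<phi> x * \<phi> y" by (rule LIMSEQ_unique)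
  next
    fix c x assume x: "x \<in> arveson_ideal T"
    note px = P(1)[OF x]
    have "(\<lambda>n. laplace (\<lambda>t. c * P x n t) \<mu>) \<longlonglongrightarrow> \<phi> (c *\<^sub>C x)"
      by (rule lim[OF ideal_scale[OF x] test_fun_scale[OF px]])
        (simp only: Phi_scale[OF L[OF px]], intro bounded_linear.tendsto[OF bounded_linear_scaleC] P(2) x)
    moreover have "(\<lambda>n. laplace (\<lambda>t. c * P x n t) \<mu>) \<longlonglongrightarrow> c * \<phi> x"
      unfolding laplace_scale by (intro tendsto_intros lim x px P(2))
    ultimately show "\<phi> (c *\<^sub>C x) = c * \<phi> x" by (rule LIMSEQ_unique)
  next
    \<comment> \<open>The transform of this function at \<mu> is 1, so the functional is not
      zero.\<close>
    let ?e = "\<lambda>t. exp_kernel \<mu> t * complex_of_real (indicat_real {1..2} t)"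
    have "test_fun ?e" "laplace ?e \<mu> = 1" using test_fun_exp_indicator[of 1 \<mu> 2] by auto
    then show "\<exists>x\<in>arveson_ideal T. \<phi> x \<noteq> 0"
      using phiP[of ?e] Phi_test_in_ideal[of ?e] by (metis zero_neq_one)
  qed
  \<comment> \<open>Applying \<phi> to the identity of \<open>Phi_resolvend_test\<close> gives 0 on
    the side of \<open>F\<close>, while \<phi> does not vanish at \<Phi>(e * F); so \<phi> vanishes
    at \<Phi>(\<mu> f0 + f0').\<close>
  obtain F where F: "test_fun F" "laplace F \<mu> = 0" "laplace (convol (exp_kernel \<mu>) F) \<mu> \<noteq> 0"
    by (rule laplace_zero_witness)
  note h = convol_exp_kernel_test_fun[OF F(1,2)]
  have "\<phi> (Phi T (resolvend_fun f\<^sub>0 \<mu>)) * \<phi> (Phi T (convol (exp_kernel \<mu>) F)) = \<phi> (Phi T f\<^sub>0) * \<phi> (Phi T F)"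
    using Phi_resolvend_test[OF f F(1,2)] char_mult[OF chi] Phi_in_ideal[OF g(3)] Phi_in_ideal[OF g(5)]
      Phi_test_in_ideal[OF F(1)] Phi_test_in_ideal[OF h] by metis
  then have "\<phi> (Phi T (resolvend_fun f\<^sub>0 \<mu>)) = 0" using F phiP[OF F(1)] phiP[OF h] by simp
  then have "character_ext (arveson_ideal T) blinfun_compose \<phi> (arveson_generator T f\<^sub>0) = \<mu>"
    using character_ext_generator_iff[OF chi f] by blast
  then show ?thesis unfolding sigma_ar_def using chi by blast
qed

lemma Res_ar_iff:
  assumes f: "generating_function T f\<^sub>0"
  shows "\<mu> \<in> Res_ar T f\<^sub>0 \<longleftrightarrow> (\<exists>p. test_fun p \<and> norm (Phi T p) < cmod (laplace p \<mu>))"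
  unfolding Res_ar_def Compl_iff
  using sigma_ar_laplace_le[OF f] laplace_le_sigma_ar[OF f] by (metis not_less)

lemma open_Res_ar:
  assumes f: "generating_function T f\<^sub>0"
  shows "open (Res_ar T f\<^sub>0)"
proof -
  have "Res_ar T f\<^sub>0 = (\<Union>p\<in>Collect test_fun. {\<mu>. norm (Phi T p) < cmod (laplace p \<mu>)})"
    using Res_ar_iff[OF f] by auto
  moreover have "open {\<mu>. norm (Phi T p) < cmod (laplace p \<mu>)}" if "test_fun p" for p
  proof -
    have "continuous_on UNIV (laplace p)" using laplace_continuous[OF that] by (simp add: continuous_at_imp_continuous_on)
    then show ?thesis by (intro open_Collect_less continuous_intros)
  qed
  ultimately show ?thesis by auto
qed

text \<open>\<open>growth_rate\<close> is given as a limit, whose existence is Fekete's lemma for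
  the submultiplicative weight: the limit is the infimum of \<omega>(t)^(1/t). Any \<rho> strictly
  between this infimum and exp(\<sigma>) then dominates the weight for large times.\<close>

lemma growth_bound:
  assumes s: "ereal_log (growth_rate T) < ereal \<sigma>"
  shows "\<exists>\<rho>>0. \<exists>t\<^sub>0>0. ln \<rho> < \<sigma> \<and> (\<forall>t\<ge>t\<^sub>0. weight T t \<le> \<rho> powr t)"
proof -
  define w where "w t = weight T t powr (1 / t)" for t
  define L where "L = (INF t\<in>{0<..}. w t)"
  have wn: "w t \<ge> 0" for t unfolding w_def by simp
  have bdd: "bdd_below (w ` {0<..})" using wn by (intro bdd_belowI2[where m = 0])
  have Lle: "L \<le> w t" if "t > 0" for t
    unfolding L_def using that by (intro cINF_lower bdd) simp
  have L0: "L \<ge> 0" unfolding L_def using wn by (intro cINF_greatest) auto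
  have "(w \<longlongrightarrow> L) at_top"
  proof (rule order_tendstoI)
    fix a assume "a < L"
    then have "a < w t" if "t > 0" for t using Lle[OF that] by simp
    then show "\<forall>\<^sub>F t in at_top. a < w t" using eventually_gt_at_top[of 0] by (rule eventually_mono[rotated])
  next
    fix a assume "L < a"
    then obtain p where p: "p > 0" "w p < a"
      using cINF_less_iff[of "{0<..}" w a] bdd unfolding L_def by auto
    have wp: "w p > 0" unfolding w_def using weight_pos[OF p(1)] by simp
    have wpp: "weight T p = w p powr p" unfolding w_def using p(1) weight_pos[OF p(1)] by (simp add: powr_powr)
    obtain K where K: "\<forall>t\<in>{p..2 * p}. weight T t \<le> K" using weight_fun_T p(1) unfolding weight_fun_def by meson
    \<comment> \<open>The remainder \<open>s\<close> below ranges over {p..2 * p} and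
      \<open>w p\<close> may lie on either side of 1, so the larger of the two extreme powers is
      taken.\<close>
    define K' where "K' = max K 1 * max (w p powr (- p)) (w p powr (- 2 * p))"
    have K'pos: "K' > 0" unfolding K'_def using wp by (auto intro!: mult_pos_pos simp: less_max_iff_disj)
    have pw: "weight T (real n * p + s) \<le> weight T p ^ n * weight T s" if "s > 0" for n s
    proof (induction n)
      case (Suc n)
      have "real n * p + s > 0" using that p(1) by (simp add: add_nonneg_pos)
      then have "weight T (p + (real n * p + s)) \<le> weight T p * weight T (real n * p + s)"
        using weight_fun_T p(1) unfolding weight_fun_def by blast
      also have "\<dots> \<le> weight T p * (weight T p ^ n * weight T s)"
        by (intro mult_left_mono Suc weight_nonneg)
      finally show ?case by (simp add: algebra_simps)
    qed simp
    have bd: "weight T t \<le> w p powr t * K'" if t: "t \<ge> p" for t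
    proof -
      \<comment> \<open>One less than the integer quotient: the remainder then lies in {p..2 * p},
        away from 0, where the weight may be unbounded.\<close>
      define n where "n = nat \<lfloor>t / p\<rfloor> - 1"
      have fl: "\<lfloor>t / p\<rfloor> \<ge> 1" using t p(1) by (simp add: le_floor_iff field_simps)
      have rn: "real n = real_of_int \<lfloor>t / p\<rfloor> - 1"
      proof -
        obtain k where k: "\<lfloor>t / p\<rfloor> = k" by blast
        then have "int n = k - 1" unfolding n_def using fl by linarith
        then show ?thesis unfolding k by linarith
      qed
      define s where "s = t - real n * p"
      have "real_of_int \<lfloor>t / p\<rfloor> * p \<le> t" "t < (real_of_int \<lfloor>t / p\<rfloor> + 1) * p"
        using p(1) floor_divide_lower[of p t] floor_divide_upper[of p t] by auto
      then have s: "p \<le> s" "s \<le> 2 * p" unfolding s_def rn by (auto simp: algebra_simps)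
      have "weight T t \<le> weight T p ^ n * weight T s" using pw[of s n] s p(1) unfolding s_def by simp
      also have "\<dots> \<le> weight T p ^ n * max K 1"
        using K s weight_nonneg by (intro mult_left_mono) (auto simp: le_max_iff_disj)
      also have "weight T p ^ n = w p powr (real n * p)"
        using wp by (simp add: wpp powr_powr powr_realpow[symmetric] mult.commute)
      also have "real n * p = t + (- s)" unfolding s_def by simp
      also have "w p powr (t + (- s)) = w p powr t * w p powr (- s)" by (rule powr_add)
      finally have a1: "weight T t \<le> w p powr t * w p powr (- s) * max K 1" .
      have "w p powr (- s) \<le> max (w p powr (- p)) (w p powr (- 2 * p))"
      proof (cases "w p \<ge> 1")
        case True
        then have "w p powr (- s) \<le> w p powr (- p)" using s by (intro powr_mono) auto
        then show ?thesis by simp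
      next
        case False
        then have "w p powr (- s) \<le> w p powr (- 2 * p)" using s wp by (intro powr_mono') auto
        then show ?thesis by simp
      qed
      then have "w p powr t * w p powr (- s) * max K 1 \<le> w p powr t * max (w p powr (- p)) (w p powr (- 2 * p)) * max K 1"
        by (intro mult_right_mono mult_left_mono) auto
      with a1 show ?thesis unfolding K'_def by (simp add: mult_ac)
    qed
    have "((\<lambda>t. w p * K' powr (1 / t)) \<longlongrightarrow> w p * K' powr 0) at_top"
      using K'pos by (intro tendsto_intros tendsto_divide_0[OF tendsto_const] filterlim_at_top_imp_at_infinity filterlim_ident) auto
    then have "((\<lambda>t. w p * K' powr (1 / t)) \<longlongrightarrow> w p) at_top" using K'pos by simp
    then have "\<forall>\<^sub>F t in at_top. w p * K' powr (1 / t) < a" using p(2) by (rule order_tendstoD)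
    then show "\<forall>\<^sub>F t in at_top. w t < a"
      using eventually_ge_at_top[of p]
    proof eventually_elim
      case (elim t)
      have t: "t > 0" using elim p(1) by simp
      have "w t \<le> (w p powr t * K') powr (1 / t)"
        unfolding w_def[of t] using t bd[OF elim(2)] weight_nonneg by (intro powr_mono2) auto
      also have "\<dots> = w p * K' powr (1 / t)" using t wp K'pos by (simp add: powr_mult powr_powr)
      finally show ?case using elim(1) by simp
    qed
  qed
  then have lim: "(w \<longlongrightarrow> L) at_top" .
  then have "growth_rate T = L"
    unfolding growth_rate_def w_def weight_def by (intro tendsto_Lim) auto
  \<comment> \<open>If the infimum is 0 its logarithm is minus infinity and positivity of the
    exponential is enough.\<close>
  then have "L < exp \<sigma>"
  proof (cases "L = 0")
    case False
    then have "ln L < \<sigma>" using s \<open>growth_rate T = L\<close> unfolding ereal_log_def by simp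
    then have "exp (ln L) < exp \<sigma>" by simp
    then show ?thesis using L0 False by simp
  qed simp
  then obtain \<rho> where r: "L < \<rho>" "\<rho> < exp \<sigma>" using dense by blast
  have rpos: "\<rho> > 0" using r L0 by simp
  have "ln \<rho> < ln (exp \<sigma>)" using rpos r(2) by (subst ln_less_cancel_iff) auto
  then have "ln \<rho> < \<sigma>" by simp
  moreover have "\<forall>\<^sub>F t in at_top. w t < \<rho>" using order_tendstoD(2)[OF lim r(1)] .
  then obtain t0 where t0: "\<And>t. t \<ge> t0 \<Longrightarrow> w t < \<rho>" unfolding eventually_at_top_linorder by blast
  have "weight T t \<le> \<rho> powr t" if t: "t \<ge> max t0 1" for t
  proof -
    have "weight T t = w t powr t" unfolding w_def using t weight_pos[of t] by (simp add: powr_powr)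
    also have "\<dots> \<le> \<rho> powr t" using t t0[of t] wn by (intro powr_mono2) auto
    finally show ?thesis .
  qed
  ultimately show ?thesis using rpos by (intro exI[of _ \<rho>] conjI exI[of _ "max t0 1"]) auto
qed

end

section \<open>Quasimultipliers and normalizations\<close>

lemma multipliers_swap:
  assumes R: "R \<in> multipliers"
  shows "u * blinfun_apply R v = blinfun_apply R u * v"
  by (rule trans[OF multipliersD(3)[OF R, symmetric] multipliersD(2)[OF R]])

lemma multiplier_power:
  assumes R: "R \<in> multipliers"
  shows "(blinfun_apply R ^^ n) (x * y) = (blinfun_apply R ^^ n) x * y"
    and "(blinfun_apply R ^^ n) (x * y) = x * (blinfun_apply R ^^ n) y"
proof -
  show 1: "(blinfun_apply R ^^ n) (x * y) = (blinfun_apply R ^^ n) x * y" for x y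
    by (induction n) (auto simp: multipliersD(2)[OF R])
  show "(blinfun_apply R ^^ n) (x * y) = x * (blinfun_apply R ^^ n) y"
    using 1[of y x] by (simp add: mult.commute)
qed

lemma norm_power_le:
  fixes R :: "'c::real_normed_vector \<Rightarrow>\<^sub>L 'c"
  shows "norm ((blinfun_apply R ^^ n) x) \<le> norm R ^ n * norm x"
proof (induction n)
  case (Suc n)
  have "norm ((blinfun_apply R ^^ Suc n) x) \<le> norm R * norm ((blinfun_apply R ^^ n) x)"
    using norm_blinfun[of R "(blinfun_apply R ^^ n) x"] by simp
  also have "\<dots> \<le> norm R * (norm R ^ n * norm x)" by (intro mult_left_mono Suc) simp
  finally show ?case by (simp add: mult.assoc)
qed simp

locale wc_algebra =
  fixes A :: "'a::comm_cbanach_algebra itself"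
  assumes wc: "weakly_cancellative (UNIV :: 'a set) (*)"
begin

abbreviation Om :: "'a set" where "Om \<equiv> Omega UNIV (*)"
abbreviation frac :: "'a \<Rightarrow> 'a \<Rightarrow> ('a \<times> 'a) set" where "frac \<equiv> qm UNIV (*)"

lemma mult_cancel: "(\<And>y. x * y = 0) \<Longrightarrow> x = (0::'a)"
proof (rule ccontr)
  assume "\<And>y. x * y = 0" "x \<noteq> 0"
  then have "(*) x ` UNIV = {0}" by auto
  then show False using wc \<open>x \<noteq> 0\<close> unfolding weakly_cancellative_def by blast
qed

lemma OmD: "v \<in> Om \<Longrightarrow> x \<in> closure (range ((*) v))"
  unfolding Omega_def by blast

text \<open>If v x = 0 then \<open>x\<close> annihilates the dense ideal of \<open>v\<close>, hence
  the whole algebra, and weak cancellativity applies.\<close>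

lemma Om_cancel:
  assumes v: "v \<in> Om" and z: "v * x = 0"
  shows "x = 0"
proof (rule mult_cancel)
  fix y
  have "x * (v * y) = 0" for y
  proof -
    have "x * (v * y) = (v * x) * y" by (simp only: mult_ac)
    then show ?thesis using z by simp
  qed
  then have "range ((*) v) \<subseteq> {y. x * y = 0}" by auto
  then have "closure (range ((*) v)) \<subseteq> {y. x * y = 0}"
    by (intro closure_minimal closed_Collect_eq continuous_intros)
  then show "x * y = 0" using OmD[OF v] by blast
qed

lemma Om_cancel_eq: "v \<in> Om \<Longrightarrow> v * x = v * y \<Longrightarrow> x = y"
  using Om_cancel[of v "x - y"] by (simp add: right_diff_distrib)

lemma Om_cancel_iff: "v \<in> Om \<Longrightarrow> v * x = v * y \<longleftrightarrow> x = y"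
  using Om_cancel_eq by metis

lemma Om_mult:
  assumes v: "v \<in> Om" and q: "q \<in> Om"
  shows "v * q \<in> Om"
proof -
  have "range ((*) v) \<subseteq> closure (range ((*) (v * q)))"
  proof
    fix z assume "z \<in> range ((*) v)"
    then obtain y where z: "z = v * y" by auto
    have "(\<lambda>x. v * x) ` closure (range ((*) q)) \<subseteq> closure (range ((*) (v * q)))"
      by (rule image_closure_subset) (auto intro!: continuous_intros subsetD[OF closure_subset] simp: mult.assoc)
    then show "z \<in> closure (range ((*) (v * q)))" unfolding z using OmD[OF q] by blast
  qed
  then have "closure (range ((*) v)) \<subseteq> closure (range ((*) (v * q)))" by (intro closure_minimal) auto
  then show ?thesis using OmD[OF v] unfolding Omega_def by blast
qed

text \<open>Quotients encoded as graphs obey the equality rule of ordinary fractions. One direction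
  evaluates the graph at the denominator; the other multiplies by both denominators, which may be
  cancelled.\<close>

lemma frac_eq_iff:
  assumes v: "v \<in> Om" and q: "q \<in> Om"
  shows "frac u v = frac p q \<longleftrightarrow> u * q = p * v"
proof
  assume "frac u v = frac p q"
  moreover have "(v, u) \<in> frac u v" unfolding qm_def by (simp add: mult.commute)
  ultimately show "u * q = p * v" unfolding qm_def by (simp add: mult.commute)
next
  assume e: "u * q = p * v"
  have "v * y = u * x \<longleftrightarrow> q * y = p * x" for x y
  proof -
    have "q * (u * x) = (u * q) * x" by (simp only: mult_ac)
    also have "\<dots> = v * (p * x)" unfolding e by (simp only: mult_ac)
    finally have "q * (v * y) = q * (u * x) \<longleftrightarrow> v * (q * y) = v * (p * x)" by (simp only: mult.left_commute)
    then show ?thesis by (simp only: Om_cancel_iff[OF q] Om_cancel_iff[OF v])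
  qed
  then show "frac u v = frac p q" unfolding qm_def by auto
qed

lemma frac_QM: "v \<in> Om \<Longrightarrow> frac u v \<in> QM UNIV (*)"
  unfolding QM_def by blast

lemma QM_cases:
  assumes "S \<in> QM UNIV (*)"
  obtains u v where "v \<in> Om" "S = frac u v"
  using assms unfolding QM_def by blast

text \<open>This and the next two lemmas show that the descriptions defining the operations do not
  depend on the chosen fractions, so one may compute with any representatives.\<close>

lemma qm_add_frac:
  assumes v: "v \<in> Om" and q: "q \<in> Om"
  shows "qm_add UNIV (*) (frac u v) (frac p q) = frac (u * q + p * v) (v * q)"
  unfolding qm_add_def
proof (rule the_equality)
  show "\<exists>u'\<in>UNIV. \<exists>v'\<in>Om. \<exists>u''\<in>UNIV. \<exists>v''\<in>Om. frac u v = frac u' v' \<and> frac p q = frac u'' v'' \<and>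
     frac (u * q + p * v) (v * q) = frac (u' * v'' + u'' * v') (v' * v'')" using assms by blast
  fix R assume "\<exists>u'\<in>UNIV. \<exists>v'\<in>Om. \<exists>u''\<in>UNIV. \<exists>v''\<in>Om. frac u v = frac u' v' \<and> frac p q = frac u'' v'' \<and>
     R = frac (u' * v'' + u'' * v') (v' * v'')"
  then obtain u' v' u'' v'' where v': "v' \<in> Om" "v'' \<in> Om" and e: "frac u v = frac u' v'" "frac p q = frac u'' v''"
    and R: "R = frac (u' * v'' + u'' * v') (v' * v'')" by blast
  have e': "u * v' = u' * v" "p * v'' = u'' * q" using e v q v' by (simp_all add: frac_eq_iff)
  have "(u' * v'' + u'' * v') * (v * q) = (u' * v) * (v'' * q) + (u'' * q) * (v' * v)" by (simp add: algebra_simps)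
  also have "\<dots> = (u * q + p * v) * (v' * v'')" unfolding e'[symmetric] by (simp add: algebra_simps)
  finally show "R = frac (u * q + p * v) (v * q)"
    unfolding R by (subst frac_eq_iff) (auto intro: Om_mult v' v q)
qed

lemma qm_mult_frac:
  assumes v: "v \<in> Om" and q: "q \<in> Om"
  shows "qm_mult UNIV (*) (frac u v) (frac p q) = frac (u * p) (v * q)"
  unfolding qm_mult_def
proof (rule the_equality)
  show "\<exists>u'\<in>UNIV. \<exists>v'\<in>Om. \<exists>u''\<in>UNIV. \<exists>v''\<in>Om. frac u v = frac u' v' \<and> frac p q = frac u'' v'' \<and>
     frac (u * p) (v * q) = frac (u' * u'') (v' * v'')" using assms by blast
  fix R assume "\<exists>u'\<in>UNIV. \<exists>v'\<in>Om. \<exists>u''\<in>UNIV. \<exists>v''\<in>Om. frac u v = frac u' v' \<and> frac p q = frac u'' v'' \<and>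
     R = frac (u' * u'') (v' * v'')"
  then obtain u' v' u'' v'' where v': "v' \<in> Om" "v'' \<in> Om" and e: "frac u v = frac u' v'" "frac p q = frac u'' v''"
    and R: "R = frac (u' * u'') (v' * v'')" by blast
  have e': "u * v' = u' * v" "p * v'' = u'' * q" using e v q v' by (simp_all add: frac_eq_iff)
  have "(u' * u'') * (v * q) = (u' * v) * (u'' * q)" by (simp add: mult_ac)
  also have "\<dots> = (u * p) * (v' * v'')" unfolding e'[symmetric] by (simp add: mult_ac)
  finally show "R = frac (u * p) (v * q)"
    unfolding R by (subst frac_eq_iff) (auto intro: Om_mult v' v q)
qed

lemma qm_scale_frac:
  assumes v: "v \<in> Om"
  shows "qm_scale UNIV (*) c (frac u v) = frac (c *\<^sub>C u) v"
  unfolding qm_scale_def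
proof (rule the_equality)
  show "\<exists>u'\<in>UNIV. \<exists>v'\<in>Om. frac u v = frac u' v' \<and> frac (c *\<^sub>C u) v = frac (c *\<^sub>C u') v'" using assms by blast
  fix R assume "\<exists>u'\<in>UNIV. \<exists>v'\<in>Om. frac u v = frac u' v' \<and> R = frac (c *\<^sub>C u') v'"
  then obtain u' v' where v': "v' \<in> Om" and e: "frac u v = frac u' v'" and R: "R = frac (c *\<^sub>C u') v'" by blast
  have "u * v' = u' * v" using e v v' by (simp add: frac_eq_iff)
  then show "R = frac (c *\<^sub>C u) v"
    unfolding R by (simp add: frac_eq_iff v v' mult_scaleC_left)
qed

lemma qm_one_frac:
  assumes v: "v \<in> Om"
  shows "qm_one UNIV = frac v v"
  unfolding qm_one_def qm_def Id_on_def using Om_cancel_eq[OF v] by auto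

lemma graph_of_mult_frac:
  assumes v: "v \<in> Om"
  shows "graph_of ((*) u) = frac (u * v) v"
proof -
  have "v * y = u * v * x \<longleftrightarrow> y = u * x" for x y
    using Om_cancel_iff[OF v, of y "u * x"] by (simp only: mult_ac)
  then show ?thesis unfolding graph_of_def qm_def by auto
qed

lemma graph_of_multiplier_frac:
  assumes v: "v \<in> Om" and R: "R \<in> multipliers"
  shows "graph_of (blinfun_apply R) = frac (blinfun_apply R v) v"
proof -
  have "v * y = blinfun_apply R v * x \<longleftrightarrow> y = blinfun_apply R x" for x y
    using Om_cancel_iff[OF v, of y "blinfun_apply R x"] by (simp only: multipliers_swap[OF R])
  then show ?thesis unfolding graph_of_def qm_def by auto
qed

end

locale semigroup_normalization = wc_algebra "TYPE('a)" for T :: "real \<Rightarrow> 'a::comm_cbanach_algebra \<Rightarrow>\<^sub>L 'a" +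
  fixes \<iota> :: "'b::comm_cbanach_algebra \<Rightarrow> ('a \<times> 'a) set"
  assumes dense: "dense_principal_ideals (UNIV :: 'a set) (*)"
    and semigroup: "multiplier_semigroup T" and scont: "strongly_continuous T"
    and range_dense: "t > 0 \<Longrightarrow> closure (range (blinfun_apply (T t))) = UNIV"
    and norma: "normalization T \<iota>"
begin

lemma Om_nonempty: "\<exists>v. v \<in> Om"
  using dense unfolding dense_principal_ideals_def by blast

sublocale A: multiplier_flow T
proof
  show "multiplier_semigroup T" "strongly_continuous T" by (rule semigroup scont)+
  show "x = (0::'a)" if "\<And>v. x * v = 0" for x using mult_cancel that by blast
  show "T t \<noteq> 0" if t: "t > 0" for t
  proof
    assume "T t = 0"
    then have "range (blinfun_apply (T t)) = {0}" by auto
    then have "(UNIV :: 'a set) = {0}" using range_dense[OF t] by simp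
    then show False using wc unfolding weakly_cancellative_def by blast
  qed
qed

abbreviation j :: "'a \<Rightarrow> 'b" where "j \<equiv> incl_map \<iota>"

lemma sub: "subalgebra_of_QM \<iota>" and QMj: "QM_hom j"
  and j_norm: "norm (j u) \<le> norm u"
  using norma unfolding normalization_def by blast+

lemma iota_j: "\<iota> (j u) = graph_of ((*) u)"
proof -
  have "graph_of ((*) u) \<in> range \<iota>" using norma unfolding normalization_def by blast
  then obtain b where b: "\<iota> b = graph_of ((*) u)" by auto
  moreover have "b' = b" if "\<iota> b' = graph_of ((*) u)" for b'
    using sub b that unfolding subalgebra_of_QM_def by (metis injD)
  ultimately show ?thesis unfolding incl_map_def by (rule theI)
qed

lemma j_add: "j (x + y) = j x + j y" and j_scale: "j (c *\<^sub>C x) = c *\<^sub>C j x" and j_mult: "j (x * y) = j x * j y"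
  using QMj unfolding QM_hom_def algebra_hom_def by blast+

lemma j_inj: "j x = j y \<longleftrightarrow> x = y"
  using QMj unfolding QM_hom_def inj_def by blast

lemma j_linear: "bounded_linear j"
  using j_add j_scale j_norm
  by (intro bounded_linear_intro[where K = 1]) (simp_all add: scaleC_of_real[symmetric])

lemma j_zero: "j 0 = 0"
  using linear_0[OF bounded_linear.linear[OF j_linear]] .

lemma j_dense: "b \<in> closure (range j)"
  using QMj unfolding QM_hom_def by blast

text \<open>The element \<open>x\<close> is itself a quasimultiplier a/b on the original algebra.
  There the hypothesis reads v b b a = 0, where the first three factors lie in
  \<open>Om\<close>.\<close>

lemma j_cancel:
  assumes v: "v \<in> Om" and z: "j v * x = 0"
  shows "x = 0"
proof -
  have inj: "inj \<iota>" and ran: "range \<iota> \<subseteq> QM UNIV (*)"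
    and sc: "\<And>c x. \<iota> (c *\<^sub>C x) = qm_scale UNIV (*) c (\<iota> x)"
    and mu: "\<And>x y. \<iota> (x * y) = qm_mult UNIV (*) (\<iota> x) (\<iota> y)"
    using sub unfolding subalgebra_of_QM_def by blast+
  have "\<iota> x \<in> QM UNIV (*)" using ran by blast
  then obtain a b where b: "b \<in> Om" and x: "\<iota> x = frac a b" by (rule QM_cases)
  have z0: "0 *\<^sub>C y = 0" for y :: "'v::cbanach" using scaleC_of_real[of 0 y] by simp
  have "\<iota> 0 = frac 0 b" using sc[of 0 x] unfolding x qm_scale_frac[OF b] by (simp add: z0)
  moreover have "\<iota> (j v * x) = frac ((v * b) * a) (b * b)"
    unfolding mu iota_j x graph_of_mult_frac[OF b] by (rule qm_mult_frac[OF b b])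
  ultimately have "frac ((v * b) * a) (b * b) = frac 0 b" using z by simp
  then have "((v * b) * a) * b = 0" using frac_eq_iff[OF Om_mult[OF b b] b] by simp
  then have "((v * b) * b) * a = 0" by (simp add: mult_ac)
  then have "a = 0" by (rule Om_cancel[OF Om_mult[OF Om_mult[OF v b] b]])
  then have "\<iota> x = \<iota> 0" using x \<open>\<iota> 0 = frac 0 b\<close> by simp
  then show ?thesis using inj by (metis injD)
qed

lemma j_cancel_eq: "v \<in> Om \<Longrightarrow> j v * x = j v * y \<Longrightarrow> x = y"
  using j_cancel[of v "x - y"] by (simp add: right_diff_distrib)

lemma j_cancel_iff: "v \<in> Om \<Longrightarrow> j v * x = j v * y \<longleftrightarrow> x = y"
  using j_cancel_eq by metis

lemma B_cancel: "(\<And>y. x * y = 0) \<Longrightarrow> x = (0::'b)"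
  using Om_nonempty j_cancel by (metis mult.commute)

text \<open>A multiplier of the normalization is determined by its value at one \<open>j v\<close>,
  since j(v) R(x) = R(j v) x and \<open>j v\<close> can be cancelled. Operator identities below are
  thereby checked on a single vector.\<close>

lemma multiplier_eqI:
  assumes v: "v \<in> Om" and R: "R \<in> multipliers" and S: "S \<in> multipliers"
    and eq: "blinfun_apply R (j v) = blinfun_apply S (j v)"
  shows "R = S"
proof (rule blinfun_eqI)
  fix x
  have "j v * blinfun_apply R x = j v * blinfun_apply S x"
    by (simp only: multipliers_swap[OF R] multipliers_swap[OF S] eq)
  then show "blinfun_apply R x = blinfun_apply S x" by (rule j_cancel_eq[OF v])
qed

lemma qm_ext_frac:
  assumes v: "v \<in> Om"
  shows "qm_ext j (frac u v) = qm UNIV (*) (j u) (j v)"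
  unfolding qm_ext_def
proof (rule the_equality)
  show "\<exists>u'. \<exists>v'\<in>Om. frac u v = frac u' v' \<and> qm UNIV (*) (j u) (j v) = qm UNIV (*) (j u') (j v')"
    using v by blast
  fix R assume "\<exists>u'. \<exists>v'\<in>Om. frac u v = frac u' v' \<and> R = qm UNIV (*) (j u') (j v')"
  then obtain u' v' where v': "v' \<in> Om" and e: "frac u v = frac u' v'" and R: "R = qm UNIV (*) (j u') (j v')" by blast
  have "u * v' = u' * v" using e v v' by (simp add: frac_eq_iff)
  then have ej: "j u * j v' = j u' * j v" by (simp only: j_mult[symmetric])
  have "j v' * y = j u' * x \<longleftrightarrow> j v * y = j u * x" for x y
  proof -
    have "j v * (j u' * x) = (j u' * j v) * x" by (simp only: mult_ac)
    also have "\<dots> = j v' * (j u * x)" unfolding ej[symmetric] by (simp only: mult_ac)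
    finally have "j v * (j v' * y) = j v * (j u' * x) \<longleftrightarrow> j v' * (j v * y) = j v' * (j u * x)"
      by (simp only: mult.left_commute)
    then show ?thesis by (simp only: j_cancel_iff[OF v] j_cancel_iff[OF v'])
  qed
  then show "R = qm UNIV (*) (j u) (j v)" unfolding R qm_def by auto
qed

text \<open>The identification of the two quasimultiplier algebras comes down to one equation at the
  denominator, which is the form used in the rest of the proof.\<close>

lemma represents_frac_iff:
  assumes v: "v \<in> Om"
  shows "represents \<iota> (frac u v) R \<longleftrightarrow> R \<in> multipliers \<and> blinfun_apply R (j v) = j u"
proof -
  have "qm UNIV (*) (j u) (j v) = graph_of (blinfun_apply R) \<longleftrightarrow> blinfun_apply R (j v) = j u" if R: "R \<in> multipliers"
  proof
    assume "qm UNIV (*) (j u) (j v) = graph_of (blinfun_apply R)"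
    moreover have "(j v, blinfun_apply R (j v)) \<in> graph_of (blinfun_apply R)" unfolding graph_of_def by simp
    ultimately have "j v * blinfun_apply R (j v) = j u * j v" unfolding qm_def by auto
    then have "j v * blinfun_apply R (j v) = j v * j u" by (simp only: mult.commute)
    then show "blinfun_apply R (j v) = j u" by (rule j_cancel_eq[OF v])
  next
    assume e: "blinfun_apply R (j v) = j u"
    have "j v * y = j u * x \<longleftrightarrow> y = blinfun_apply R x" for x y
      using j_cancel_iff[OF v, of y "blinfun_apply R x"] by (simp only: multipliers_swap[OF R] e)
    then show "qm UNIV (*) (j u) (j v) = graph_of (blinfun_apply R)" unfolding qm_def graph_of_def by auto
  qed
  then show ?thesis unfolding represents_def qm_ext_frac[OF v] using frac_QM[OF v] by blast
qed

lemma represents_unique: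
  assumes "represents \<iota> S R" "represents \<iota> S R'"
  shows "R = R'"
proof -
  have "S \<in> QM UNIV (*)" using assms unfolding represents_def by blast
  then obtain u v where v: "v \<in> Om" and S: "S = frac u v" by (rule QM_cases)
  show ?thesis
    using assms represents_frac_iff[OF v] multiplier_eqI[OF v] unfolding S by metis
qed

lemma to_multiplier_eq: "represents \<iota> S R \<Longrightarrow> to_multiplier \<iota> S = R"
  unfolding to_multiplier_def using represents_unique by blast

lemma multiplier_extension:
  assumes R: "R \<in> multipliers"
  obtains R' where "represents \<iota> (graph_of (blinfun_apply R)) R'" "R' \<in> multipliers"
    "\<And>u. blinfun_apply R' (j u) = j (blinfun_apply R u)" "norm R' \<le> norm R"
proof -
  obtain R' where r: "represents \<iota> (graph_of (blinfun_apply R)) R'" "norm R' \<le> norm R"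
    using norma R unfolding normalization_def by blast
  obtain v where v: "v \<in> Om" using Om_nonempty by blast
  have R': "R' \<in> multipliers" and e: "blinfun_apply R' (j v) = j (blinfun_apply R v)"
    using r(1) unfolding graph_of_multiplier_frac[OF v R] represents_frac_iff[OF v] by blast+
  have "blinfun_apply R' (j u) = j (blinfun_apply R u)" for u
  proof (rule j_cancel_eq[OF v])
    have "j v * blinfun_apply R' (j u) = blinfun_apply R' (j v) * j u"
      by (rule multipliers_swap[OF R'])
    also have "\<dots> = j (blinfun_apply R v * u)" by (simp add: e j_mult)
    also have "blinfun_apply R v * u = v * blinfun_apply R u" by (rule multipliers_swap[OF R, symmetric])
    finally show "j v * blinfun_apply R' (j u) = j v * j (blinfun_apply R u)" by (simp add: j_mult)
  qed
  with r R' show thesis by (intro that)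
qed

abbreviation TB :: "real \<Rightarrow> 'b \<Rightarrow>\<^sub>L 'b" where "TB \<equiv> semigroup_on \<iota> T"

lemma TB:
  assumes t: "t > 0"
  shows "TB t \<in> multipliers" "blinfun_apply (TB t) (j u) = j (blinfun_apply (T t) u)" "norm (TB t) \<le> norm (T t)"
proof -
  obtain R' where r: "represents \<iota> (graph_of (blinfun_apply (T t))) R'" "R' \<in> multipliers"
    "\<And>u. blinfun_apply R' (j u) = j (blinfun_apply (T t) u)" "norm R' \<le> norm (T t)"
    by (rule multiplier_extension[OF A.T_mult[OF t]]) blast
  have "TB t = R'" unfolding semigroup_on_def by (rule to_multiplier_eq[OF r(1)])
  then show "TB t \<in> multipliers" "blinfun_apply (TB t) (j u) = j (blinfun_apply (T t) u)" "norm (TB t) \<le> norm (T t)"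
    using r by simp_all
qed

lemma weight_TB_le: "t > 0 \<Longrightarrow> weight TB t \<le> weight T t"
  unfolding weight_def by (rule TB(3))

text \<open>On the dense range of \<open>j\<close> continuity is inherited from \<open>T\<close>.
  The general case follows by a three-term estimate, since the norms of \<open>TB\<close> are
  bounded by those of \<open>T\<close> and hence near each positive time.\<close>

lemma TB_strongly_continuous: "strongly_continuous TB"
  unfolding strongly_continuous_def
proof
  fix b
  show "continuous_on {0<..} (\<lambda>t. blinfun_apply (TB t) b)"
    unfolding continuous_on_iff
  proof (intro ballI allI impI)
    fix t e :: real assume "t \<in> {0<..}" and e: "e > 0"
    then have t: "t > 0" by simp
    obtain K where K: "\<forall>s\<in>{t / 2..2 * t}. weight T s \<le> K"
      using A.weight_fun_T t unfolding weight_fun_def by (meson half_gt_zero)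
    define K' where "K' = max K 1"
    have K': "norm (TB s) \<le> K'" if "t / 2 \<le> s" "s \<le> 2 * t" for s
    proof -
      have "weight TB s \<le> weight T s" using that t by (intro weight_TB_le) simp
      also have "\<dots> \<le> K" using K that by simp
      finally show "norm (TB s) \<le> K'" unfolding K'_def weight_def by simp
    qed
    have K'0: "K' > 0" unfolding K'_def by simp
    have "e / (3 * K') > 0" using e K'0 by simp
    then obtain u where u: "dist (j u) b < e / (3 * K')"
      using j_dense[of b] unfolding closure_approachable by blast
    have "\<forall>e>0. \<exists>d>0. \<forall>s\<in>{0<..}. dist s t < d \<longrightarrow> dist (blinfun_apply (T s) u) (blinfun_apply (T t) u) < e"
      by (rule bspec[OF A.T_cont[of u, unfolded continuous_on_iff]]) (use t in simp)
    then obtain d where d: "d > 0" "\<And>s. s > 0 \<Longrightarrow> dist s t < d \<Longrightarrow> dist (blinfun_apply (T s) u) (blinfun_apply (T t) u) < e / 3"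
      using e by (metis divide_pos_pos greaterThan_iff zero_less_numeral)
    have near: "norm (blinfun_apply (TB s) b - j (blinfun_apply (T s) u)) \<le> e / 3" if s: "t / 2 \<le> s" "s \<le> 2 * t" for s
    proof -
      have s0: "s > 0" using s t by linarith
      have "norm (blinfun_apply (TB s) (b - j u)) \<le> norm (TB s) * norm (b - j u)" by (rule norm_blinfun)
      also have "\<dots> \<le> K' * (e / (3 * K'))"
        using K'[OF s] u K'0 by (intro mult_mono) (auto simp: dist_norm norm_minus_commute less_imp_le)
      also have "\<dots> = e / 3" using K'0 by simp
      finally show ?thesis by (simp add: blinfun.diff_right TB(2)[OF s0])
    qed
    show "\<exists>d>0. \<forall>s\<in>{0<..}. dist s t < d \<longrightarrow> dist (blinfun_apply (TB s) b) (blinfun_apply (TB t) b) < e"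
    proof (intro exI[of _ "min d (t / 2)"] conjI ballI impI)
      show "min d (t / 2) > 0" using d t by simp
      fix s assume "s \<in> {0<..}" and ds: "dist s t < min d (t / 2)"
      then have s0: "s > 0" by simp
      have "\<bar>s - t\<bar> < t / 2" using ds by (simp add: dist_real_def)
      then have s: "t / 2 \<le> s" "s \<le> 2 * t" using t by linarith+
      have "norm (j (blinfun_apply (T s) u) - j (blinfun_apply (T t) u)) = norm (j (blinfun_apply (T s) u - blinfun_apply (T t) u))"
        by (simp add: linear_diff[OF bounded_linear.linear[OF j_linear]])
      also have "\<dots> \<le> norm (blinfun_apply (T s) u - blinfun_apply (T t) u)" by (rule j_norm)
      also have "\<dots> < e / 3" using d(2)[OF s0] ds by (simp add: dist_norm)
      finally have m: "norm (j (blinfun_apply (T s) u) - j (blinfun_apply (T t) u)) < e / 3" .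
      have "norm (blinfun_apply (TB s) b - blinfun_apply (TB t) b) \<le>
        norm (blinfun_apply (TB s) b - j (blinfun_apply (T s) u)) +
        norm (j (blinfun_apply (T s) u) - j (blinfun_apply (T t) u)) +
        norm (blinfun_apply (TB t) b - j (blinfun_apply (T t) u))"
        by norm
      also have "\<dots> < e / 3 + e / 3 + e / 3"
        using near[OF s] near[of t] m t by (intro add_less_le_mono add_le_less_mono) auto
      finally show "dist (blinfun_apply (TB s) b) (blinfun_apply (TB t) b) < e" by (simp add: dist_norm)
    qed
  qed
qed

text \<open>The convolution calculus and the ideal properties hence apply to the induced semigroup
  as well.\<close>

sublocale B: multiplier_flow TB
proof
  obtain v where v: "v \<in> Om" using Om_nonempty by blast
  show "multiplier_semigroup TB"
    unfolding multiplier_semigroup_def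
  proof (intro conjI allI impI)
    show "TB t \<in> multipliers" if "t > 0" for t by (rule TB(1)[OF that])
    fix s t :: real assume st: "s > 0" "t > 0"
    show "TB (s + t) = TB s o\<^sub>L TB t"
      using st by (intro multiplier_eqI[OF v] multipliers_compose TB(1)) (auto simp: TB(2) A.T_add)
  qed
  show "strongly_continuous TB" by (rule TB_strongly_continuous)
  show "TB t \<noteq> 0" if t: "t > 0" for t
  proof
    assume "TB t = 0"
    then have "j (blinfun_apply (T t) u) = j 0" for u using TB(2)[OF t, of u] by (simp add: j_zero)
    then have "T t = 0" by (intro blinfun_eqI) (simp add: j_inj)
    then show False using A.nonzero[OF t] by blast
  qed
  show "x = (0::'b)" if "\<And>v. x * v = 0" for x by (rule B_cancel[OF that])
qed

lemma L1w_TB: "f \<in> L1w (weight T) \<Longrightarrow> f \<in> L1w (weight TB)"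
  by (rule L1w_mono[OF _ weight_TB_le])

lemma Phi_TB_j:
  assumes f: "f \<in> L1w (weight T)"
  shows "blinfun_apply (Phi TB f) (j u) = j (blinfun_apply (Phi T f) u)"
proof (rule B.Phi_unique[OF L1w_TB[OF f]])
  have "has_Bochner_integral half_line (\<lambda>t. j (f t *\<^sub>C blinfun_apply (T t) u)) (j (blinfun_apply (Phi T f) u))"
    by (rule has_Bochner_integral_bounded_linear[OF A.Phi_has_integral[OF f] j_linear])
  then show "has_Bochner_integral half_line (\<lambda>t. f t *\<^sub>C blinfun_apply (TB t) (j u)) (j (blinfun_apply (Phi T f) u))"
    by (rule has_Bochner_integral_half_line_cong) (simp add: j_scale TB(2))
qed

text \<open>The extension of \<Phi>(f) from the original algebra does not increase the norm, and it
  agrees with the integral formed on the normalization. The strict inequality behind the norm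
  criterion thus carries over.\<close>

lemma norm_Phi_TB_le:
  assumes f: "f \<in> L1w (weight T)"
  shows "norm (Phi TB f) \<le> norm (Phi T f)"
proof -
  obtain v where v: "v \<in> Om" using Om_nonempty by blast
  obtain R' where r: "R' \<in> multipliers"
    "\<And>u. blinfun_apply R' (j u) = j (blinfun_apply (Phi T f) u)" "norm R' \<le> norm (Phi T f)"
    by (rule multiplier_extension[OF A.Phi_multipliers[OF f]]) blast
  have "Phi TB f = R'"
    by (rule multiplier_eqI[OF v B.Phi_multipliers[OF L1w_TB[OF f]] r(1)]) (simp add: r(2) Phi_TB_j[OF f])
  then show ?thesis using r(3) by simp
qed

text \<open>The limsup condition of the normalization controls times near 0, local boundedness the
  remaining interval.\<close>

lemma TB_bounded_near_zero: "\<exists>M. \<forall>t. 0 < t \<and> t \<le> b \<longrightarrow> weight TB t \<le> M"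
proof -
  have "Limsup (at_right 0) (\<lambda>t. ereal (norm (TB t))) < \<infinity>" using norma unfolding normalization_def by blast
  then obtain C where "Limsup (at_right 0) (\<lambda>t. ereal (norm (TB t))) < ereal C"
    using less_PInf_Ex_of_nat[of "Limsup (at_right 0) (\<lambda>t. ereal (norm (TB t)))"] by auto
  then have "\<forall>\<^sub>F t in at_right 0. ereal (norm (TB t)) < ereal C" by (rule Limsup_lessD)
  then obtain d where d: "d > 0" "\<And>t. 0 < t \<Longrightarrow> t < d \<Longrightarrow> norm (TB t) < C"
    unfolding eventually_at_right_field by auto
  obtain K where K: "\<forall>t\<in>{d / 2..b}. weight TB t \<le> K"
    using B.weight_fun_T d(1) unfolding weight_fun_def by (meson half_gt_zero)
  have "weight TB t \<le> max C K" if t: "0 < t" "t \<le> b" for t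
  proof (cases "t < d")
    case True
    then show ?thesis using d(2)[OF t(1)] unfolding weight_def by simp
  next
    case False
    then show ?thesis using K t d(1) by (simp add: le_max_iff_disj)
  qed
  then show ?thesis by blast
qed

text \<open>The map \<open>G\<close> sends \<open>b\<close> to the preimage of j(w) b under
  \<open>j\<close>. It is bounded by the closed graph theorem and lets norms be carried back from
  the normalization to the original algebra.\<close>

lemma ideal_witness:
  obtains w G where "w \<in> Om" "bounded_linear G" "\<And>b. j (G b) = j w * b"
proof -
  obtain w where w: "w \<in> Om" "range (\<lambda>b. j w * b) \<subseteq> range j"
    using QMj unfolding QM_hom_def by blast
  then have "\<forall>b. \<exists>a. j a = j w * b" by (metis rangeE rangeI subsetD)
  then obtain G where G: "\<And>b. j (G b) = j w * b" by metis
  have jd: "j (r *\<^sub>R x) = r *\<^sub>R j x" for r x by (simp add: scaleC_of_real[symmetric] j_scale)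
  have "linear G"
  proof (rule linearI)
    show "G (x + y) = G x + G y" for x y
      using j_inj by (metis G j_add distrib_left)
    show "G (r *\<^sub>R x) = r *\<^sub>R G x" for r x
      using j_inj by (metis G jd mult_scaleR_right)
  qed
  then have Gb: "bounded_linear G"
  proof (rule closed_graph)
    fix X x y assume X: "X \<longlonglongrightarrow> x" and GX: "(\<lambda>n. G (X n)) \<longlonglongrightarrow> y"
    have "(\<lambda>n. j (G (X n))) \<longlonglongrightarrow> j y" by (rule bounded_linear.tendsto[OF j_linear GX])
    moreover have "(\<lambda>n. j (G (X n))) \<longlonglongrightarrow> j w * x" unfolding G by (intro tendsto_intros X)
    ultimately have "j y = j w * x" by (rule LIMSEQ_unique)
    then show "G x = y" using G[of x] j_inj by metis
  qed
  show thesis by (rule that[OF w(1) Gb G])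
qed

text \<open>The fraction with denominator q = w w and numerator G(R(j w)) represents
  \<open>R\<close>. At \<open>q\<close> its n-th power takes the value G(R^n(j w)), whose norm is at
  most a constant times the n-th power of the norm of \<open>R\<close>; so \<open>q\<close>
  witnesses pseudoboundedness.\<close>

lemma multiplier_represented:
  assumes R: "R \<in> multipliers"
  shows "\<exists>S\<in>QM_reg UNIV (*). represents \<iota> S R"
proof -
  obtain w G where w: "w \<in> Om" and G: "bounded_linear G" "\<And>b. j (G b) = j w * b"
    by (rule ideal_witness) blast
  define a q where "a = G (blinfun_apply R (j w))" and "q = w * w"
  have q: "q \<in> Om" unfolding q_def by (rule Om_mult[OF w w])
  have Rq: "blinfun_apply R (j q) = j a" unfolding a_def q_def G j_mult by (rule multipliersD(3)[OF R])
  define S where "S = frac a q"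
  have rep: "represents \<iota> S R" unfolding S_def represents_frac_iff[OF q] using R Rq by blast
  \<comment> \<open>The denominators change with \<open>n\<close>. What the induction keeps is that
    the fraction p/s corresponds to the n-th iterate of \<open>R\<close>.\<close>
  have pow: "\<exists>p s. s \<in> Om \<and> qm_power UNIV (*) S n = frac p s \<and> (blinfun_apply R ^^ n) (j s) = j p" for n
  proof (induction n)
    case 0
    show ?case unfolding qm_power_def using qm_one_frac[OF w] w by auto
  next
    case (Suc n)
    then obtain p s where s: "s \<in> Om" "qm_power UNIV (*) S n = frac p s" "(blinfun_apply R ^^ n) (j s) = j p" by blast
    have "qm_power UNIV (*) S (Suc n) = qm_mult UNIV (*) S (qm_power UNIV (*) S n)" unfolding qm_power_def by simp
    also have "\<dots> = frac (a * p) (q * s)" unfolding s(2) by (subst S_def) (rule qm_mult_frac[OF q s(1)])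
    finally have "qm_power UNIV (*) S (Suc n) = frac (a * p) (q * s)" .
    moreover have "(blinfun_apply R ^^ Suc n) (j (q * s)) = j (a * p)"
      by (simp add: j_mult multiplier_power(2)[OF R] s(3) multipliersD(2)[OF R] Rq)
    ultimately show ?case using Om_mult[OF q s(1)] by blast
  qed
  \<comment> \<open>Makes r times the norm of \<open>R\<close> at most 1; the added 1 covers R =
    0.\<close>
  define r where "r = 1 / (norm R + 1)"
  have nR: "norm R + 1 > 0" by (simp add: add_nonneg_pos)
  have r: "r > 0" "r * norm R \<le> 1" unfolding r_def using nR by (simp_all add: field_simps)
  define V where "V = {qm_scale UNIV (*) (complex_of_real (r ^ n)) (qm_power UNIV (*) S n) | n. n \<ge> 1}"
  define c where "c n = complex_of_real (r ^ n)" for n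
  have elem: "S' \<in> QM UNIV (*)" "(q, y) \<in> S' \<longleftrightarrow> y = c n *\<^sub>C G ((blinfun_apply R ^^ n) (j w))"
    if S': "S' = qm_scale UNIV (*) (c n) (qm_power UNIV (*) S n)" for S' n y
  proof -
    obtain p s where s: "s \<in> Om" "qm_power UNIV (*) S n = frac p s" "(blinfun_apply R ^^ n) (j s) = j p" using pow by blast
    have S'': "S' = frac (c n *\<^sub>C p) s" unfolding S' s(2) by (rule qm_scale_frac[OF s(1)])
    show "(q, y) \<in> S' \<longleftrightarrow> y = c n *\<^sub>C G ((blinfun_apply R ^^ n) (j w))"
    proof -
      \<comment> \<open>The single vector \<open>q\<close> lies in the domain of all powers, because
        j(w) R^n(j w) = R^n(j q) belongs to the range of \<open>j\<close> with preimage under the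
        control of \<open>G\<close>.\<close>
      have e: "j s * j (G ((blinfun_apply R ^^ n) (j w))) = j p * j q"
        unfolding G q_def j_mult s(3)[symmetric]
        by (simp add: multiplier_power[OF R, symmetric] mult_ac)
      have "(q, y) \<in> S' \<longleftrightarrow> s * y = (c n *\<^sub>C p) * q" unfolding S'' qm_def by simp
      also have "\<dots> \<longleftrightarrow> j s * j y = c n *\<^sub>C (j p * j q)"
        by (simp add: j_inj[symmetric] j_mult j_scale mult_scaleC_left)
      also have "\<dots> \<longleftrightarrow> j s * j y = j s * j (c n *\<^sub>C G ((blinfun_apply R ^^ n) (j w)))"
        unfolding e[symmetric] by (simp add: j_scale mult_scaleC_right)
      also have "\<dots> \<longleftrightarrow> j y = j (c n *\<^sub>C G ((blinfun_apply R ^^ n) (j w)))" by (rule j_cancel_iff[OF s(1)])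
      finally show ?thesis by (simp add: j_inj)
    qed
    show "S' \<in> QM UNIV (*)" unfolding S'' by (rule frac_QM[OF s(1)])
  qed
  obtain K where K: "K > 0" "\<And>x. norm (G x) \<le> norm x * K" using bounded_linear.pos_bounded[OF G(1)] by blast
  have bd: "norm (c n *\<^sub>C G ((blinfun_apply R ^^ n) (j w))) \<le> norm (j w) * K" for n
  proof -
    have "norm (c n *\<^sub>C G ((blinfun_apply R ^^ n) (j w))) \<le> r ^ n * (norm ((blinfun_apply R ^^ n) (j w)) * K)"
      unfolding norm_scaleC c_def using r(1) by (simp add: norm_power K(2))
    also have "\<dots> \<le> r ^ n * ((norm R ^ n * norm (j w)) * K)"
      using r(1) K(1) by (intro mult_left_mono mult_right_mono norm_power_le) auto
    also have "\<dots> = (r * norm R) ^ n * (norm (j w) * K)" by (simp add: power_mult_distrib)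
    also have "\<dots> \<le> 1 * (norm (j w) * K)"
      using r K(1) by (intro mult_right_mono power_le_one) auto
    finally show ?thesis by simp
  qed
  have Vc: "S' \<in> V \<longleftrightarrow> (\<exists>n\<ge>1. S' = qm_scale UNIV (*) (c n) (qm_power UNIV (*) S n))" for S'
    unfolding V_def c_def by blast
  have "pseudobounded UNIV (*) V"
    unfolding pseudobounded_def
  proof (intro conjI bexI[of _ q] ballI)
    show "V \<subseteq> QM UNIV (*)" using elem(1) Vc by auto
    show "q \<in> Domain S'" if SV: "S' \<in> V" for S'
    proof -
      obtain n where "S' = qm_scale UNIV (*) (c n) (qm_power UNIV (*) S n)" using Vc[THEN iffD1, OF SV] by auto
      then have "(q, c n *\<^sub>C G ((blinfun_apply R ^^ n) (j w))) \<in> S'" by (rule elem(2)[THEN iffD2]) simp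
      then show ?thesis by (rule DomainI)
    qed
    have "norm y \<le> norm (j w) * K" if SV: "S' \<in> V" and qy: "(q, y) \<in> S'" for S' y
    proof -
      obtain n where "S' = qm_scale UNIV (*) (c n) (qm_power UNIV (*) S n)" using Vc[THEN iffD1, OF SV] by auto
      then have "y = c n *\<^sub>C G ((blinfun_apply R ^^ n) (j w))" by (rule elem(2)[THEN iffD1]) (rule qy)
      then show ?thesis using bd[of n] by (simp only:)
    qed
    then show "bounded {y. \<exists>S'\<in>V. (q, y) \<in> S'}" unfolding bounded_iff by blast
  qed (rule q)
  moreover have "S \<in> QM UNIV (*)" unfolding S_def by (rule frac_QM[OF q])
  ultimately have "S \<in> QM_reg UNIV (*)" unfolding QM_reg_def V_def using r(1) by blast
  with rep show ?thesis by blast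
qed

end

section \<open>The resolvent\<close>

lemma integrable_half_line_bounded:
  fixes k :: "real \<Rightarrow> complex"
  assumes k: "k \<in> borel_measurable half_line"
    and le: "\<And>s. s > 0 \<Longrightarrow> cmod (k s) \<le> K * indicat_real {..r} s"
  shows "integrable half_line k"
proof (rule integrableI_bounded[OF k])
  have "(\<integral>\<^sup>+ s. ennreal (cmod (k s)) \<partial>half_line) \<le> (\<integral>\<^sup>+ s. ennreal \<bar>K\<bar> * indicator {..r} s \<partial>half_line)"
  proof (rule nn_integral_mono)
    fix s assume "s \<in> space half_line"
    then have "cmod (k s) \<le> K * indicat_real {..r} s" using le by simp
    then show "ennreal (cmod (k s)) \<le> ennreal \<bar>K\<bar> * indicator {..r} s"
      by (auto simp: indicator_def intro!: ennreal_leI split: if_splits)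
  qed
  also have "\<dots> = ennreal \<bar>K\<bar> * (\<integral>\<^sup>+ s. indicator {..r} s \<partial>half_line)"
    by (intro nn_integral_cmult half_line_measurable_lborel) simp
  also have "\<dots> \<le> ennreal \<bar>K\<bar> * ennreal \<bar>r\<bar>" by (intro mult_left_mono nn_integral_half_line_atMost) simp
  also have "\<dots> < \<infinity>" by (simp add: ennreal_mult_less_top)
  finally show "(\<integral>\<^sup>+ s. ennreal (cmod (k s)) \<partial>half_line) < \<infinity>" .
qed

lemma nn_integral_exp_half_line:
  assumes d: "d > 0"
  shows "(\<integral>\<^sup>+ t. ennreal (exp (- d * t)) \<partial>half_line) < \<infinity>"
proof -
  have "(\<integral>\<^sup>+ t. ennreal (exp (- d * t)) \<partial>half_line) \<le> (\<integral>\<^sup>+ t. ennreal (exp (- d * t)) * indicator {0..} t \<partial>lborel)"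
    unfolding nn_integral_half_line by (intro nn_integral_mono) (auto simp: indicator_def)
  also have "\<dots> = ennreal (0 - (- exp (- d * 0) / d))"
  proof (rule nn_integral_FTC_atLeast)
    have "filterlim (\<lambda>t. - d * t) at_bot at_top"
      by (rule filterlim_tendsto_neg_mult_at_bot[OF tendsto_const _ filterlim_ident]) (use d in simp)
    then have "((\<lambda>t. exp (- d * t)) \<longlongrightarrow> 0) at_top" by (rule filterlim_compose[OF exp_at_bot])
    then have "((\<lambda>t. - exp (- d * t) / d) \<longlongrightarrow> - 0 / d) at_top" using d by (intro tendsto_intros) auto
    then show "((\<lambda>t. - exp (- d * t) / d) \<longlongrightarrow> 0) at_top" by simp
    show "((\<lambda>t. - exp (- d * t) / d) has_real_derivative exp (- d * x)) (at x)" for x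
      using d by (auto intro!: derivative_eq_intros)
  qed auto
  also have "\<dots> < \<infinity>" by simp
  finally show ?thesis .
qed

lemma cmod_exp_kernel: "cmod (exp_kernel \<mu> t) = exp (- Re \<mu> * t)"
  unfolding exp_kernel_def by (simp add: norm_exp_eq_Re)

context semigroup_normalization begin

text \<open>The closed principal ideal of \<Phi>(f0) u0 contains the range of \<Phi>(f0), then the
  range of every \<Phi>(g) by density inside the Arveson ideal, then the range of T(1) by averaging,
  which is dense.\<close>

lemma Phi_generating_Om:
  assumes f: "generating_function T f\<^sub>0" and u: "u\<^sub>0 \<in> Om"
  shows "blinfun_apply (Phi T f\<^sub>0) u\<^sub>0 \<in> Om"
proof -
  let ?P = "Phi T f\<^sub>0"
  have P: "?P \<in> multipliers" by (rule A.Phi_multipliers[OF A.generating_functionD(3)[OF f]])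
  let ?N = "closure (range ((*) (blinfun_apply ?P u\<^sub>0)))"
  have "blinfun_apply ?P x \<in> ?N" for x
  proof -
    have "blinfun_apply ?P ` closure (range ((*) u\<^sub>0)) \<subseteq> ?N"
      by (rule image_closure_subset)
        (auto intro!: continuous_intros subsetD[OF closure_subset] simp: multipliersD(2)[OF P])
    then show ?thesis using OmD[OF u] by blast
  qed
  then have PN: "range (blinfun_apply ?P) \<subseteq> ?N" by blast
  have Phi: "blinfun_apply (Phi T g) x \<in> ?N" if g: "g \<in> L1w (weight T)" for g x
  proof -
    have "Phi T g \<in> closure (blinfun_compose ?P ` arveson_ideal T)"
      using A.Phi_generating_Omega[OF f] A.Phi_in_ideal[OF g] unfolding Omega_def by blast
    then obtain X where X: "\<And>n::nat. X n \<in> blinfun_compose ?P ` arveson_ideal T" "X \<longlonglongrightarrow> Phi T g"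
      unfolding closure_sequential by blast
    have "(\<lambda>n. blinfun_apply (X n) x) \<longlonglongrightarrow> blinfun_apply (Phi T g) x" by (intro tendsto_intros X)
    moreover have "blinfun_apply (X n) x \<in> ?N" for n using X(1)[of n] PN by auto
    ultimately show ?thesis by (rule closed_sequentially[OF closed_closure, rotated])
  qed
  have TN: "range (blinfun_apply (T 1)) \<subseteq> ?N"
  proof
    fix z assume "z \<in> range (blinfun_apply (T 1))"
    then obtain x where z: "z = blinfun_apply (T 1) x" by auto
    have "closure {blinfun_apply (Phi T q) x | q. q \<in> L1w (weight T)} \<subseteq> ?N"
      using Phi by (intro closure_minimal) auto
    then show "z \<in> ?N" unfolding z using A.Phi_approximates_T[of 1 x] by auto
  qed
  have "closure (range (blinfun_apply (T 1))) \<subseteq> ?N" using TN by (intro closure_minimal) auto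
  then show ?thesis using range_dense[of 1] unfolding Omega_def by auto
qed

text \<open>\<open>X\<close> is not known to lie in \<open>Om\<close>, so v/X cannot be written down
  as the inverse. Instead \<open>R\<close> is represented by a fraction a/q, and the hypothesis
  becomes X a = v q, which says that a/q inverts X/v.\<close>

lemma inverse_represented:
  assumes v: "v \<in> Om" and R: "R \<in> multipliers" and e: "blinfun_apply R (j X) = j v"
  shows "qm_invertible UNIV (*) (frac X v) \<and> represents \<iota> (qm_inverse UNIV (*) (frac X v)) R"
proof -
  obtain S where S: "S \<in> QM UNIV (*)" "represents \<iota> S R" using multiplier_represented[OF R] unfolding QM_reg_def by blast
  obtain a q where q: "q \<in> Om" and Sf: "S = frac a q" using S(1) by (rule QM_cases)
  have Rq: "blinfun_apply R (j q) = j a" using S(2) unfolding Sf represents_frac_iff[OF q] by blast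
  have "j (X * a) = blinfun_apply R (j X) * j q"
    using multipliers_swap[OF R, of "j X" "j q"] Rq by (simp add: j_mult)
  then have Xa: "X * a = v * q" unfolding e by (simp add: j_mult[symmetric] j_inj)
  have one: "qm_mult UNIV (*) (frac X v) (frac a q) = qm_one UNIV"
    unfolding qm_mult_frac[OF v q] Xa by (rule qm_one_frac[OF Om_mult[OF v q], symmetric])
  have uniq: "W = frac a q" if W: "W \<in> QM UNIV (*)" "qm_mult UNIV (*) (frac X v) W = qm_one UNIV" for W
  proof -
    obtain p s where s: "s \<in> Om" and Wf: "W = frac p s" using W(1) by (rule QM_cases)
    note vs = Om_mult[OF v s]
    have "frac (X * p) (v * s) = frac (v * s) (v * s)"
      using W(2) unfolding Wf qm_mult_frac[OF v s] qm_one_frac[OF vs] .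
    then have "(X * p) * (v * s) = (v * s) * (v * s)" using frac_eq_iff[OF vs vs] by blast
    then have "(v * s) * (X * p) = (v * s) * (v * s)" by (simp only: mult.commute)
    then have Xp: "X * p = v * s" by (rule Om_cancel_eq[OF vs])
    have "(v * q) * (p * q) = (X * p) * (a * q)" unfolding Xa[symmetric] by (simp only: mult_ac)
    also have "\<dots> = (v * q) * (a * s)" unfolding Xp by (simp only: mult_ac)
    finally have "p * q = a * s" by (rule Om_cancel_eq[OF Om_mult[OF v q]])
    then show ?thesis unfolding Wf using frac_eq_iff[OF s q] by blast
  qed
  have "qm_inverse UNIV (*) (frac X v) = frac a q"
    unfolding qm_inverse_def by (rule the_equality) (use one uniq frac_QM[OF q] in blast)+
  moreover have "qm_invertible UNIV (*) (frac X v)"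
    unfolding qm_invertible_def using frac_QM[OF v] frac_QM[OF q] one by blast
  ultimately show ?thesis using S(2) Sf by simp
qed

text \<open>For large times \<omega>(t) \<le> \<rho>^t with ln \<rho> < Re \<mu> leaves an
  exponentially decaying factor. Near 0 the bound on the normalization is needed, which is why the
  weight is that of \<open>TB\<close>.\<close>

lemma exp_kernel_L1w:
  assumes s: "ereal_log (growth_rate T) < ereal (Re \<mu>)"
  shows "exp_kernel \<mu> \<in> L1w (weight TB)"
proof -
  obtain \<rho> t0 where r: "\<rho> > 0" "t0 > 0" "ln \<rho> < Re \<mu>" "\<And>t. t \<ge> t0 \<Longrightarrow> weight T t \<le> \<rho> powr t"
    using A.growth_bound[OF s] by blast
  obtain M where M: "\<And>t. 0 < t \<Longrightarrow> t \<le> t0 \<Longrightarrow> weight TB t \<le> M" using TB_bounded_near_zero by blast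
  define d where "d = Re \<mu> - ln \<rho>"
  have d: "d > 0" unfolding d_def using r by simp
  \<comment> \<open>The 1 serves times beyond \<open>t0\<close>, where the growth bound cancels
    exp(-t ln \<rho>); the other term serves times up to \<open>t0\<close>.\<close>
  define C where "C = max 1 (\<bar>M\<bar> * exp (\<bar>ln \<rho>\<bar> * t0))"
  have C: "C \<ge> 0" unfolding C_def by simp
  have le: "cmod (exp_kernel \<mu> t) * weight TB t \<le> C * exp (- d * t)" if t: "t > 0" for t
  proof -
    have ex: "exp (- Re \<mu> * t) = exp (- d * t) * exp (- ln \<rho> * t)"
      unfolding d_def by (simp add: exp_add[symmetric] algebra_simps)
    have "exp (- ln \<rho> * t) * weight TB t \<le> C"
    proof (cases "t \<le> t0")
      case True
      have "exp (- ln \<rho> * t) \<le> exp (\<bar>ln \<rho>\<bar> * t0)"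
      proof -
        have "- ln \<rho> * t \<le> \<bar>ln \<rho>\<bar> * t0" by (intro mult_mono) (use True t in auto)
        then show ?thesis by simp
      qed
      then have "exp (- ln \<rho> * t) * weight TB t \<le> exp (\<bar>ln \<rho>\<bar> * t0) * \<bar>M\<bar>"
        using M[OF t True] B.weight_nonneg by (intro mult_mono) auto
      then show ?thesis unfolding C_def by (simp add: mult.commute)
    next
      case False
      then have "weight TB t \<le> \<rho> powr t" using r(4)[of t] weight_TB_le[OF t] by simp
      also have "\<dots> = exp (ln \<rho> * t)" using r(1) by (simp add: powr_def mult.commute)
      finally have "exp (- ln \<rho> * t) * weight TB t \<le> exp (- ln \<rho> * t) * exp (ln \<rho> * t)" by (rule mult_left_mono) simp
      also have "\<dots> = 1" by (simp add: exp_add[symmetric])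
      finally show ?thesis unfolding C_def by simp
    qed
    then have "exp (- d * t) * (exp (- ln \<rho> * t) * weight TB t) \<le> exp (- d * t) * C" by (rule mult_left_mono) simp
    then show ?thesis unfolding cmod_exp_kernel ex by (simp add: mult_ac)
  qed
  have "(\<integral>\<^sup>+ t. ennreal (cmod (exp_kernel \<mu> t) * weight TB t) \<partial>half_line) \<le> (\<integral>\<^sup>+ t. ennreal C * ennreal (exp (- d * t)) \<partial>half_line)"
    using le C by (intro nn_integral_mono) (simp add: ennreal_leI flip: ennreal_mult')
  also have "\<dots> = ennreal C * (\<integral>\<^sup>+ t. ennreal (exp (- d * t)) \<partial>half_line)"
    by (intro nn_integral_cmult half_line_measurable_lborel) measurable
  also have "\<dots> < \<infinity>" using nn_integral_exp_half_line[OF d] by (simp add: ennreal_mult_less_top)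
  finally show ?thesis unfolding L1w_def using exp_kernel_measurable by blast
qed

section \<open>Construction of the resolvent on the normalization\<close>

context
  fixes f\<^sub>0 u\<^sub>0
  assumes gen: "generating_function T f\<^sub>0" and u0: "u\<^sub>0 \<in> Om"
begin

abbreviation "v\<^sub>0 \<equiv> blinfun_apply (Phi T f\<^sub>0) u\<^sub>0"
abbreviation "w\<^sub>0 \<equiv> blinfun_apply (Phi T (deriv_ray f\<^sub>0)) u\<^sub>0"

lemma v0: "v\<^sub>0 \<in> Om"
  by (rule Phi_generating_Om[OF gen u0])

lemma qm_resolvend_generator:
  "qm_resolvend UNIV (*) \<mu> (generator T f\<^sub>0 u\<^sub>0) = frac (\<mu> *\<^sub>C v\<^sub>0 + w\<^sub>0) v\<^sub>0"
proof -
  have m: "(- 1) *\<^sub>C (- w\<^sub>0) = w\<^sub>0" unfolding scaleC_minus1 by simp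
  have "qm_resolvend UNIV (*) \<mu> (generator T f\<^sub>0 u\<^sub>0) = frac ((\<mu> *\<^sub>C v\<^sub>0) * v\<^sub>0 + w\<^sub>0 * v\<^sub>0) (v\<^sub>0 * v\<^sub>0)"
    unfolding qm_resolvend_def generator_def qm_one_frac[OF v0] qm_scale_frac[OF v0] m qm_add_frac[OF v0 v0] ..
  also have "\<dots> = frac (\<mu> *\<^sub>C v\<^sub>0 + w\<^sub>0) v\<^sub>0"
    unfolding frac_eq_iff[OF Om_mult[OF v0 v0] v0] by (simp add: algebra_simps)
  finally show ?thesis .
qed

lemma resolvend_j: "blinfun_apply (Phi TB (resolvend_fun f\<^sub>0 \<mu>)) (j u\<^sub>0) = j (\<mu> *\<^sub>C v\<^sub>0 + w\<^sub>0)"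
  unfolding Phi_TB_j[OF A.generating_functionD(5)[OF gen]] A.generating_functionD(6)[OF gen]
  by (simp add: blinfun.add_left scaleC_blinfun.rep_eq)

text \<open>Testing \<open>R (\<mu> - \<Delta>) = 1\<close> on a single element suffices, since multipliers agreeing there coincide.\<close>

definition is_resolvent :: "complex \<Rightarrow> ('b \<Rightarrow>\<^sub>L 'b) \<Rightarrow> bool" where
  "is_resolvent \<mu> R \<longleftrightarrow> R \<in> arveson_ideal TB \<and> blinfun_apply R (j (\<mu> *\<^sub>C v\<^sub>0 + w\<^sub>0)) = j v\<^sub>0"

lemma resolvent_represents:
  assumes "is_resolvent \<mu> R"
  shows "qm_invertible UNIV (*) (qm_resolvend UNIV (*) \<mu> (generator T f\<^sub>0 u\<^sub>0))"
    "represents \<iota> (qm_inverse UNIV (*) (qm_resolvend UNIV (*) \<mu> (generator T f\<^sub>0 u\<^sub>0))) R"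
    "to_multiplier \<iota> (qm_inverse UNIV (*) (qm_resolvend UNIV (*) \<mu> (generator T f\<^sub>0 u\<^sub>0))) = R"
proof -
  have R: "R \<in> multipliers" "blinfun_apply R (j (\<mu> *\<^sub>C v\<^sub>0 + w\<^sub>0)) = j v\<^sub>0"
    using assms B.ideal_multipliers unfolding is_resolvent_def by blast+
  show "qm_invertible UNIV (*) (qm_resolvend UNIV (*) \<mu> (generator T f\<^sub>0 u\<^sub>0))"
    and r: "represents \<iota> (qm_inverse UNIV (*) (qm_resolvend UNIV (*) \<mu> (generator T f\<^sub>0 u\<^sub>0))) R"
    unfolding qm_resolvend_generator using inverse_represented[OF v0 R] by blast+
  show "to_multiplier \<iota> (qm_inverse UNIV (*) (qm_resolvend UNIV (*) \<mu> (generator T f\<^sub>0 u\<^sub>0))) = R"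
    by (rule to_multiplier_eq[OF r])
qed

text \<open>Here the exponential itself belongs to the weighted space, so g * e = f0 can be passed
  through \<Phi> directly.\<close>

lemma exp_resolvent:
  assumes s: "ereal_log (growth_rate T) < ereal (Re \<mu>)"
  shows "is_resolvent \<mu> (Phi TB (exp_kernel \<mu>))"
proof -
  note g = A.generating_functionD[OF gen]
  note E = exp_kernel_L1w[OF s]
  note gB = L1w_TB[OF g(5)[of \<mu>]]
  have "Phi TB (convol (resolvend_fun f\<^sub>0 \<mu>) (exp_kernel \<mu>)) = Phi TB f\<^sub>0"
    by (rule B.Phi_cong[OF L1w_convol[OF B.weight_fun_T gB E] L1w_TB[OF g(3)]])
      (simp add: convol_resolvend_exp[OF g(1,2)])
  then have "Phi TB (resolvend_fun f\<^sub>0 \<mu>) o\<^sub>L Phi TB (exp_kernel \<mu>) = Phi TB f\<^sub>0"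
    by (simp add: B.Phi_convol[OF gB E])
  then have "Phi TB (exp_kernel \<mu>) o\<^sub>L Phi TB (resolvend_fun f\<^sub>0 \<mu>) = Phi TB f\<^sub>0"
    by (simp add: B.multipliers_commute[OF B.Phi_multipliers[OF E] B.Phi_multipliers[OF gB]])
  then have "blinfun_apply (Phi TB (exp_kernel \<mu>)) (blinfun_apply (Phi TB (resolvend_fun f\<^sub>0 \<mu>)) (j u\<^sub>0)) = j v\<^sub>0"
    by (metis blinfun_apply_blinfun_compose Phi_TB_j[OF g(3)])
  then show ?thesis unfolding is_resolvent_def resolvend_j using B.Phi_in_ideal[OF E] by blast
qed

text \<open>For c the transform of \<open>p\<close> at \<mu>, the second factor is the function h of
  the overview, written as c e - e * p. The claim is linearity together with g * e = f0 and g * (e *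
  p) = f0 * p; the work lies in the integrability that linearity requires.\<close>

lemma convol_corrector:
  assumes p: "test_fun p" and r: "r > 0"
  shows "convol (resolvend_fun f\<^sub>0 \<mu>) (\<lambda>t. c * exp_kernel \<mu> t - convol (exp_kernel \<mu>) p t) r
    = c * f\<^sub>0 r - convol f\<^sub>0 p r"
proof -
  note g = A.generating_functionD[OF gen]
  let ?g = "resolvend_fun f\<^sub>0 \<mu>" and ?q = "convol (exp_kernel \<mu>) p"
  have gm: "?g \<in> borel_measurable half_line" by (rule L1w_measurable[OF g(5)])
  have qm: "?q \<in> borel_measurable half_line"
    by (rule convol_measurable[OF exp_kernel_measurable test_fun_measurable[OF p]])
  have hm: "(\<lambda>t. c * exp_kernel \<mu> t - ?q t) \<in> borel_measurable half_line"
    using qm exp_kernel_measurable by (intro borel_measurable_diff borel_measurable_times borel_measurable_const)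
  obtain K where K: "\<And>r. cmod (?q r) \<le> K * cmod (exp_kernel \<mu> r)" "K \<ge> 0"
    by (rule convol_exp_kernel_test[OF p, of \<mu>]) blast
  have sm: "(\<lambda>s. indicat_real {..r} s *\<^sub>R ?g (r - s)) \<in> borel_measurable half_line"
    by (intro half_line_measurable_lborel borel_measurable_continuous_on_indicator
        continuous_on_compose2[OF continuous_resolvend_fun[OF g(1)]] continuous_intros) auto
  have "bounded (?g ` {0..r})" "bounded (exp_kernel \<mu> ` {0..r})"
    by (intro compact_imp_bounded compact_continuous_image continuous_on_subset[OF continuous_resolvend_fun[OF g(1)]]
        continuous_exp_kernel; auto)+
  then obtain G E where "\<forall>y\<in>?g ` {0..r}. norm y \<le> G" "\<forall>y\<in>exp_kernel \<mu> ` {0..r}. norm y \<le> E"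
    unfolding bounded_iff by auto
  then have G: "\<And>t. 0 \<le> t \<Longrightarrow> t \<le> r \<Longrightarrow> cmod (?g t) \<le> \<bar>G\<bar>"
    and E: "\<And>t. 0 \<le> t \<Longrightarrow> t \<le> r \<Longrightarrow> cmod (exp_kernel \<mu> t) \<le> \<bar>E\<bar>" by force+
  have int: "integrable half_line (\<lambda>s. indicat_real {..r} s *\<^sub>R (?g (r - s) * k s))"
    if k: "k \<in> borel_measurable half_line" and kb: "\<And>s. 0 \<le> s \<Longrightarrow> s \<le> r \<Longrightarrow> cmod (k s) \<le> L" for k L
  proof (rule integrable_half_line_bounded)
    have "(\<lambda>s. (indicat_real {..r} s *\<^sub>R ?g (r - s)) * k s) \<in> borel_measurable half_line"
      by (rule borel_measurable_times[OF sm k])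
    then show "(\<lambda>s. indicat_real {..r} s *\<^sub>R (?g (r - s) * k s)) \<in> borel_measurable half_line" by simp
    show "cmod (indicat_real {..r} s *\<^sub>R (?g (r - s) * k s)) \<le> (\<bar>G\<bar> * L) * indicat_real {..r} s" if "s > 0" for s
    proof (cases "s \<le> r")
      case True
      then have "cmod (?g (r - s)) * cmod (k s) \<le> \<bar>G\<bar> * L" using that by (intro mult_mono G kb) auto
      then show ?thesis using True by (simp add: norm_mult)
    qed simp
  qed
  have iE: "integrable half_line (\<lambda>s. indicat_real {..r} s *\<^sub>R (?g (r - s) * exp_kernel \<mu> s))"
    by (rule int[OF exp_kernel_measurable E])
  have iq: "integrable half_line (\<lambda>s. indicat_real {..r} s *\<^sub>R (?g (r - s) * ?q s))"
  proof (rule int[OF qm])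
    fix s assume "0 \<le> s" "s \<le> r"
    then show "cmod (?q s) \<le> K * \<bar>E\<bar>" using order_trans[OF K(1) mult_left_mono[OF E K(2)]] by blast
  qed
  have "convol ?g (\<lambda>t. c * exp_kernel \<mu> t - ?q t) r = (LINT s|half_line.
      c * (indicat_real {..r} s *\<^sub>R (?g (r - s) * exp_kernel \<mu> s)) - indicat_real {..r} s *\<^sub>R (?g (r - s) * ?q s))"
    unfolding convol_half_line[OF gm hm]
    by (intro Bochner_Integration.integral_cong refl) (simp add: indicator_def algebra_simps)
  also have "\<dots> = c * convol ?g (exp_kernel \<mu>) r - convol ?g ?q r"
    unfolding convol_half_line[OF gm exp_kernel_measurable] convol_half_line[OF gm qm]
    by (subst Bochner_Integration.integral_diff[OF integrable_mult_right[OF iE] iq]) (simp only: integral_mult_right_zero)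
  also have "convol ?g (exp_kernel \<mu>) r = f\<^sub>0 r" by (rule convol_resolvend_exp[OF g(1,2)]) (use r in simp)
  also have "convol ?g ?q r = convol f\<^sub>0 p r" by (rule convol_resolvend_assoc[OF g(1,2) p])
  finally show ?thesis .
qed

text \<open>The two exponential tails cancel beyond the support of \<open>p\<close>, so the function
  is bounded with bounded support. It need not vanish at 0, and the boundedness of \<open>TB\<close>
  there makes it admissible.\<close>

lemma corrector_L1w:
  assumes p: "test_fun p"
  shows "(\<lambda>t. laplace p \<mu> * exp_kernel \<mu> t - convol (exp_kernel \<mu>) p t) \<in> L1w (weight TB)"
proof -
  let ?q = "convol (exp_kernel \<mu>) p" and ?c = "laplace p \<mu>"
  obtain b K where bK: "\<And>r. r \<ge> b \<Longrightarrow> ?q r = ?c * exp_kernel \<mu> r"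
    "\<And>r. cmod (?q r) \<le> K * cmod (exp_kernel \<mu> r)" "K \<ge> 0" "b > 0"
    by (rule convol_exp_kernel_test[OF p, of \<mu>]) blast
  obtain M where M: "\<And>t. 0 < t \<Longrightarrow> t \<le> b \<Longrightarrow> weight TB t \<le> M" using TB_bounded_near_zero by blast
  have "bounded (exp_kernel \<mu> ` {0..b})"
    by (intro compact_imp_bounded compact_continuous_image continuous_exp_kernel) simp
  then obtain E where "\<forall>t\<in>{0..b}. cmod (exp_kernel \<mu> t) \<le> E" unfolding bounded_iff by auto
  then have E: "\<And>t. 0 \<le> t \<Longrightarrow> t \<le> b \<Longrightarrow> cmod (exp_kernel \<mu> t) \<le> E" by simp
  have "?q \<in> borel_measurable half_line"
    by (rule convol_measurable[OF exp_kernel_measurable test_fun_measurable[OF p]])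
  then have hm: "(\<lambda>t. ?c * exp_kernel \<mu> t - ?q t) \<in> borel_measurable half_line"
    using exp_kernel_measurable by (intro borel_measurable_diff borel_measurable_times borel_measurable_const)
  have z: "?c * exp_kernel \<mu> t - ?q t = 0" if "t > b" for t using bK(1)[of t] that by simp
  show ?thesis
  proof (rule L1w_integrable_bounded[OF B.weight_fun_T])
    show "integrable half_line (\<lambda>t. ?c * exp_kernel \<mu> t - ?q t)"
    proof (rule integrable_half_line_bounded[OF hm])
      fix s :: real assume s: "s > 0"
      show "cmod (?c * exp_kernel \<mu> s - ?q s) \<le> ((cmod ?c + K) * E) * indicat_real {..b} s"
      proof (cases "s \<le> b")
        case True
        have "cmod (?c * exp_kernel \<mu> s - ?q s) \<le> cmod (?c * exp_kernel \<mu> s) + cmod (?q s)" by (rule norm_triangle_ineq4)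
        also have "\<dots> \<le> (cmod ?c + K) * cmod (exp_kernel \<mu> s)" using bK(2)[of s] by (simp add: norm_mult distrib_right)
        also have "\<dots> \<le> (cmod ?c + K) * E" using E[of s] s True bK(3) by (intro mult_left_mono) auto
        finally show ?thesis using True by simp
      qed (use z in auto)
    qed
    show "weight TB t \<le> M" if "t > 0" "?c * exp_kernel \<mu> t - ?q t \<noteq> 0" for t
      using M[OF that(1)] z[of t] that(2) by (cases "t \<le> b") auto
  qed
qed

text \<open>With c the transform of \<open>p\<close> at \<mu>, P = \<Phi>(p) and H = \<Phi>(h) on
  the normalization, the resolvent should be (c - P)^(-1) H. The norm of \<open>P\<close> is less
  than |c| because passing to the normalization does not increase it.\<close>

lemma Res_ar_resolvent:
  assumes mu: "\<mu> \<in> Res_ar T f\<^sub>0"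
  shows "\<exists>R. is_resolvent \<mu> R"
proof -
  obtain p where p: "test_fun p" "norm (Phi T p) < cmod (laplace p \<mu>)" using mu A.Res_ar_iff[OF gen] by blast
  note g = A.generating_functionD[OF gen]
  note gB = L1w_TB[OF g(5)[of \<mu>]] and fB = L1w_TB[OF g(3)]
  define c where "c = laplace p \<mu>"
  define h where "h t = c * exp_kernel \<mu> t - convol (exp_kernel \<mu>) p t" for t
  have hL: "h \<in> L1w (weight TB)" unfolding h_def[abs_def] c_def by (rule corrector_L1w[OF p(1)])
  have pL: "p \<in> L1w (weight TB)" by (rule test_fun_L1w[OF B.weight_fun_T p(1)])
  define H where "H = Phi TB h"
  define P where "P = Phi TB p"
  define G where "G = Phi TB (resolvend_fun f\<^sub>0 \<mu>)"
  have nP: "norm P < cmod c"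
    unfolding P_def c_def using norm_Phi_TB_le[OF test_fun_L1w[OF A.weight_fun_T p(1)]] p(2) by simp
  then have c0: "c \<noteq> 0" using norm_ge_zero[of P] by auto
  have HI: "H \<in> arveson_ideal TB" and PI: "P \<in> arveson_ideal TB" and GI: "G \<in> arveson_ideal TB"
    unfolding H_def P_def G_def by (intro B.Phi_in_ideal hL pL gB)+
  have "Phi TB (convol (resolvend_fun f\<^sub>0 \<mu>) h) = Phi TB (\<lambda>t. c * f\<^sub>0 t - convol f\<^sub>0 p t)"
    by (rule B.Phi_cong[OF L1w_convol[OF B.weight_fun_T gB hL]
          L1w_diff[OF B.weight_fun_T L1w_scale[OF B.weight_fun_T fB] L1w_convol[OF B.weight_fun_T fB pL]]])
      (simp only: h_def[abs_def] convol_corrector[OF p(1)])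
  then have GH: "G o\<^sub>L H = c *\<^sub>C Phi TB f\<^sub>0 - (Phi TB f\<^sub>0 o\<^sub>L P)"
    unfolding G_def H_def P_def
    by (simp only: B.Phi_convol[OF gB hL] B.Phi_diff[OF L1w_scale[OF B.weight_fun_T fB] L1w_convol[OF B.weight_fun_T fB pL]]
        B.Phi_scale[OF fB] B.Phi_convol[OF fB pL])
  \<comment> \<open>The contraction principle replaces the Neumann series, and keeps the solution of
    c R = H + P R inside the closed ideal without appeal to a unit.\<close>
  have "\<exists>!R\<in>arveson_ideal TB. (1 / c) *\<^sub>C (H + (P o\<^sub>L R)) = R"
  proof (rule Banach_fix)
    show "complete (arveson_ideal TB)" using B.closed_ideal by (simp add: complete_eq_closed)
    show "arveson_ideal TB \<noteq> {}" using HI by blast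
    show "norm P / cmod c < 1" using nP by (simp add: divide_less_eq)
    show "0 \<le> norm P / cmod c" by simp
    show "(\<lambda>R. (1 / c) *\<^sub>C (H + (P o\<^sub>L R))) ` arveson_ideal TB \<subseteq> arveson_ideal TB"
      using HI PI B.ideal_add B.ideal_compose B.ideal_scale by blast
    show "dist ((1 / c) *\<^sub>C (H + (P o\<^sub>L R))) ((1 / c) *\<^sub>C (H + (P o\<^sub>L S))) \<le> norm P / cmod c * dist R S" for R S
    proof -
      have "(1 / c) *\<^sub>C (H + (P o\<^sub>L R)) - (1 / c) *\<^sub>C (H + (P o\<^sub>L S)) = (1 / c) *\<^sub>C (P o\<^sub>L (R - S))"
        by (simp add: bounded_bilinear.diff_right[OF bounded_bilinear_scaleC, symmetric]
            bounded_bilinear.diff_right[OF bounded_bilinear_blinfun_compose])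
      then have "dist ((1 / c) *\<^sub>C (H + (P o\<^sub>L R))) ((1 / c) *\<^sub>C (H + (P o\<^sub>L S))) = cmod (1 / c) * norm (P o\<^sub>L (R - S))"
        by (simp only: dist_norm norm_scaleC)
      also have "\<dots> \<le> cmod (1 / c) * (norm P * norm (R - S))" by (intro mult_left_mono norm_blinfun_compose) simp
      finally show ?thesis by (simp add: norm_divide dist_norm)
    qed
  qed
  then obtain R where RI: "R \<in> arveson_ideal TB" and Rf: "(1 / c) *\<^sub>C (H + (P o\<^sub>L R)) = R" by blast
  have "c *\<^sub>C ((1 / c) *\<^sub>C (H + (P o\<^sub>L R))) = H + (P o\<^sub>L R)" using c0 by (simp add: scaleC_scaleC scaleC_one)
  then have cR: "c *\<^sub>C R = H + (P o\<^sub>L R)" unfolding Rf .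
  define y where "y = blinfun_apply R (blinfun_apply G (j u\<^sub>0))"
  have jv: "blinfun_apply (Phi TB f\<^sub>0) (j u\<^sub>0) = j v\<^sub>0" by (rule Phi_TB_j[OF g(3)])
  have "c *\<^sub>C y = blinfun_apply (c *\<^sub>C R) (blinfun_apply G (j u\<^sub>0))" unfolding y_def by (simp add: scaleC_blinfun.rep_eq)
  also have "\<dots> = blinfun_apply (H o\<^sub>L G) (j u\<^sub>0) + blinfun_apply P y" unfolding cR y_def by (simp add: blinfun.add_left)
  also have "H o\<^sub>L G = c *\<^sub>C Phi TB f\<^sub>0 - (P o\<^sub>L Phi TB f\<^sub>0)"
    using GH B.ideal_commute[OF HI GI] B.ideal_commute[OF PI B.Phi_in_ideal[OF fB]] by simp
  also have "blinfun_apply \<dots> (j u\<^sub>0) = c *\<^sub>C j v\<^sub>0 - blinfun_apply P (j v\<^sub>0)"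
    by (simp add: blinfun.diff_left scaleC_blinfun.rep_eq jv)
  finally have "c *\<^sub>C (y - j v\<^sub>0) = blinfun_apply P (y - j v\<^sub>0)"
    by (simp add: bounded_bilinear.diff_right[OF bounded_bilinear_scaleC] blinfun.diff_right)
  \<comment> \<open>As the norm of \<open>P\<close> is strictly below |c|, the difference has to
    vanish.\<close>
  then have "cmod c * norm (y - j v\<^sub>0) \<le> norm P * norm (y - j v\<^sub>0)" by (metis norm_blinfun norm_scaleC)
  then have "y = j v\<^sub>0" using nP by (metis eq_iff_diff_eq_0 linorder_not_less mult_less_cancel_right norm_ge_zero norm_le_zero_iff)
  then have "is_resolvent \<mu> R" unfolding is_resolvent_def using RI by (simp add: y_def G_def resolvend_j)
  then show ?thesis by blast
qed

text \<open>Both sides are compared at \<open>j v\<^sub>0\<close>. Inserting the defining equation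
  of each resolvent expresses S(j v0) and R(j v0) through S R (j v0) and S R (j w0), and the w0
  terms cancel in the difference.\<close>

lemma resolvent_identity:
  assumes R: "is_resolvent \<mu> R" and S: "is_resolvent \<nu> S"
  shows "S - R = (\<mu> - \<nu>) *\<^sub>C (S o\<^sub>L R)"
proof (rule multiplier_eqI[OF v0])
  have RI: "R \<in> arveson_ideal TB" and SI: "S \<in> arveson_ideal TB" using R S unfolding is_resolvent_def by auto
  have Rm: "R \<in> multipliers" and Sm: "S \<in> multipliers" using RI SI B.ideal_multipliers by auto
  show "S - R \<in> multipliers"
    using multipliers_add[OF Sm multipliers_scaleC[OF Rm, of "-1"]] by (simp add: scaleC_minus1)
  show "(\<mu> - \<nu>) *\<^sub>C (S o\<^sub>L R) \<in> multipliers" by (intro multipliers_scaleC multipliers_compose Sm Rm)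
  have eR: "blinfun_apply R (\<mu> *\<^sub>C j v\<^sub>0 + j w\<^sub>0) = j v\<^sub>0" and eS: "blinfun_apply S (\<nu> *\<^sub>C j v\<^sub>0 + j w\<^sub>0) = j v\<^sub>0"
    using R S unfolding is_resolvent_def by (simp_all add: j_add j_scale)
  have com: "blinfun_apply R (blinfun_apply S x) = blinfun_apply S (blinfun_apply R x)" for x
    using arg_cong[OF B.ideal_commute[OF RI SI], of "\<lambda>Z. blinfun_apply Z x"] by simp
  define x y where "x = blinfun_apply S (blinfun_apply R (j v\<^sub>0))" and "y = blinfun_apply S (blinfun_apply R (j w\<^sub>0))"
  have Sv: "blinfun_apply S (j v\<^sub>0) = \<mu> *\<^sub>C x + y"
    by (subst eR[symmetric]) (simp add: x_def y_def blinfun.add_right multipliersD(1)[OF Rm] multipliersD(1)[OF Sm])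
  have Rv: "blinfun_apply R (j v\<^sub>0) = \<nu> *\<^sub>C x + y"
    by (subst eS[symmetric]) (simp add: x_def y_def blinfun.add_right multipliersD(1)[OF Rm] multipliersD(1)[OF Sm] com)
  have "blinfun_apply (S - R) (j v\<^sub>0) = \<mu> *\<^sub>C x - \<nu> *\<^sub>C x"
    by (simp add: blinfun.diff_left Sv Rv)
  also have "\<dots> = (\<mu> - \<nu>) *\<^sub>C x" by (simp add: bounded_bilinear.diff_left[OF bounded_bilinear_scaleC])
  finally show "blinfun_apply (S - R) (j v\<^sub>0) = blinfun_apply ((\<mu> - \<nu>) *\<^sub>C (S o\<^sub>L R)) (j v\<^sub>0)"
    by (simp add: scaleC_blinfun.rep_eq x_def)
qed

text \<open>The resolvent identity first bounds the resolvents near \<mu>, then gives a Lipschitz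
  estimate, and applied once more a remainder of second order.\<close>

lemma resolvent_holomorphic:
  assumes F: "\<And>\<mu>. \<mu> \<in> U \<Longrightarrow> is_resolvent \<mu> (F \<mu>)" and U: "open U"
  shows "holomorphic_into F U (arveson_ideal TB)"
  unfolding holomorphic_into_def
proof (intro conjI ballI)
  show "F ` U \<subseteq> arveson_ideal TB" using F unfolding is_resolvent_def by blast
  fix \<mu> assume mu: "\<mu> \<in> U"
  have near: "\<forall>\<^sub>F \<nu> in at \<mu>. \<nu> \<in> U" using U mu by (rule eventually_at_in_open')
  define N where "N = norm (F \<mu>)"
  have id: "F \<nu> - F \<mu> = (\<mu> - \<nu>) *\<^sub>C (F \<nu> o\<^sub>L F \<mu>)" if "\<nu> \<in> U" for \<nu>
    by (rule resolvent_identity[OF F[OF mu] F[OF that]])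
  \<comment> \<open>The increment is at most |\<nu> - \<mu>| N times the norm of F(\<nu>) itself.
    Once that coefficient is at most 1/2 it can be absorbed, so no continuity has to be known
    beforehand.\<close>
  have bound: "norm (F \<nu>) \<le> 2 * N" if nu: "\<nu> \<in> U" "cmod (\<nu> - \<mu>) * N \<le> 1 / 2" for \<nu>
  proof -
    have "norm (F \<nu> - F \<mu>) \<le> cmod (\<nu> - \<mu>) * (norm (F \<nu>) * N)"
      unfolding id[OF nu(1)] norm_scaleC N_def norm_minus_commute[of \<mu>]
      by (intro mult_left_mono norm_blinfun_compose) simp
    also have "\<dots> = (cmod (\<nu> - \<mu>) * N) * norm (F \<nu>)" by (simp add: mult_ac)
    also have "\<dots> \<le> 1 / 2 * norm (F \<nu>)" by (intro mult_right_mono nu) simp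
    finally show ?thesis using norm_triangle_ineq2[of "F \<nu>" "F \<mu>"] unfolding N_def by linarith
  qed
  have lim0: "((\<lambda>\<nu>. cmod (\<nu> - \<mu>) * K) \<longlongrightarrow> 0) (at \<mu>)" for K
  proof -
    have "((\<lambda>\<nu>. cmod (\<nu> - \<mu>) * K) \<longlongrightarrow> cmod (\<mu> - \<mu>) * K) (at \<mu>)" by (intro tendsto_intros)
    then show ?thesis by simp
  qed
  have "\<forall>\<^sub>F \<nu> in at \<mu>. cmod (\<nu> - \<mu>) * N < 1 / 2" by (rule order_tendstoD(2)[OF lim0]) simp
  with near have good: "\<forall>\<^sub>F \<nu> in at \<mu>. \<nu> \<in> U \<and> norm (F \<nu>) \<le> 2 * N"
    by eventually_elim (use bound in auto)
  \<comment> \<open>The formal derivative of (\<mu> - \<Delta>)^(-1) in \<mu> is minus its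
    square.\<close>
  define D where "D = - (F \<mu> o\<^sub>L F \<mu>)"
  have D: "c *\<^sub>C D = - (c *\<^sub>C (F \<mu> o\<^sub>L F \<mu>))" for c
    unfolding D_def by (simp add: bounded_bilinear.minus_right[OF bounded_bilinear_scaleC])
  have "(F has_derivative (\<lambda>h. h *\<^sub>C D)) (at \<mu>)"
    unfolding has_derivative_at2
  proof
    show "bounded_linear (\<lambda>h. h *\<^sub>C D)" by (rule bounded_bilinear.bounded_linear_left[OF bounded_bilinear_scaleC])
    show "((\<lambda>\<nu>. (1 / norm (\<nu> - \<mu>)) *\<^sub>R (F \<nu> - (F \<mu> + (\<nu> - \<mu>) *\<^sub>C D))) \<longlongrightarrow> 0) (at \<mu>)"
    proof (rule Lim_null_comparison)
      show "((\<lambda>\<nu>. cmod (\<nu> - \<mu>) * (2 * N * N * N)) \<longlongrightarrow> 0) (at \<mu>)" by (rule lim0)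
      show "\<forall>\<^sub>F \<nu> in at \<mu>. norm ((1 / norm (\<nu> - \<mu>)) *\<^sub>R (F \<nu> - (F \<mu> + (\<nu> - \<mu>) *\<^sub>C D))) \<le> cmod (\<nu> - \<mu>) * (2 * N * N * N)"
        using good
      proof eventually_elim
        case (elim \<nu>)
        have i: "F \<nu> - F \<mu> = (\<mu> - \<nu>) *\<^sub>C (F \<nu> o\<^sub>L F \<mu>)" using id elim by blast
        have "(\<nu> - \<mu>) *\<^sub>C D = (\<mu> - \<nu>) *\<^sub>C (F \<mu> o\<^sub>L F \<mu>)"
          unfolding D by (simp add: bounded_bilinear.diff_left[OF bounded_bilinear_scaleC])
        then have "F \<nu> - (F \<mu> + (\<nu> - \<mu>) *\<^sub>C D) = (\<mu> - \<nu>) *\<^sub>C (F \<nu> o\<^sub>L F \<mu>) - (\<mu> - \<nu>) *\<^sub>C (F \<mu> o\<^sub>L F \<mu>)"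
          using i by (simp add: algebra_simps)
        also have "\<dots> = (\<mu> - \<nu>) *\<^sub>C ((F \<nu> - F \<mu>) o\<^sub>L F \<mu>)"
          by (simp add: bounded_bilinear.diff_right[OF bounded_bilinear_scaleC]
              bounded_bilinear.diff_left[OF bounded_bilinear_blinfun_compose])
        finally have "norm (F \<nu> - (F \<mu> + (\<nu> - \<mu>) *\<^sub>C D)) = cmod (\<mu> - \<nu>) * norm ((F \<nu> - F \<mu>) o\<^sub>L F \<mu>)"
          by (simp only: norm_scaleC)
        also have "\<dots> \<le> cmod (\<mu> - \<nu>) * (norm (F \<nu> - F \<mu>) * N)"
          unfolding N_def by (intro mult_left_mono norm_blinfun_compose) simp
        also have "\<dots> \<le> cmod (\<mu> - \<nu>) * ((cmod (\<mu> - \<nu>) * (2 * N * N)) * N)"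
        proof -
          have "norm (F \<nu> - F \<mu>) = cmod (\<mu> - \<nu>) * norm (F \<nu> o\<^sub>L F \<mu>)" unfolding i norm_scaleC ..
          also have "\<dots> \<le> cmod (\<mu> - \<nu>) * (norm (F \<nu>) * N)"
            unfolding N_def by (intro mult_left_mono norm_blinfun_compose) simp
          also have "\<dots> \<le> cmod (\<mu> - \<nu>) * (2 * N * N)"
            using elim by (intro mult_left_mono mult_right_mono) (auto simp: N_def)
          finally show ?thesis by (intro mult_left_mono mult_right_mono) (auto simp: N_def)
        qed
        finally have le: "norm (F \<nu> - (F \<mu> + (\<nu> - \<mu>) *\<^sub>C D)) \<le> cmod (\<nu> - \<mu>) * (cmod (\<nu> - \<mu>) * (2 * N * N * N))"
          by (simp add: norm_minus_commute mult_ac)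
        have "norm ((1 / norm (\<nu> - \<mu>)) *\<^sub>R (F \<nu> - (F \<mu> + (\<nu> - \<mu>) *\<^sub>C D))) = norm (F \<nu> - (F \<mu> + (\<nu> - \<mu>) *\<^sub>C D)) / cmod (\<nu> - \<mu>)"
          by simp
        also have "\<dots> \<le> cmod (\<nu> - \<mu>) * (2 * N * N * N)"
        proof (cases "\<nu> = \<mu>")
          case False
          then show ?thesis using le by (simp add: pos_divide_le_eq mult.commute)
        qed simp
        finally show ?case .
      qed
    qed
  qed
  then show "\<exists>D. (F has_derivative (\<lambda>h. h *\<^sub>C D)) (at \<mu>)" by blast
qed (rule U)

lemma exp_resolvent_integral:
  assumes s: "ereal_log (growth_rate T) < ereal (Re \<mu>)"
  shows "has_Bochner_integral half_line (\<lambda>s. exp (- \<mu> * complex_of_real s) *\<^sub>C blinfun_apply (TB s) b)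
      (blinfun_apply (Phi TB (exp_kernel \<mu>)) b)"
    and "integrable half_line (\<lambda>t. exp (- Re \<mu> * t) * norm (TB t))"
    and "norm (Phi TB (exp_kernel \<mu>)) \<le> (LINT t|half_line. exp (- Re \<mu> * t) * norm (TB t))"
proof -
  note E = exp_kernel_L1w[OF s]
  show "has_Bochner_integral half_line (\<lambda>s. exp (- \<mu> * complex_of_real s) *\<^sub>C blinfun_apply (TB s) b)
      (blinfun_apply (Phi TB (exp_kernel \<mu>)) b)"
    using B.Phi_has_integral[OF E, of b] unfolding exp_kernel_def .
  have m: "(\<lambda>t. exp (- Re \<mu> * t) * norm (TB t)) \<in> borel_measurable half_line"
  proof -
    have "(\<lambda>t. exp (- Re \<mu> * t) * weight TB t) \<in> borel_measurable half_line"
      by (intro borel_measurable_times B.weight_measurable half_line_measurable_lborel) measurable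
    then show ?thesis by (simp add: weight_def)
  qed
  have fin: "(\<integral>\<^sup>+ t. ennreal (exp (- Re \<mu> * t) * norm (TB t)) \<partial>half_line) < \<infinity>"
    using L1w_fin[OF E] unfolding cmod_exp_kernel weight_def .
  show i: "integrable half_line (\<lambda>t. exp (- Re \<mu> * t) * norm (TB t))"
    using fin by (intro integrableI_bounded m) simp
  show "norm (Phi TB (exp_kernel \<mu>)) \<le> (LINT t|half_line. exp (- Re \<mu> * t) * norm (TB t))"
  proof (rule B.Phi_norm_le[OF E])
    show "0 \<le> (LINT t|half_line. exp (- Re \<mu> * t) * norm (TB t))" by simp
    show "(\<integral>\<^sup>+ t. ennreal (cmod (exp_kernel \<mu> t) * weight TB t) \<partial>half_line)
      \<le> ennreal (LINT t|half_line. exp (- Re \<mu> * t) * norm (TB t))"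
      unfolding cmod_exp_kernel weight_def using nn_integral_eq_integral[OF i] by simp
  qed
qed

end

end

text \<open>The generator is formed from an arbitrary admissible pair \<open>f\<^sub>0\<close>,
  \<open>u\<^sub>0\<close>. Membership of a quasimultiplier in an algebra of operators on the
  normalization is expressed by \<open>represents\<close>, which determines the multiplier
  uniquely.\<close>

theorem proposition6p1:
  fixes T :: "real \<Rightarrow> 'a::comm_cbanach_algebra \<Rightarrow>\<^sub>L 'a"
    and \<iota> :: "'b::comm_cbanach_algebra \<Rightarrow> ('a \<times> 'a) set"
    and f\<^sub>0 :: "real \<Rightarrow> complex" and u\<^sub>0 :: 'a
  assumes "weakly_cancellative (UNIV :: 'a set) (*)"
    and "dense_principal_ideals (UNIV :: 'a set) (*)"
    and "multiplier_semigroup T" and "strongly_continuous T"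
    and "\<And>t. t > 0 \<Longrightarrow> closure (range (blinfun_apply (T t))) = UNIV"
    and "normalization T \<iota>"
    and "generating_function T f\<^sub>0" and "u\<^sub>0 \<in> Omega UNIV (*)"
  shows "(\<forall>\<mu>\<in>Res_ar T f\<^sub>0.
            qm_invertible UNIV (*) (qm_resolvend UNIV (*) \<mu> (generator T f\<^sub>0 u\<^sub>0)) \<and>
            (\<exists>R\<in>arveson_ideal (semigroup_on \<iota> T).
               represents \<iota> (qm_inverse UNIV (*) (qm_resolvend UNIV (*) \<mu> (generator T f\<^sub>0 u\<^sub>0))) R))
       \<and> arveson_ideal (semigroup_on \<iota> T) \<subseteq> multipliers
       \<and> (\<forall>R\<in>multipliers. \<exists>S\<in>QM_reg UNIV (*). represents \<iota> S R)
       \<and> holomorphic_into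
            (\<lambda>\<mu>. to_multiplier \<iota>
                   (qm_inverse UNIV (*) (qm_resolvend UNIV (*) \<mu> (generator T f\<^sub>0 u\<^sub>0))))
            (Res_ar T f\<^sub>0) (arveson_ideal (semigroup_on \<iota> T))
       \<and> (\<forall>\<mu>. ereal_log (growth_rate T) < ereal (Re \<mu>) \<longrightarrow>
            qm_invertible UNIV (*) (qm_resolvend UNIV (*) \<mu> (generator T f\<^sub>0 u\<^sub>0)) \<and>
            (\<exists>R\<in>arveson_ideal (semigroup_on \<iota> T).
               represents \<iota> (qm_inverse UNIV (*) (qm_resolvend UNIV (*) \<mu> (generator T f\<^sub>0 u\<^sub>0))) R \<and>
               (\<forall>b. has_Bochner_integral half_line
                      (\<lambda>s. exp (- \<mu> * complex_of_real s) *\<^sub>C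
                             blinfun_apply (semigroup_on \<iota> T s) b)
                      (blinfun_apply R b)) \<and>
               integrable half_line (\<lambda>t. exp (- Re \<mu> * t) * norm (semigroup_on \<iota> T t)) \<and>
               norm R \<le> (LINT t|half_line. exp (- Re \<mu> * t) * norm (semigroup_on \<iota> T t))))"
proof -
  interpret N: semigroup_normalization T \<iota>
    by (intro semigroup_normalization.intro wc_algebra.intro semigroup_normalization_axioms.intro assms)
  note gu = assms(7,8)
  have res: "\<exists>R. N.is_resolvent f\<^sub>0 u\<^sub>0 \<mu> R" if "\<mu> \<in> Res_ar T f\<^sub>0" for \<mu>
    by (rule N.Res_ar_resolvent[OF gu that])
  have ideal: "N.is_resolvent f\<^sub>0 u\<^sub>0 \<mu> R \<Longrightarrow> R \<in> arveson_ideal (semigroup_on \<iota> T)" for \<mu> R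
    unfolding N.is_resolvent_def[OF gu] by blast
  show ?thesis
  proof (intro conjI ballI allI impI)
    fix \<mu> assume "\<mu> \<in> Res_ar T f\<^sub>0"
    then obtain R where R: "N.is_resolvent f\<^sub>0 u\<^sub>0 \<mu> R" using res by blast
    show "qm_invertible UNIV (*) (qm_resolvend UNIV (*) \<mu> (generator T f\<^sub>0 u\<^sub>0))"
      by (rule N.resolvent_represents(1)[OF gu R])
    show "\<exists>R\<in>arveson_ideal (semigroup_on \<iota> T).
        represents \<iota> (qm_inverse UNIV (*) (qm_resolvend UNIV (*) \<mu> (generator T f\<^sub>0 u\<^sub>0))) R"
      using N.resolvent_represents(2)[OF gu R] ideal[OF R] by blast
  next
    show "arveson_ideal (semigroup_on \<iota> T) \<subseteq> multipliers" by (rule N.B.ideal_multipliers)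
    show "\<exists>S\<in>QM_reg UNIV (*). represents \<iota> S R" if "R \<in> multipliers" for R
      by (rule N.multiplier_represented[OF that])
    show "holomorphic_into (\<lambda>\<mu>. to_multiplier \<iota>
        (qm_inverse UNIV (*) (qm_resolvend UNIV (*) \<mu> (generator T f\<^sub>0 u\<^sub>0))))
        (Res_ar T f\<^sub>0) (arveson_ideal (semigroup_on \<iota> T))"
      by (rule N.resolvent_holomorphic[OF gu _ N.A.open_Res_ar[OF assms(7)]])
        (use res N.resolvent_represents(3)[OF gu] in metis)
  next
    fix \<mu> assume s: "ereal_log (growth_rate T) < ereal (Re \<mu>)"
    note R = N.exp_resolvent[OF gu s]
    show "qm_invertible UNIV (*) (qm_resolvend UNIV (*) \<mu> (generator T f\<^sub>0 u\<^sub>0))"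
      by (rule N.resolvent_represents(1)[OF gu R])
    show "\<exists>R\<in>arveson_ideal (semigroup_on \<iota> T).
               represents \<iota> (qm_inverse UNIV (*) (qm_resolvend UNIV (*) \<mu> (generator T f\<^sub>0 u\<^sub>0))) R \<and>
               (\<forall>b. has_Bochner_integral half_line
                      (\<lambda>s. exp (- \<mu> * complex_of_real s) *\<^sub>C
                             blinfun_apply (semigroup_on \<iota> T s) b)
                      (blinfun_apply R b)) \<and>
               integrable half_line (\<lambda>t. exp (- Re \<mu> * t) * norm (semigroup_on \<iota> T t)) \<and>
               norm R \<le> (LINT t|half_line. exp (- Re \<mu> * t) * norm (semigroup_on \<iota> T t))"
      using ideal[OF R] N.resolvent_represents(2)[OF gu R] N.exp_resolvent_integral[OF gu s] by blast
  qed
qed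

end
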